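(* For all $w,v\in W$, \[ \langle C_w,\widetilde C_v\rangle=\delta^{Kr}_{w,v}\prod_{\alpha\in\Sigma^+}\bigl(t-t^{-1}e^{-\alpha}\bigr). \]
   Context: Root data. Let $G$ be a semisimple simply connected complex linear algebraic group, $T\subset B$ a maximal torus inside a Borel subgroup, and $X^*(T)$ the character lattice. Let $W=N_G(T)/T$ be the Weyl group, $\Sigma$ the roots, $\Sigma^+$ the positive roots (the roots of $B$), $\Sigma^-=-\Sigma^+$, and $\Pi=\{\alpha_1,\dots,\alpha_n\}$ the simple roots. Write $s_i$ for the simple reflections, $\ell$ for the length function, $\le$ for the Bruhat order, $\epsilon_w=(-1)^{\ell(w)}$, and $w_0$ for the longest element of $W$. Twisted group algebra. Take $R=\mathbb Z[t,t^{-1},(t+t^{-1})^{-1}]$ and the multiplicative formal group law $F_m(x,y)=x+y-xy$. Let $S_m=R[[X^*(T)]]_{F_m}$, with $x_\lambda=1-e^{-\lambda}$, and let $Q_m=S_m[1/x_\alpha:\alpha\in\Sigma^+]$. Let $Q_{m,W}$ be the free left $Q_m$-module with basis $\{\delta^m_w\}_{w\in W}$, with product $(p\delta^m_w)(p'\delta^m_{w'})=p\,w(p')\,\delta^m_{ww'}$. Let $x_\Pi=\prod_{\alpha\in\Sigma^-}x_\alpha$. Dual and actions. Let $Q^*_{m,W}$ be the ring of functions $W\to Q_m$ under pointwise product, with basis $f^m_w$ (the indicator of $w$). Two actions of $Q_{m,W}$ on $Q^*_{m,W}$ are defined by - $(p\delta_v)\bullet(qf_w)=q\,wv^{-1}(p)\,f_{wv^{-1}}$,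 - $(p\delta_v)\odot(qf_w)=p\,v(q)\,f_{vw}$. Set $\mathrm{pt}^m_w:=w(x_\Pi)f^m_w$. Hecke algebra and Kazhdan–Lusztig elements. The Demazure–Lusztig elements are \[ \tau_i=\frac{t^{-1}-t}{1-e^{-\alpha_i}}+\frac{t-t^{-1}e^{-\alpha_i}}{1-e^{-\alpha_i}}\,\delta^m_{s_i}. \] They satisfy the quadratic relation $\tau_i^2=(t^{-1}-t)\tau_i+1$ and the braid relations, and they generate the Hecke algebra $H$. For a reduced word $w=s_{i_1}\cdots s_{i_k}$ set $\tau_w=\tau_{i_1}\cdots\tau_{i_k}$, and set $t_w=t^{\ell(w)}$. Let $P_{v,w}$ be the Kazhdan–Lusztig polynomials, with $P_{v,w}=0$ unless $v\le w$. Define \[ \gamma_w=\sum_{v\le w}t_wt_v^{-1}P_{v,w}(t^{-2})\tau_v,\qquad \widetilde\gamma_w=\sum_{v}\epsilon_w\epsilon_vt_w^{-1}t_vP_{v,w}(t^2)\tau_v. \] KL classes. Define \[ C_w:=\gamma_w\odot\mathrm{pt}^m_e,\qquad \widetilde C_w:=\widetilde\gamma_{w^{-1}w_0}\bullet\mathrm{pt}^m_{w_0}. \] These are viewed as classes in $K_T(G/B)[t^{\pm1}]$ via the standard identification of $K_T(G/B)$ with a subring of $Q^*_{m,W}$ by restriction to $T$-fixed points: the coefficient of $f^m_w$ is the restriction to $wB$, and $\mathrm{pt}^m_w$ is the class of the fixed point $wB$. Pairing. $\langle f,g\rangle$ is the equivariant Euler characteristic pairing on $K_T(G/B)[t^{\pm1}]$,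 i.e. $\langle f,g\rangle=Y_\Pi\bullet(fg)$. In fixed-point terms, \[ \langle f,g\rangle=\sum_{w\in W}\frac{f|_w\,g|_w}{w(x_\Pi)}. \] *)

theory Defs
  imports "HOL-Computational_Algebra.Polynomial" "HOL-Library.Function_Algebras"
begin

(* Root datum of a simply connected semisimple group, encoded by its Cartan matrix.
   Weights are written in the basis of fundamental weights: lam :: 'i => int,
   lam i = <lam, alpha_i^vee>.  Convention: A i j = <alpha_j, alpha_i^vee>. *)

type_synonym 'i wt = "'i \<Rightarrow> int"
type_synonym 'i wg = "'i wt \<Rightarrow> 'i wt"

definition simple_root :: "('i \<Rightarrow> 'i \<Rightarrow> int) \<Rightarrow> 'i \<Rightarrow> 'i wt" where
  "simple_root A j = (\<lambda>i. A i j)"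

definition sref :: "('i \<Rightarrow> 'i \<Rightarrow> int) \<Rightarrow> 'i \<Rightarrow> 'i wg" where
  "sref A i = (\<lambda>lam. (\<lambda>k. lam k - lam i * A k i))"

definition word_elt :: "('i \<Rightarrow> 'i \<Rightarrow> int) \<Rightarrow> 'i list \<Rightarrow> 'i wg" where
  "word_elt A ws = foldr (\<lambda>i f. sref A i \<circ> f) ws id"

definition weyl :: "('i \<Rightarrow> 'i \<Rightarrow> int) \<Rightarrow> 'i wg set" where
  "weyl A = range (word_elt A)"

definition wlen :: "('i \<Rightarrow> 'i \<Rightarrow> int) \<Rightarrow> 'i wg \<Rightarrow> nat" where
  "wlen A w = (LEAST k. \<exists>ws. length ws = k \<and> word_elt A ws = w)"

definition reflections :: "('i \<Rightarrow> 'i \<Rightarrow> int) \<Rightarrow> 'i wg set" where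
  "reflections A = {u \<circ> sref A i \<circ> inv u | u i. u \<in> weyl A}"

definition bruhat_le :: "('i \<Rightarrow> 'i \<Rightarrow> int) \<Rightarrow> 'i wg \<Rightarrow> 'i wg \<Rightarrow> bool" where
  "bruhat_le A v w \<longleftrightarrow> v \<in> weyl A \<and>
     (\<lambda>a b. \<exists>r\<in>reflections A. b = a \<circ> r \<and> wlen A a < wlen A b)\<^sup>*\<^sup>* v w"

definition bruhat_lt :: "('i \<Rightarrow> 'i \<Rightarrow> int) \<Rightarrow> 'i wg \<Rightarrow> 'i wg \<Rightarrow> bool" where
  "bruhat_lt A v w \<longleftrightarrow> bruhat_le A v w \<and> v \<noteq> w"

definition longest :: "('i \<Rightarrow> 'i \<Rightarrow> int) \<Rightarrow> 'i wg" where
  "longest A = (THE w. w \<in> weyl A \<and> (\<forall>v\<in>weyl A. wlen A v \<le> wlen A w))"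

definition roots :: "('i \<Rightarrow> 'i \<Rightarrow> int) \<Rightarrow> 'i wt set" where
  "roots A = {w (simple_root A i) | w i. w \<in> weyl A}"

definition pos_roots :: "('i::finite \<Rightarrow> 'i \<Rightarrow> int) \<Rightarrow> 'i wt set" where
  "pos_roots A = {\<beta> \<in> roots A. \<exists>c::'i \<Rightarrow> int. (\<forall>j. 0 \<le> c j) \<and>
                      \<beta> = (\<lambda>k. \<Sum>j\<in>UNIV. c j * simple_root A j k)}"

definition neg_roots :: "('i::finite \<Rightarrow> 'i \<Rightarrow> int) \<Rightarrow> 'i wt set" where
  "neg_roots A = uminus ` pos_roots A"

definition finite_type_cartan :: "('i \<Rightarrow> 'i \<Rightarrow> int) \<Rightarrow> bool" where
  "finite_type_cartan A \<longleftrightarrow> (\<forall>i. A i i = 2) \<and> (\<forall>i j. i \<noteq> j \<longrightarrow> A i j \<le> 0)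
     \<and> (\<forall>i j. A i j = 0 \<longleftrightarrow> A j i = 0) \<and> finite (weyl A)"

(* Kazhdan--Lusztig polynomials (in q), characterised by the Kazhdan--Lusztig recursion *)
definition kl_mu :: "('i \<Rightarrow> 'i \<Rightarrow> int) \<Rightarrow> ('i wg \<Rightarrow> 'i wg \<Rightarrow> int poly) \<Rightarrow> 'i wg \<Rightarrow> 'i wg \<Rightarrow> int" where
  "kl_mu A P z v = (if bruhat_lt A z v \<and> odd (wlen A v - wlen A z)
      then coeff (P z v) ((wlen A v - wlen A z - 1) div 2) else 0)"

definition kl_family :: "('i \<Rightarrow> 'i \<Rightarrow> int) \<Rightarrow> ('i wg \<Rightarrow> 'i wg \<Rightarrow> int poly) \<Rightarrow> bool" where
  "kl_family A P \<longleftrightarrow>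
     (\<forall>x w. (x \<notin> weyl A \<or> w \<notin> weyl A \<or> \<not> bruhat_le A x w) \<longrightarrow> P x w = 0)
   \<and> P id id = 1
   \<and> (\<forall>x\<in>weyl A. \<forall>w\<in>weyl A. \<forall>i. wlen A (sref A i \<circ> w) < wlen A w \<longrightarrow>
        (let s = sref A i; v = s \<circ> w;
             c = (if wlen A (s \<circ> x) < wlen A x then 1 else 0 :: nat) in
         P x w = [:0,1:] ^ (1 - c) * P (s \<circ> x) v + [:0,1:] ^ c * P x v
           - (\<Sum>z\<in>{z\<in>weyl A. bruhat_lt A z v \<and> wlen A (s \<circ> z) < wlen A z}.
                smult (kl_mu A P z v) ([:0,1:] ^ ((wlen A w - wlen A z) div 2) * P x z))))"

definition kl_poly :: "('i \<Rightarrow> 'i \<Rightarrow> int) \<Rightarrow> 'i wg \<Rightarrow> 'i wg \<Rightarrow> int poly" where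
  "kl_poly A = (THE P. kl_family A P)"

(* Twisted group algebra Q_{m,W} over a field 'k carrying a W-action act:
   h :: 'i wg => 'k stands for sum_v h(v) delta_v.  Dual Q^*_{m,W}: f :: 'i wg => 'k
   stands for sum_w f(w) f_w. *)

definition tmult :: "('i \<Rightarrow> 'i \<Rightarrow> int) \<Rightarrow> ('i wg \<Rightarrow> 'k::field \<Rightarrow> 'k) \<Rightarrow>
    ('i wg \<Rightarrow> 'k) \<Rightarrow> ('i wg \<Rightarrow> 'k) \<Rightarrow> ('i wg \<Rightarrow> 'k)" where
  "tmult A act h h' = (\<lambda>u. \<Sum>v\<in>weyl A. \<Sum>v'\<in>{v'\<in>weyl A. v \<circ> v' = u}. h v * act v (h' v'))"

definition delta_e :: "'i wg \<Rightarrow> 'k::field" where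
  "delta_e = (\<lambda>u. if u = id then 1 else 0)"

definition scal :: "'k::field \<Rightarrow> ('i wg \<Rightarrow> 'k) \<Rightarrow> ('i wg \<Rightarrow> 'k)" where
  "scal p h = (\<lambda>u. p * h u)"

definition dl_tau :: "('i \<Rightarrow> 'i \<Rightarrow> int) \<Rightarrow> 'k::field \<Rightarrow> ('i wt \<Rightarrow> 'k) \<Rightarrow> 'i \<Rightarrow> ('i wg \<Rightarrow> 'k)" where
  "dl_tau A t e i = (\<lambda>u.
     if u = sref A i then (t - inverse t * e (- simple_root A i)) / (1 - e (- simple_root A i))
     else if u = id then (inverse t - t) / (1 - e (- simple_root A i))
     else 0)"

definition red_word :: "('i \<Rightarrow> 'i \<Rightarrow> int) \<Rightarrow> 'i wg \<Rightarrow> 'i list" where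
  "red_word A w = (SOME ws. word_elt A ws = w \<and> length ws = wlen A w)"

definition tau_w :: "('i \<Rightarrow> 'i \<Rightarrow> int) \<Rightarrow> 'k::field \<Rightarrow> ('i wt \<Rightarrow> 'k) \<Rightarrow> ('i wg \<Rightarrow> 'k \<Rightarrow> 'k)
    \<Rightarrow> 'i wg \<Rightarrow> ('i wg \<Rightarrow> 'k)" where
  "tau_w A t e act w = foldr (\<lambda>i acc. tmult A act (dl_tau A t e i) acc) (red_word A w) delta_e"

definition kl_gamma :: "('i \<Rightarrow> 'i \<Rightarrow> int) \<Rightarrow> 'k::field \<Rightarrow> ('i wt \<Rightarrow> 'k) \<Rightarrow> ('i wg \<Rightarrow> 'k \<Rightarrow> 'k)
    \<Rightarrow> 'i wg \<Rightarrow> ('i wg \<Rightarrow> 'k)" where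
  "kl_gamma A t e act w = (\<lambda>u. \<Sum>v\<in>{v\<in>weyl A. bruhat_le A v w}.
     scal (t ^ wlen A w * inverse (t ^ wlen A v)
           * poly (map_poly of_int (kl_poly A v w)) (inverse t ^ 2)) (tau_w A t e act v) u)"

definition kl_gamma_tilde :: "('i \<Rightarrow> 'i \<Rightarrow> int) \<Rightarrow> 'k::field \<Rightarrow> ('i wt \<Rightarrow> 'k) \<Rightarrow> ('i wg \<Rightarrow> 'k \<Rightarrow> 'k)
    \<Rightarrow> 'i wg \<Rightarrow> ('i wg \<Rightarrow> 'k)" where
  "kl_gamma_tilde A t e act w = (\<lambda>u. \<Sum>v\<in>weyl A.
     scal ((-1) ^ wlen A w * (-1) ^ wlen A v * inverse (t ^ wlen A w) * t ^ wlen A v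
           * poly (map_poly of_int (kl_poly A v w)) (t ^ 2)) (tau_w A t e act v) u)"

(* (p delta_v) odot (q f_w) = p v(q) f_{vw} *)
definition odot :: "('i \<Rightarrow> 'i \<Rightarrow> int) \<Rightarrow> ('i wg \<Rightarrow> 'k::field \<Rightarrow> 'k) \<Rightarrow>
    ('i wg \<Rightarrow> 'k) \<Rightarrow> ('i wg \<Rightarrow> 'k) \<Rightarrow> ('i wg \<Rightarrow> 'k)" where
  "odot A act h f = (\<lambda>u. \<Sum>v\<in>weyl A. \<Sum>w\<in>{w\<in>weyl A. v \<circ> w = u}. h v * act v (f w))"

(* (p delta_v) bullet (q f_w) = q (w v^{-1})(p) f_{w v^{-1}} *)
definition bullet :: "('i \<Rightarrow> 'i \<Rightarrow> int) \<Rightarrow> ('i wg \<Rightarrow> 'k::field \<Rightarrow> 'k) \<Rightarrow>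
    ('i wg \<Rightarrow> 'k) \<Rightarrow> ('i wg \<Rightarrow> 'k) \<Rightarrow> ('i wg \<Rightarrow> 'k)" where
  "bullet A act h f = (\<lambda>u. \<Sum>v\<in>weyl A. \<Sum>w\<in>{w\<in>weyl A. u \<circ> v = w}. f w * act u (h v))"

definition x_Pi :: "('i::finite \<Rightarrow> 'i \<Rightarrow> int) \<Rightarrow> ('i wt \<Rightarrow> 'k::field) \<Rightarrow> 'k" where
  "x_Pi A e = (\<Prod>\<alpha>\<in>neg_roots A. 1 - e (- \<alpha>))"

definition pt :: "('i::finite \<Rightarrow> 'i \<Rightarrow> int) \<Rightarrow> ('i wg \<Rightarrow> 'k::field \<Rightarrow> 'k) \<Rightarrow> ('i wt \<Rightarrow> 'k)
    \<Rightarrow> 'i wg \<Rightarrow> ('i wg \<Rightarrow> 'k)" where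
  "pt A act e w = (\<lambda>u. if u = w then act w (x_Pi A e) else 0)"

definition KL_C :: "('i::finite \<Rightarrow> 'i \<Rightarrow> int) \<Rightarrow> 'k::field \<Rightarrow> ('i wt \<Rightarrow> 'k) \<Rightarrow> ('i wg \<Rightarrow> 'k \<Rightarrow> 'k)
    \<Rightarrow> 'i wg \<Rightarrow> ('i wg \<Rightarrow> 'k)" where
  "KL_C A t e act w = odot A act (kl_gamma A t e act w) (pt A act e id)"

definition KL_Ct :: "('i::finite \<Rightarrow> 'i \<Rightarrow> int) \<Rightarrow> 'k::field \<Rightarrow> ('i wt \<Rightarrow> 'k) \<Rightarrow> ('i wg \<Rightarrow> 'k \<Rightarrow> 'k)
    \<Rightarrow> 'i wg \<Rightarrow> ('i wg \<Rightarrow> 'k)" where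
  "KL_Ct A t e act w = bullet A act (kl_gamma_tilde A t e act (inv w \<circ> longest A))
       (pt A act e (longest A))"

(* equivariant Euler characteristic pairing, fixed-point form *)
definition pairing :: "('i::finite \<Rightarrow> 'i \<Rightarrow> int) \<Rightarrow> ('i wg \<Rightarrow> 'k::field \<Rightarrow> 'k) \<Rightarrow> ('i wt \<Rightarrow> 'k)
    \<Rightarrow> ('i wg \<Rightarrow> 'k) \<Rightarrow> ('i wg \<Rightarrow> 'k) \<Rightarrow> 'k" where
  "pairing A act e f g = (\<Sum>w\<in>weyl A. f w * g w / act w (x_Pi A e))"

end

theory Submission
  imports Defs "HOL-Library.Poly_Mapping"
begin

text \<open>
  In fixed-point coordinates the pairing is \<open>w\<^sub>0(x\<^sub>\<Pi>)\<close> times the coefficient of \<open>\<delta>\<close> at the longest element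
  \<open>w\<^sub>0\<close> in the product of the Kazhdan--Lusztig element of \<open>w\<close> and the dual one of \<open>v\<^sup>-\<^sup>1w\<^sub>0\<close>.
  Expanding the product in the \<open>\<tau>\<^sub>x\<close>, only \<open>\<tau>\<close> at \<open>w\<^sub>0\<close> contributes, and its leading coefficient is the product
  over the positive roots. What remains is an identity in the generic Hecke algebra: the coefficient
  of \<open>\<tau>\<close> at \<open>w\<^sub>0\<close> in this product is invariant under the bar involution and, by a direct computation, it lies in
  \<open>\<delta>\<^sub>w\<^sub>v + t\<int>[t]\<close>, so it equals \<open>\<delta>\<^sub>w\<^sub>v\<close>.

  The braid relations of the operators \<open>\<tau>\<^sub>i\<close> come from a rank two computation. It uses only
  that the weight \<open>p\<close> with \<open>\<tau>\<^sub>i + t = (1 + \<delta>\<^sub>i) p(\<alpha>\<^sub>i)\<close> satisfies \<open>p(-\<beta>) = c - p(\<beta>)\<close> and an addition formula,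
  where \<open>c = t + 1/t\<close>, so it also applies to the degenerate weight with values \<open>t\<close> and \<open>1/t\<close>, which gives the regular representation of the Hecke algebra.
\<close>

section \<open>Roots and the Weyl group\<close>

text \<open>Two notions of the statement rest on choices: \<open>tau_w\<close> on a reduced word,
  \<open>kl_poly\<close> on a unique description. So Matsumoto's theorem and the existence and
  uniqueness of the Kazhdan--Lusztig polynomials belong to the proof; since the root datum is just a
  matrix with finite \<open>weyl A\<close>, so do the signs of roots, exchange and the lifting
  property. Membership in \<delta> + tZ[t] comes from one identity: the coefficient at the longest
  element lo of T_x g is the bar conjugate of the coefficient of bar(g) at x^-1 lo. For bar
  invariant g this turns the product into a sum of products of two Kazhdan--Lusztig coefficients. In
  rank two the alternating words are not compared directly. With Chebyshev correction terms, both
  orders of the operators \<tau>_i + t give the same sum over the vertices of a 2m-gon. The maps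
  \<open>act u\<close> are ring endomorphisms known to compose correctly only on what t and the
  \<open>e lam\<close> generate. Elements are therefore written with coefficients to the right of
  \<delta>_u: left multiplication by \<tau>_i then involves the weight at u^-1 \<alpha>_i, and
  \<open>act\<close> disappears from the operators.\<close>

locale cartan_datum =
  fixes A :: "'i::finite \<Rightarrow> 'i \<Rightarrow> int"
  assumes finite_type: "finite_type_cartan A"
begin

abbreviation "W \<equiv> weyl A"
abbreviation "s \<equiv> sref A"
abbreviation "\<alpha> \<equiv> simple_root A"
abbreviation "len \<equiv> wlen A"
abbreviation "\<Phi> \<equiv> roots A"
abbreviation "\<Phi>pos \<equiv> pos_roots A"
abbreviation "elt \<equiv> word_elt A"
abbreviation "lo \<equiv> longest A"
abbreviation "desc i w \<equiv> len (s i \<circ> w) < len w"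

lemma cartan_diag [simp]: "A i i = 2"
  and cartan_off_diag: "i \<noteq> j \<Longrightarrow> A i j \<le> 0"
  and finite_weyl [simp]: "finite W"
  using finite_type unfolding finite_type_cartan_def by auto

lemma sref_sref [simp]: "s i (s i lam) = lam"
  by (rule ext) (simp add: sref_def)

lemma sref_o_sref [simp]: "s i \<circ> s i = id"
  by (rule ext) simp

lemma sref_o_sref_o [simp]: "s i \<circ> (s i \<circ> w) = w"
  by (rule ext) simp

lemma bij_sref: "bij (s i)"
  by (rule o_bij[of "s i"]) simp_all

lemma inv_sref [simp]: "inv (s i) = s i"
  by (rule inv_unique_comp) simp_all

lemma word_elt_Nil [simp]: "elt [] = id"
  and word_elt_Cons [simp]: "elt (i # ws) = s i \<circ> elt ws"
  by (simp_all add: word_elt_def)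

lemma word_elt_append: "elt (us @ ws) = elt us \<circ> elt ws"
  by (induction us) (simp_all add: o_assoc)

lemma bij_word_elt: "bij (elt ws)"
  by (induction ws) (simp_all only: word_elt_Nil word_elt_Cons bij_id bij_comp bij_sref)

lemma inv_word_elt: "inv (elt ws) = elt (rev ws)"
  by (induction ws)
    (simp_all only: word_elt_Nil word_elt_Cons rev.simps word_elt_append o_inv_distrib
      bij_sref bij_word_elt inv_sref inv_id comp_id)

lemma word_elt_in_weyl [simp]: "elt ws \<in> W"
  by (simp add: weyl_def)

lemma weyl_cases:
  assumes "w \<in> W" obtains ws where "w = elt ws"
  using assms by (auto simp: weyl_def)

lemma weyl_bij: "w \<in> W \<Longrightarrow> bij w"
  by (metis weyl_cases bij_word_elt)

lemma id_in_weyl [simp]: "id \<in> W"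
  by (metis word_elt_Nil word_elt_in_weyl)

lemma sref_in_weyl [simp]: "s i \<in> W"
  by (metis word_elt_Nil word_elt_Cons comp_id word_elt_in_weyl)

lemma weyl_comp [simp]: "u \<in> W \<Longrightarrow> w \<in> W \<Longrightarrow> u \<circ> w \<in> W"
  by (metis weyl_cases word_elt_append word_elt_in_weyl)

lemma weyl_inv [simp]: "w \<in> W \<Longrightarrow> inv w \<in> W"
  by (metis weyl_cases inv_word_elt word_elt_in_weyl)

lemma weyl_inv_inv [simp]: "w \<in> W \<Longrightarrow> inv (inv w) = w"
  by (simp add: inv_inv_eq weyl_bij)

lemma weyl_inv_apply [simp]: "w \<in> W \<Longrightarrow> inv w (w lam) = lam"
  and weyl_apply_inv: "w \<in> W \<Longrightarrow> w (inv w lam) = lam"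
  by (simp_all add: weyl_bij bij_is_inj bij_is_surj surj_f_inv_f)

lemma weyl_inv_comp [simp]:
  assumes "w \<in> W"
  shows "inv w \<circ> w = id" "w \<circ> inv w = id" "inv w \<circ> (w \<circ> u) = u" "w \<circ> (inv w \<circ> u) = u"
  using assms by (auto simp: fun_eq_iff weyl_apply_inv)

lemma inv_weyl_comp: "u \<in> W \<Longrightarrow> w \<in> W \<Longrightarrow> inv (u \<circ> w) = inv w \<circ> inv u"
  by (simp add: o_inv_distrib weyl_bij)

lemma inv_sref_comp: "w \<in> W \<Longrightarrow> inv (s i \<circ> w) = inv w \<circ> s i"
  by (simp add: inv_weyl_comp)

lemma sref_comp_in_weyl_iff [simp]: "s i \<circ> w \<in> W \<longleftrightarrow> w \<in> W"
  by (metis sref_in_weyl sref_o_sref_o weyl_comp)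

lemma bij_betw_weyl_left: "u \<in> W \<Longrightarrow> bij_betw (\<lambda>w. u \<circ> w) W W"
  by (rule bij_betw_byWitness[where f' = "\<lambda>w. inv u \<circ> w"]) auto

lemma bij_betw_weyl_right: "u \<in> W \<Longrightarrow> bij_betw (\<lambda>w. w \<circ> u) W W"
  by (rule bij_betw_byWitness[where f' = "\<lambda>w. w \<circ> inv u"]) (auto simp: comp_assoc)

lemma sum_weyl_left: "u \<in> W \<Longrightarrow> (\<Sum>w\<in>W. f (u \<circ> w)) = (\<Sum>w\<in>W. f w)"
  by (rule sum.reindex_bij_betw[OF bij_betw_weyl_left])

lemma sum_weyl_right: "u \<in> W \<Longrightarrow> (\<Sum>w\<in>W. f (w \<circ> u)) = (\<Sum>w\<in>W. f w)"
  by (rule sum.reindex_bij_betw[OF bij_betw_weyl_right])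

lemma weyl_induct [consumes 1, case_names id sref]:
  assumes "w \<in> W" "P id" "\<And>i w. w \<in> W \<Longrightarrow> P w \<Longrightarrow> P (s i \<circ> w)"
  shows "P w"
proof -
  obtain ws where "w = elt ws" by (metis weyl_cases assms(1))
  moreover have "P (elt ws)"
    by (induction ws) (simp_all only: word_elt_Nil word_elt_Cons word_elt_in_weyl assms(2,3))
  ultimately show ?thesis by simp
qed

subsection \<open>Linearity and the invariant form\<close>

lemma sref_add: "s i (a + b) = s i a + s i b"
  by (rule ext) (simp add: sref_def algebra_simps)

lemma weyl_add: "w \<in> W \<Longrightarrow> w (a + b) = w a + w b"
  by (induction arbitrary: a b rule: weyl_induct) (simp_all add: sref_add)

lemma weyl_zero: "w \<in> W \<Longrightarrow> w 0 = 0"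
  using weyl_add[of w 0 0] by simp

lemma weyl_minus: "w \<in> W \<Longrightarrow> w (- a) = - w a"
  using weyl_add[of w a "- a"] weyl_zero[of w] by (simp add: eq_neg_iff_add_eq_0 add.commute)

lemma weyl_diff: "w \<in> W \<Longrightarrow> w (a - b) = w a - w b"
  using weyl_add[of w a "- b"] weyl_minus[of w b] by simp

lemma sref_scale: "s i (\<lambda>k. c * a k) = (\<lambda>k. c * s i a k)"
  by (rule ext) (simp add: sref_def algebra_simps)

lemma weyl_scale: "w \<in> W \<Longrightarrow> w (\<lambda>k. c * a k) = (\<lambda>k. c * w a k)"
  by (induction arbitrary: a rule: weyl_induct) (simp_all add: sref_scale)

text \<open>The dot product in fundamental weight coordinates, summed over the finite group to make
  it invariant. The summand at \<open>id\<close> keeps it positive definite, and all values stay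
  integral. It replaces an explicit symmetrization of the Cartan matrix.\<close>

definition form :: "'i wt \<Rightarrow> 'i wt \<Rightarrow> int" where
  "form a b = (\<Sum>w\<in>W. \<Sum>k\<in>UNIV. w a k * w b k)"

lemma form_commute: "form a b = form b a"
  by (simp add: form_def mult.commute)

lemma form_add: "form (a + b) c = form a c + form b c"
  by (simp add: form_def weyl_add algebra_simps sum.distrib)

lemma form_add_right: "form c (a + b) = form c a + form c b"
  by (metis form_add form_commute)

lemma form_scale: "form (\<lambda>k. x * a k) b = x * form a b"
  by (simp add: form_def weyl_scale sum_distrib_left mult.assoc)

lemma form_minus: "form (- a) b = - form a b"
  using form_scale[of "-1" a b] by (simp add: fun_Compl_def)

lemma form_minus_right: "form b (- a) = - form b a"
  by (metis form_minus form_commute)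

lemma form_zero: "form 0 b = 0"
  by (simp add: form_def weyl_zero)

lemma form_sum: "finite J \<Longrightarrow> form (\<lambda>k. \<Sum>j\<in>J. f j k) b = (\<Sum>j\<in>J. form (f j) b)"
proof (induction J rule: finite_induct)
  case empty then show ?case using form_zero by (simp add: zero_fun_def)
next
  case (insert x F)
  have "(\<lambda>k. \<Sum>j\<in>insert x F. f j k) = f x + (\<lambda>k. \<Sum>j\<in>F. f j k)"
    using insert by (simp add: fun_eq_iff)
  then show ?case using insert by (simp add: form_add)
qed

lemma form_invariant: "u \<in> W \<Longrightarrow> form (u a) (u b) = form a b"
  unfolding form_def
  using sum_weyl_right[of u "\<lambda>w. \<Sum>k\<in>UNIV. w a k * w b k"] by simp

lemma form_pos: assumes "a \<noteq> 0" shows "form a a > 0"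
proof -
  obtain k where k: "a k \<noteq> 0" using assms by (auto simp: fun_eq_iff)
  have "0 < (\<Sum>k\<in>UNIV. a k * a k)"
    by (rule sum_pos2[of _ k]) (use k in \<open>auto simp: zero_less_mult_iff\<close>)
  then show ?thesis unfolding form_def
    by (intro sum_pos2[of _ id]) (auto intro: sum_nonneg)
qed

lemma simple_root_apply: "\<alpha> j k = A k j"
  by (simp add: simple_root_def)

lemma simple_root_nz: "\<alpha> i \<noteq> 0"
  using cartan_diag[of i] by (metis simple_root_apply zero_fun_def zero_neq_numeral)

lemma sref_simple_root: "s i (\<alpha> i) = - \<alpha> i"
  by (rule ext) (simp add: sref_def simple_root_apply)

abbreviation (input) nsq :: "'i \<Rightarrow> int" where "nsq i \<equiv> form (\<alpha> i) (\<alpha> i)"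

lemma nsq_pos: "nsq i > 0"
  by (rule form_pos[OF simple_root_nz])

lemma sref_alt: "s i a = a + - (\<lambda>k. a i * \<alpha> i k)"
  by (rule ext) (simp add: sref_def simple_root_apply)

text \<open>Invariance under \<open>s i\<close>, which negates \<alpha>_i and changes
  \<open>a\<close> by a multiple of \<alpha>_i. It identifies the i-th coordinate of a weight with
  its pairing with the simple coroot.\<close>

lemma form_simple_root: "2 * form (\<alpha> i) a = a i * nsq i"
proof -
  have "form a (\<alpha> i) = form (s i a) (- \<alpha> i)"
    using form_invariant[of "s i" a "\<alpha> i"] sref_simple_root by simp
  also have "\<dots> = - form a (\<alpha> i) + a i * nsq i"
    by (subst sref_alt)
      (simp only: form_add form_minus form_minus_right form_scale minus_add_distrib minus_minus)
  finally show ?thesis using form_commute[of a "\<alpha> i"] by simp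
qed

lemma form_simple_root_cartan: "2 * form (\<alpha> i) (\<alpha> j) = A i j * nsq i"
  using form_simple_root[of i "\<alpha> j"] by (simp add: simple_root_apply)

lemma cartan_symmetrizable: "nsq i * A i j = nsq j * A j i"
  using form_simple_root_cartan[of i j] form_simple_root_cartan[of j i] form_commute
  by (simp add: mult.commute)

definition comb :: "('i \<Rightarrow> int) \<Rightarrow> 'i wt" where
  "comb c = (\<lambda>k. \<Sum>j\<in>UNIV. c j * \<alpha> j k)"

lemma comb_add: "comb (a + b) = comb a + comb b"
  by (rule ext) (simp add: comb_def algebra_simps sum.distrib)

lemma comb_minus: "comb (- a) = - comb a"
  by (rule ext) (simp add: comb_def sum_negf)

lemma comb_scale: "comb (\<lambda>j. x * c j) = (\<lambda>k. x * comb c k)"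
  by (rule ext) (simp add: comb_def sum_distrib_left mult.assoc)

lemma comb_unit: "comb (\<lambda>j. if j = i then x else 0) = (\<lambda>k. x * \<alpha> i k)"
  by (rule ext) (simp add: comb_def if_distrib[of "\<lambda>y. y * _"] sum.delta cong: if_cong)

lemma form_comb: "2 * form (comb c) a = (\<Sum>j\<in>UNIV. c j * nsq j * a j)"
proof -
  have "form (comb c) a = (\<Sum>j\<in>UNIV. c j * form (\<alpha> j) a)"
    unfolding comb_def by (subst form_sum) (simp_all add: form_scale)
  then have "2 * form (comb c) a = (\<Sum>j\<in>UNIV. c j * (2 * form (\<alpha> j) a))"
    by (simp add: sum_distrib_left algebra_simps)
  then show ?thesis by (simp add: form_simple_root algebra_simps)
qed

text \<open>Pairing with the i-th fundamental weight isolates the coefficient \<open>c i\<close>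
  times a positive norm, so simple roots are linearly independent without inverting the Cartan
  matrix.\<close>

lemma comb_inj: "comb c = comb d \<longleftrightarrow> c = d"
proof
  assume eq: "comb c = comb d"
  show "c = d"
  proof
    fix i
    let ?u = "\<lambda>j::'i. if j = i then 1 else 0 :: int"
    have "2 * form (comb e) ?u = e i * nsq i" for e
      by (simp add: form_comb if_distrib[of "\<lambda>y. _ * y"] cong: if_cong)
    from this[of c] this[of d] eq nsq_pos[of i] show "c i = d i" by simp
  qed
qed simp

lemma sref_comb: "s i (comb c) = comb (c(i := c i - comb c i))"
proof -
  have "c(i := c i - comb c i) = c + - (\<lambda>j. if j = i then comb c i else 0)"
    by (simp add: fun_eq_iff)
  then have "comb (c(i := c i - comb c i)) = comb c + - (\<lambda>k. comb c i * \<alpha> i k)"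
    by (simp only: comb_add comb_minus comb_unit)
  then show ?thesis by (simp only: sref_alt)
qed

lemma weyl_comb: assumes "w \<in> W" shows "\<exists>d. w (comb c) = comb d"
  using assms by (induction rule: weyl_induct) (auto simp: sref_comb)

lemma simple_root_comb: "\<alpha> i = comb (\<lambda>j. if j = i then 1 else 0)"
  by (simp add: comb_unit fun_eq_iff)

lemma root_comb: assumes "\<beta> \<in> \<Phi>" shows "\<exists>c. \<beta> = comb c"
proof -
  obtain w i where "w \<in> W" "\<beta> = w (\<alpha> i)" using assms by (auto simp: roots_def)
  then show ?thesis using weyl_comb simple_root_comb[of i] by metis
qed

text \<open>Integrality of the coefficients \<open>d\<close> is the point: applied to the inverse of
  w, they are the coordinates of the coroot of w \<alpha>_i in the simple coroots.\<close>

lemma weyl_coord: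
  assumes "w \<in> W" shows "\<exists>d. \<forall>a. w a i = (\<Sum>j\<in>UNIV. d j * a j)"
  using assms
proof (induction arbitrary: i rule: weyl_induct)
  case id
  show ?case
    by (rule exI[of _ "\<lambda>j. if j = i then 1 else 0"])
      (simp add: if_distrib[of "\<lambda>y. y * _"] sum.delta cong: if_cong)
next
  case (sref k w)
  obtain d where d: "\<And>a. w a i = (\<Sum>j\<in>UNIV. d j * a j)" using sref by blast
  obtain d' where d': "\<And>a. w a k = (\<Sum>j\<in>UNIV. d' j * a j)" using sref by blast
  show ?case
    by (rule exI[of _ "\<lambda>j. d j - A i k * d' j"])
      (simp add: sref_def d d' sum_subtractf sum_distrib_left sum_distrib_right algebra_simps)
qed

section \<open>Roots and their signs\<close>

lemma simple_root_in_roots [simp]: "\<alpha> i \<in> \<Phi>"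
  unfolding roots_def by (rule CollectI, rule exI[of _ id]) auto

lemma weyl_root [simp]: "w \<in> W \<Longrightarrow> \<beta> \<in> \<Phi> \<Longrightarrow> w \<beta> \<in> \<Phi>"
proof -
  assume w: "w \<in> W" and "\<beta> \<in> \<Phi>"
  then obtain u i where "u \<in> W" "\<beta> = u (\<alpha> i)" by (auto simp: roots_def)
  then show ?thesis unfolding roots_def using w
    by (intro CollectI exI[of _ "w \<circ> u"] exI[of _ i]) simp
qed

lemma minus_root [simp]: "\<beta> \<in> \<Phi> \<Longrightarrow> - \<beta> \<in> \<Phi>"
proof -
  assume "\<beta> \<in> \<Phi>"
  then obtain w i where w: "w \<in> W" "\<beta> = w (\<alpha> i)" by (auto simp: roots_def)
  then have "- \<beta> = w (s i (\<alpha> i))" by (simp only: sref_simple_root weyl_minus)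
  then show ?thesis using w by simp
qed

lemma minus_root_iff [simp]: "- \<beta> \<in> \<Phi> \<longleftrightarrow> \<beta> \<in> \<Phi>"
  by (metis minus_root minus_minus)

lemma pos_roots_iff: "\<beta> \<in> \<Phi>pos \<longleftrightarrow> \<beta> \<in> \<Phi> \<and> (\<exists>c. (\<forall>j. 0 \<le> c j) \<and> \<beta> = comb c)"
  by (simp add: pos_roots_def comb_def)

lemma pos_rootsI: "\<beta> \<in> \<Phi> \<Longrightarrow> \<beta> = comb c \<Longrightarrow> (\<And>j. 0 \<le> c j) \<Longrightarrow> \<beta> \<in> \<Phi>pos"
  unfolding pos_roots_iff by blast

lemma pos_roots_root: "\<beta> \<in> \<Phi>pos \<Longrightarrow> \<beta> \<in> \<Phi>"
  by (simp add: pos_roots_iff)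

lemma root_nz: "\<beta> \<in> \<Phi> \<Longrightarrow> \<beta> \<noteq> 0"
proof
  assume "\<beta> \<in> \<Phi>" "\<beta> = 0"
  then obtain u i where u: "u \<in> W" "0 = u (\<alpha> i)" by (auto simp: roots_def)
  then have "\<alpha> i = inv u 0" by (metis weyl_inv_apply)
  then show False using u weyl_zero[of "inv u"] simple_root_nz[of i] by simp
qed

lemma not_pos_and_neg: "\<beta> \<in> \<Phi>pos \<Longrightarrow> - \<beta> \<notin> \<Phi>pos"
proof
  assume "\<beta> \<in> \<Phi>pos" "- \<beta> \<in> \<Phi>pos"
  then obtain c d where c: "\<forall>j. 0 \<le> c j" "\<beta> = comb c" and d: "\<forall>j. 0 \<le> d j" "- \<beta> = comb d" and b: "\<beta> \<in> \<Phi>"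
    by (auto simp: pos_roots_iff)
  from c d have "comb (- c) = comb d" by (simp add: comb_minus)
  then have "- c = d" by (simp add: comb_inj)
  with c(1) d(1) have "c = 0" by (auto simp: fun_eq_iff) (metis dual_order.antisym neg_0_le_iff_le)
  then have "\<beta> = 0" using c(2) by (simp add: comb_def fun_eq_iff)
  then show False using root_nz b by blast
qed

text \<open>Off-diagonal terms cancel in pairs modulo 2.\<close>

lemma symmetric_sum_even:
  fixes f :: "'a \<Rightarrow> 'a \<Rightarrow> int"
  assumes "finite J" "\<And>j k. f j k = f k j" "\<And>j. even (f j j)"
  shows "even (\<Sum>j\<in>J. \<Sum>k\<in>J. f j k)"
  using assms(1)
proof (induction J rule: finite_induct)
  case (insert x F)
  have "(\<Sum>j\<in>insert x F. \<Sum>k\<in>insert x F. f j k)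
      = f x x + (\<Sum>k\<in>F. f x k) + ((\<Sum>j\<in>F. f j x) + (\<Sum>j\<in>F. \<Sum>k\<in>F. f j k))"
    using insert by (simp add: sum.distrib)
  also have "(\<Sum>j\<in>F. f j x) = (\<Sum>k\<in>F. f x k)" by (rule sum.cong[OF refl]) (rule assms(2))
  finally show ?case using insert.IH assms(3)[of x] by simp
qed simp

text \<open>A root of mixed sign would be a difference of two vectors each at least as long as the root.\<close>

lemma root_pos_or_neg:
  assumes "\<beta> \<in> \<Phi>" shows "\<beta> \<in> \<Phi>pos \<or> - \<beta> \<in> \<Phi>pos"
proof -
  obtain w i where w: "w \<in> W" and \<beta>: "\<beta> = w (\<alpha> i)" using assms by (auto simp: roots_def)
  obtain c where c: "\<beta> = comb c" using root_comb[OF assms] by blast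
  \<comment> \<open>\<open>d\<close> lists the coordinates of the coroot of \<beta>; comparing
    coefficients below shows that it is proportional to \<open>c\<close> after weighting by the
    norms of the simple roots.\<close>
  obtain d where d: "\<And>a. inv w a i = (\<Sum>j\<in>UNIV. d j * a j)"
    using weyl_coord[of "inv w" i] w by auto
  have "2 * form \<beta> a = nsq i * inv w a i" for a
    using form_invariant[of "inv w" \<beta> a] w \<beta> form_simple_root[of i "inv w a"] by simp
  then have cd: "(\<Sum>j\<in>UNIV. c j * nsq j * a j) = nsq i * (\<Sum>j\<in>UNIV. d j * a j)" for a
    by (simp add: c form_comb d)
  have cd: "c j * nsq j = nsq i * d j" for j
    using cd[of "\<lambda>k. if k = j then 1 else 0"]
    by (simp add: if_distrib[of "\<lambda>y. _ * y"] cong: if_cong)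
  define part where "part J = (\<lambda>j. if j \<in> J then c j else 0)" for J
  define M where "M J = (\<Sum>j\<in>J. \<Sum>k\<in>J. d j * A j k * c k)" for J
  have comb_part: "comb (part J) j = (\<Sum>k\<in>J. A j k * c k)" for J j
    by (simp add: comb_def part_def simple_root_apply if_distrib[of "\<lambda>y. y * _"] sum.If_cases cong: if_cong)
      (simp add: mult.commute)
  have form_part: "2 * form (comb (part J)) (comb (part J)) = nsq i * M J" for J
  proof -
    have "2 * form (comb (part J)) (comb (part J)) = (\<Sum>j\<in>J. c j * nsq j * comb (part J) j)"
      by (simp add: form_comb) (simp add: part_def if_distrib[of "\<lambda>y. y * _"] sum.If_cases cong: if_cong)
    also have "\<dots> = nsq i * M J"
      unfolding cd M_def comb_part by (simp add: sum_distrib_left algebra_simps)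
    finally show ?thesis .
  qed
  \<comment> \<open>Up to the factor \<open>nsq i\<close>, \<open>M J\<close> is twice the norm of a
    part of \<beta>. The summands are symmetric by proportionality of \<open>c\<close> and
    \<open>d\<close>, and diagonal ones carry \<open>A j j = 2\<close>. Being positive and even,
    \<open>M J\<close> is at least 2.\<close>
  have even_M: "even (M J)" for J
    unfolding M_def
  proof (rule symmetric_sum_even)
    fix j k
    have "nsq i * (d j * A j k * c k) = c j * (nsq j * A j k) * c k"
      using cd[of j] by (simp add: algebra_simps)
    also have "\<dots> = c k * nsq k * A k j * c j"
      unfolding cartan_symmetrizable[of j k] by (simp add: algebra_simps)
    also have "\<dots> = nsq i * (d k * A k j * c j)"
      using cd[of k] by (simp add: algebra_simps)
    finally show "d j * A j k * c k = d k * A k j * c j" using nsq_pos[of i] by simp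
  qed simp_all
  have M_ge: "M J \<ge> 2" if "j \<in> J" "c j \<noteq> 0" for J j
  proof -
    have "part J \<noteq> 0" using that by (auto simp: part_def fun_eq_iff)
    then have "comb (part J) \<noteq> comb 0" using comb_inj by blast
    then have "form (comb (part J)) (comb (part J)) > 0"
      by (intro form_pos) (simp add: comb_def zero_fun_def)
    then have "nsq i * M J > 0" using form_part[of J] by simp
    then have "M J > 0" using nsq_pos[of i] by (simp add: zero_less_mult_iff)
    with even_M[of J] show ?thesis by presburger
  qed
  define J where "J = {j. c j > 0}"
  define K where "K = {j. c j < 0}"
  have "c = part J + part K" by (auto simp: fun_eq_iff part_def J_def K_def)
  then have dec: "\<beta> = comb (part J) + comb (part K)" using c by (simp only: comb_add)
  \<comment> \<open>On disjoint index sets a positive coefficient meets a negative one and a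
    nonpositive Cartan entry, so the cross term cannot shorten \<beta>.\<close>
  have "2 * form (comb (part J)) (comb (part K)) \<ge> 0"
  proof -
    have "2 * form (comb (part J)) (comb (part K)) = (\<Sum>j\<in>J. c j * nsq j * comb (part K) j)"
      by (simp add: form_comb) (simp add: part_def if_distrib[of "\<lambda>y. y * _"] sum.If_cases cong: if_cong)
    also have "\<dots> \<ge> 0"
    proof (rule sum_nonneg)
      fix j assume j: "j \<in> J"
      have "comb (part K) j \<ge> 0" unfolding comb_part
      proof (rule sum_nonneg)
        fix k assume "k \<in> K"
        then have "j \<noteq> k" "c k \<le> 0" using j by (auto simp: J_def K_def)
        then show "0 \<le> A j k * c k" using cartan_off_diag by (simp add: mult_nonpos_nonpos)
      qed
      then show "0 \<le> c j * nsq j * comb (part K) j"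
        using j nsq_pos[of j] by (simp add: J_def)
    qed
    finally show ?thesis .
  qed
  moreover have "form \<beta> \<beta> = nsq i" using \<beta> form_invariant w by simp
  moreover have "form \<beta> \<beta> = form (comb (part J)) (comb (part J)) + form (comb (part K)) (comb (part K))
      + 2 * form (comb (part J)) (comb (part K))"
    by (simp add: dec form_add form_add_right form_commute)
  ultimately have "nsq i * (M J + M K) \<le> nsq i * 2"
    using form_part[of J] form_part[of K] by (simp add: algebra_simps)
  then have le: "M J + M K \<le> 2" using nsq_pos[of i] by simp
  show ?thesis
  proof (cases "J = {}")
    case True
    then have "\<forall>j. 0 \<le> (- c) j" by (auto simp: J_def not_less)
    moreover have "- \<beta> = comb (- c)" using c by (simp add: comb_minus)
    ultimately have "- \<beta> \<in> \<Phi>pos" using assms unfolding pos_roots_iff minus_root_iff by metis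
    then show ?thesis ..
  next
    case False
    then obtain j where "j \<in> J" by blast
    then have "M J \<ge> 2" by (intro M_ge) (auto simp: J_def)
    then have "\<not> M K \<ge> 2" using le by simp
    then have "\<forall>j. 0 \<le> c j" using M_ge[of _ K] by (metis K_def leI mem_Collect_eq less_irrefl)
    then have "\<beta> \<in> \<Phi>pos" using assms c unfolding pos_roots_iff by metis
    then show ?thesis ..
  qed
qed

lemma minus_pos_iff: "\<beta> \<in> \<Phi> \<Longrightarrow> - \<beta> \<in> \<Phi>pos \<longleftrightarrow> \<beta> \<notin> \<Phi>pos"
  using root_pos_or_neg not_pos_and_neg by metis

lemma simple_root_pos [simp]: "\<alpha> i \<in> \<Phi>pos"
  unfolding pos_roots_iff simple_root_comb[of i]
  by (intro conjI exI[of _ "\<lambda>j. if j = i then 1 else 0"])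
    (simp_all add: simple_root_comb[of i, symmetric])

text \<open>\<open>s i\<close> changes only the i-th coefficient, so any other positive coefficient
  survives and fixes the sign. If there is none, \<beta> is a multiple of \<alpha>_i; moving \<beta>
  to a simple root shows that the multiple divides 1.\<close>

lemma sref_pos:
  assumes "\<beta> \<in> \<Phi>pos" "\<beta> \<noteq> \<alpha> i" shows "s i \<beta> \<in> \<Phi>pos"
proof -
  obtain c where c: "\<And>j. 0 \<le> c j" "\<beta> = comb c" and b: "\<beta> \<in> \<Phi>"
    using assms by (auto simp: pos_roots_iff)
  show ?thesis
  proof (cases "\<exists>j. j \<noteq> i \<and> c j > 0")
    case True
    then obtain j where j: "j \<noteq> i" "c j > 0" by blast
    have "- s i \<beta> \<notin> \<Phi>pos"
    proof
      assume "- s i \<beta> \<in> \<Phi>pos"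
      then obtain d where d: "\<And>j. 0 \<le> d j" "- s i \<beta> = comb d" by (auto simp: pos_roots_iff)
      have "s i \<beta> = comb (- d)" by (metis comb_minus d(2) minus_minus)
      then have "c(i := c i - comb c i) = - d" by (simp only: c(2) sref_comb comb_inj)
      then have "c j = - d j" using j(1) by (metis fun_upd_other uminus_apply)
      with d(1)[of j] j(2) show False by simp
    qed
    then show ?thesis using root_pos_or_neg[of "s i \<beta>"] b by simp
  next
    case False
    then have c0: "c j = 0" if "j \<noteq> i" for j using c(1)[of j] that by force
    then have "c = (\<lambda>j. if j = i then c i else 0)" by auto
    then have bi: "\<beta> = (\<lambda>k. c i * \<alpha> i k)" using c(2) comb_unit by metis
    obtain w j where w: "w \<in> W" "\<beta> = w (\<alpha> j)" using b by (auto simp: roots_def)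
    obtain d where d: "inv w (\<alpha> i) = comb d"
      using weyl_comb[of "inv w"] w simple_root_comb[of i] by (metis weyl_inv)
    have "\<alpha> j = inv w \<beta>" using w by simp
    also have "\<dots> = (\<lambda>k. c i * inv w (\<alpha> i) k)"
      using weyl_scale[of "inv w" "c i" "\<alpha> i"] w bi by simp
    also have "\<dots> = comb (\<lambda>k. c i * d k)" by (simp only: d comb_scale)
    finally have "(\<lambda>k. if k = j then 1 else 0) = (\<lambda>k. c i * d k)"
      by (simp only: simple_root_comb[of j] comb_inj)
    then have "1 = c i * d j" by (metis (full_types))
    then have "c i = 1" using c(1)[of i] by (metis zmult_eq_1_iff not_one_le_zero neg_0_le_iff_le)
    then show ?thesis using bi assms(2) by (simp add: fun_eq_iff)
  qed
qed

subsection \<open>Length and exchange\<close>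

lemma len_word_elt_le: "len (elt ws) \<le> length ws"
  unfolding wlen_def by (rule Least_le) auto

lemma ex_word_len:
  assumes "w \<in> W" shows "\<exists>ws. elt ws = w \<and> length ws = len w"
proof -
  obtain ws where "w = elt ws" by (metis weyl_cases assms)
  then have "\<exists>vs. length vs = len w \<and> elt vs = w"
    unfolding wlen_def by (intro LeastI[of "\<lambda>k. \<exists>vs. length vs = k \<and> elt vs = w"]) auto
  then show ?thesis by blast
qed

lemma red_word:
  assumes "w \<in> W" shows "elt (red_word A w) = w" "length (red_word A w) = len w"
  using someI_ex[OF ex_word_len[OF assms]] unfolding red_word_def by auto

lemma len_id [simp]: "len id = 0"
  using len_word_elt_le[of "[]"] by simp

lemma red_word_id [simp]: "red_word A id = []"
  using red_word(2)[OF id_in_weyl] by simp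

lemma len_sref_comp_le: "w \<in> W \<Longrightarrow> len (s i \<circ> w) \<le> Suc (len w)"
  using len_word_elt_le[of "i # red_word A w"] red_word[of w] by simp

lemma len_inv: assumes "w \<in> W" shows "len (inv w) = len w"
proof -
  have "len (inv u) \<le> len u" if "u \<in> W" for u
    using len_word_elt_le[of "rev (red_word A u)"] red_word[OF that] by (simp flip: inv_word_elt)
  from this[of w] this[of "inv w"] assms show ?thesis by simp
qed

lemma reflection_apply:
  assumes "u \<in> W"
  shows "(u \<circ> s i \<circ> inv u) a = a - (\<lambda>k. inv u a i * u (\<alpha> i) k)"
    and "inv u a i * nsq i = 2 * form (u (\<alpha> i)) a"
proof -
  have "(u \<circ> s i \<circ> inv u) a = u (inv u a - (\<lambda>k. inv u a i * \<alpha> i k))"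
    by (simp only: o_apply sref_alt diff_conv_add_uminus)
  also have "\<dots> = a - (\<lambda>k. inv u a i * u (\<alpha> i) k)"
    by (simp only: weyl_diff[OF assms] weyl_scale[OF assms] weyl_apply_inv[OF assms])
  finally show "(u \<circ> s i \<circ> inv u) a = a - (\<lambda>k. inv u a i * u (\<alpha> i) k)" .
  show "inv u a i * nsq i = 2 * form (u (\<alpha> i)) a"
    using form_simple_root[of i "inv u a"] form_invariant[of u "\<alpha> i" "inv u a"] assms
    by (simp add: weyl_apply_inv)
qed

text \<open>Both sides send \<open>a\<close> to a - (2 (\<beta>,a)/(\<beta>,\<beta>)) \<beta> for
  the common root \<beta>, so the conjugating element does not matter.\<close>

lemma reflection_eqI:
  assumes "u \<in> W" "u' \<in> W" "u (\<alpha> i) = u' (\<alpha> j)"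
  shows "u \<circ> s i \<circ> inv u = u' \<circ> s j \<circ> inv u'"
proof
  fix a
  have n: "nsq i = nsq j"
    using form_invariant[OF assms(1), of "\<alpha> i" "\<alpha> i"] form_invariant[OF assms(2), of "\<alpha> j" "\<alpha> j"] assms(3)
    by simp
  have "inv u a i * nsq i = inv u' a j * nsq i"
    using reflection_apply(2)[OF assms(1), of a i] reflection_apply(2)[OF assms(2), of a j] assms(3) n
    by simp
  then have "inv u a i = inv u' a j" using nsq_pos[of i] by simp
  then show "(u \<circ> s i \<circ> inv u) a = (u' \<circ> s j \<circ> inv u') a"
    by (simp only: reflection_apply(1)[OF assms(1)] reflection_apply(1)[OF assms(2)] assms(3))
qed

text \<open>The letters of the word are applied to the positive root until it becomes the simple
  root of the next letter, the only positive root which that letter makes negative. There the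
  reflection deletes the letter.\<close>

lemma strong_exchange:
  assumes "u \<in> W" "u (\<alpha> i) \<in> \<Phi>pos" "inv (elt ws) (u (\<alpha> i)) \<notin> \<Phi>pos"
  shows "\<exists>vs. Suc (length vs) = length ws \<and> elt vs = (u \<circ> s i \<circ> inv u) \<circ> elt ws"
  using assms
proof (induction ws arbitrary: u)
  case Nil
  then show ?case by (simp add: inv_id)
next
  case (Cons j ws)
  show ?case
  proof (cases "u (\<alpha> i) = \<alpha> j")
    case True
    then have "u \<circ> s i \<circ> inv u = s j"
      using reflection_eqI[of u id i j] Cons.prems(1) by (simp add: inv_id)
    then have "elt ws = (u \<circ> s i \<circ> inv u) \<circ> elt (j # ws)"
      by (simp only: word_elt_Cons sref_o_sref_o)
    then show ?thesis by (intro exI[of _ ws] conjI) (simp_all only: length_Cons)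
  next
    case False
    have u': "s j \<circ> u \<in> W" using Cons.prems(1) by simp
    have neg: "inv (elt ws) ((s j \<circ> u) (\<alpha> i)) \<notin> \<Phi>pos"
      using Cons.prems(3) unfolding word_elt_Cons inv_sref_comp[OF word_elt_in_weyl] by simp
    have pos: "(s j \<circ> u) (\<alpha> i) \<in> \<Phi>pos" using sref_pos[OF Cons.prems(2) False] by simp
    obtain vs where vs: "Suc (length vs) = length ws"
      "elt vs = ((s j \<circ> u) \<circ> s i \<circ> inv (s j \<circ> u)) \<circ> elt ws"
      using Cons.IH[OF u' pos neg] by blast
    have "elt (j # vs) = (u \<circ> s i \<circ> inv u) \<circ> elt (j # ws)"
      using Cons.prems(1) by (simp only: word_elt_Cons vs(2) inv_sref_comp comp_assoc sref_o_sref_o)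
    then show ?thesis using vs(1) by (intro exI[of _ "j # vs"]) simp
  qed
qed

lemma reflection_involution:
  "u \<in> W \<Longrightarrow> (u \<circ> s i \<circ> inv u) \<circ> ((u \<circ> s i \<circ> inv u) \<circ> w) = w"
  by (simp add: fun_eq_iff weyl_apply_inv)

lemma len_reflection_less:
  assumes "u \<in> W" "w \<in> W" "u (\<alpha> i) \<in> \<Phi>pos" "inv w (u (\<alpha> i)) \<notin> \<Phi>pos"
  shows "len ((u \<circ> s i \<circ> inv u) \<circ> w) < len w"
  using strong_exchange[of u i "red_word A w"] len_word_elt_le red_word[of w] assms
  by (metis Suc_le_eq Suc_le_mono)

text \<open>Left multiplication by the reflection r flips the sign of inv w applied to its root.
  Applying \<open>len_reflection_less\<close> to r w instead of w therefore gives the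
  converse.\<close>

lemma len_reflection_less_iff:
  assumes u: "u \<in> W" and w: "w \<in> W" and pos: "u (\<alpha> i) \<in> \<Phi>pos"
  shows "len ((u \<circ> s i \<circ> inv u) \<circ> w) < len w \<longleftrightarrow> inv w (u (\<alpha> i)) \<notin> \<Phi>pos"
    and "len w < len ((u \<circ> s i \<circ> inv u) \<circ> w) \<longleftrightarrow> inv w (u (\<alpha> i)) \<in> \<Phi>pos"
proof -
  let ?r = "u \<circ> s i \<circ> inv u"
  have r: "?r \<in> W" using u by simp
  have "inv ?r = ?r"
    by (rule inv_unique_comp) (use reflection_involution[OF u, of i id] in simp_all)
  moreover have "?r (u (\<alpha> i)) = - u (\<alpha> i)"
    by (simp only: o_apply weyl_inv_apply[OF u] sref_simple_root weyl_minus[OF u])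
  ultimately have "inv (?r \<circ> w) (u (\<alpha> i)) = - inv w (u (\<alpha> i))"
    using inv_weyl_comp[OF r w] w by (simp only: o_apply weyl_minus weyl_inv)
  moreover have "inv w (u (\<alpha> i)) \<in> \<Phi>" using u w by simp
  ultimately have "len w < len (?r \<circ> w)" if "inv w (u (\<alpha> i)) \<in> \<Phi>pos"
    using len_reflection_less[of u "?r \<circ> w" i] that u w pos not_pos_and_neg r reflection_involution[OF u]
    by (metis weyl_comp)
  then show "len (?r \<circ> w) < len w \<longleftrightarrow> inv w (u (\<alpha> i)) \<notin> \<Phi>pos"
    "len w < len (?r \<circ> w) \<longleftrightarrow> inv w (u (\<alpha> i)) \<in> \<Phi>pos"
    using len_reflection_less[OF u w pos] by linarith+
qed

lemma descent_iff:
  assumes "w \<in> W"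
  shows "desc i w \<longleftrightarrow> inv w (\<alpha> i) \<notin> \<Phi>pos"
    and "len w < len (s i \<circ> w) \<longleftrightarrow> inv w (\<alpha> i) \<in> \<Phi>pos"
  using len_reflection_less_iff[of id w i] assms by (simp_all add: inv_id)

lemma len_sref_neq: "w \<in> W \<Longrightarrow> len (s i \<circ> w) \<noteq> len w"
  using descent_iff[of w i] by fastforce

lemma len_ascent: "w \<in> W \<Longrightarrow> \<not> desc i w \<Longrightarrow> len (s i \<circ> w) = Suc (len w)"
  using len_sref_neq[of w i] len_sref_comp_le[of w i] by simp

lemma len_descent: "w \<in> W \<Longrightarrow> desc i w \<Longrightarrow> len w = Suc (len (s i \<circ> w))"
  using len_sref_comp_le[of "s i \<circ> w" i] by simp

definition reduced :: "'i list \<Rightarrow> bool" where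
  "reduced ws \<longleftrightarrow> len (elt ws) = length ws"

lemma reduced_red_word [simp]: "w \<in> W \<Longrightarrow> reduced (red_word A w)"
  by (simp add: reduced_def red_word)

lemma reduced_Cons:
  "reduced (i # ws) \<longleftrightarrow> reduced ws \<and> \<not> len (s i \<circ> elt ws) < len (elt ws)"
  using len_ascent[of "elt ws" i] len_word_elt_le[of ws] len_sref_comp_le[of "elt ws" i]
  by (auto simp: reduced_def)

lemma reduced_Cons_red_word:
  "w \<in> W \<Longrightarrow> \<not> desc i w \<Longrightarrow> reduced (i # red_word A w)"
  by (simp add: reduced_Cons red_word)

lemma ex_descent: assumes "w \<in> W" "w \<noteq> id" shows "\<exists>i. desc i w"
proof (cases "red_word A w")
  case Nil
  then show ?thesis using assms red_word(1)[of w] by simp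
next
  case (Cons i ws)
  then have "s i \<circ> w = elt ws" using red_word(1)[OF assms(1)] by (metis sref_o_sref_o word_elt_Cons)
  then have "desc i w"
    using len_word_elt_le[of ws] red_word(2)[OF assms(1)] Cons by (metis Suc_le_eq Suc_le_mono length_Cons)
  then show ?thesis ..
qed

lemma reduced_induct [consumes 1, case_names id sref]:
  assumes "w \<in> W" "P id"
    "\<And>i w. w \<in> W \<Longrightarrow> \<not> desc i w \<Longrightarrow> P w \<Longrightarrow> P (s i \<circ> w)"
  shows "P w"
  using assms(1)
proof (induction "len w" arbitrary: w rule: less_induct)
  case less
  show ?case
  proof (cases "w = id")
    case False
    then obtain i where i: "desc i w" using ex_descent less.prems by blast
    have "P (s i \<circ> (s i \<circ> w))"
      by (rule assms(3)) (use less i in \<open>simp_all only: sref_comp_in_weyl_iff sref_o_sref_o not_less_iff_gr_or_eq simp_thms\<close>)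
    then show ?thesis by (simp only: sref_o_sref_o)
  qed (use assms(2) in simp)
qed

text \<open>Common induction behind the triangularity of \<open>Liw\<close> and \<open>G\<close>:
  passing from x to \<open>s i \<circ> x\<close> enlarges the support by at most its translate under
  \<open>s i\<close>, and such a translate raises the length by at most one.\<close>

lemma length_triangular:
  fixes T :: "'i wg \<Rightarrow> 'i wg \<Rightarrow> 'r::zero"
  assumes "x \<in> W" "T x u \<noteq> 0" and id: "\<And>u. T id u \<noteq> 0 \<Longrightarrow> u = id" and supp: "\<And>x u. T x u \<noteq> 0 \<Longrightarrow> u \<in> W"
    and step: "\<And>i x u. x \<in> W \<Longrightarrow> \<not> desc i x \<Longrightarrow> T (s i \<circ> x) u \<noteq> 0 \<Longrightarrow> T x u \<noteq> 0 \<or> T x (s i \<circ> u) \<noteq> 0"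
  shows "u = x \<or> len u < len x"
  using assms(1,2)
proof (induction arbitrary: u rule: reduced_induct)
  case id
  then show ?case using assms(3) by blast
next
  case (sref i x)
  have l: "len (s i \<circ> x) = Suc (len x)" by (rule len_ascent[OF sref(1,2)])
  have u: "u \<in> W" by (rule supp[OF sref(4)])
  show ?case
  proof (cases "T x u = 0")
    case True
    then have "s i \<circ> u = x \<or> len (s i \<circ> u) < len x" using step[OF sref(1,2,4)] sref(3) by blast
    moreover have "u = s i \<circ> x" if "s i \<circ> u = x" using that by (metis sref_o_sref_o)
    moreover have "len u \<le> Suc (len (s i \<circ> u))"
      using len_sref_comp_le[of "s i \<circ> u" i] u by (simp only: sref_o_sref_o sref_comp_in_weyl_iff)
    ultimately show ?thesis using l by linarith
  next
    case False
    then have "u = x \<or> len u < len x" using sref(3) by blast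
    then have "len u < len (s i \<circ> x)" unfolding l by auto
    then show ?thesis by blast
  qed
qed

subsection \<open>The longest element\<close>

lemma longest_all_descents:
  assumes "w \<in> W" "\<forall>v\<in>W. len v \<le> len w" shows "inv w (\<alpha> i) \<notin> \<Phi>pos"
  using assms(2) descent_iff(2)[OF assms(1), of i] assms(1) by (metis leD sref_comp_in_weyl_iff)

lemma all_descents_neg:
  assumes "w \<in> W" "\<And>i. w (\<alpha> i) \<notin> \<Phi>pos" "\<beta> \<in> \<Phi>pos" shows "w \<beta> \<notin> \<Phi>pos"
proof -
  obtain c where c: "\<And>j. 0 \<le> c j" "\<beta> = comb c" and b: "\<beta> \<in> \<Phi>"
    using assms by (auto simp: pos_roots_iff)
  have "\<exists>d. (\<forall>k. 0 \<le> d k) \<and> - w (\<alpha> j) = comb d" for j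
  proof -
    have "- w (\<alpha> j) \<in> \<Phi>pos" using assms(1,2) root_pos_or_neg[of "w (\<alpha> j)"] by simp
    then show ?thesis unfolding pos_roots_iff by metis
  qed
  then obtain d where d: "\<And>j k. 0 \<le> d j k" "\<And>j. - w (\<alpha> j) = comb (d j)" by metis
  have wsum: "w (\<lambda>k. \<Sum>j\<in>J. c j * \<alpha> j k) = (\<lambda>k. \<Sum>j\<in>J. c j * w (\<alpha> j) k)" if "finite J" for J
    using that
  proof (induction J rule: finite_induct)
    case empty
    then show ?case using weyl_zero[OF assms(1)] by (simp add: zero_fun_def)
  next
    case (insert x F)
    have "w (\<lambda>k. \<Sum>j\<in>insert x F. c j * \<alpha> j k) = w ((\<lambda>k. c x * \<alpha> x k) + (\<lambda>k. \<Sum>j\<in>F. c j * \<alpha> j k))"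
      using insert by (intro arg_cong[of _ _ w]) (simp add: fun_eq_iff)
    also have "\<dots> = (\<lambda>k. c x * w (\<alpha> x) k) + (\<lambda>k. \<Sum>j\<in>F. c j * w (\<alpha> j) k)"
      by (simp only: weyl_add[OF assms(1)] weyl_scale[OF assms(1)] insert.IH)
    finally show ?case using insert by (simp add: fun_eq_iff)
  qed
  have "(- w (\<alpha> j)) k = comb (d j) k" for j k by (simp only: d(2))
  then have wd: "w (\<alpha> j) k = - comb (d j) k" for j k
    by (metis minus_minus uminus_apply)
  have "w \<beta> = (\<lambda>k. \<Sum>j\<in>UNIV. c j * w (\<alpha> j) k)"
    by (simp only: c(2) comb_def wsum[OF finite])
  also have "\<dots> = - comb (\<lambda>l. \<Sum>j\<in>UNIV. c j * d j l)"
  proof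
    fix k
    have "(\<Sum>j\<in>UNIV. c j * w (\<alpha> j) k) = - (\<Sum>j\<in>UNIV. \<Sum>l\<in>UNIV. c j * d j l * \<alpha> l k)"
      unfolding wd comb_def by (simp add: sum_negf sum_distrib_left mult.assoc)
    also have "\<dots> = - (\<Sum>l\<in>UNIV. \<Sum>j\<in>UNIV. c j * d j l * \<alpha> l k)"
      by (subst sum.swap) (rule refl)
    finally show "(\<Sum>j\<in>UNIV. c j * w (\<alpha> j) k) = (- comb (\<lambda>l. \<Sum>j\<in>UNIV. c j * d j l)) k"
      by (simp add: comb_def sum_distrib_right)
  qed
  finally have "- w \<beta> = comb (\<lambda>l. \<Sum>j\<in>UNIV. c j * d j l)" by (metis minus_minus)
  moreover have "0 \<le> (\<Sum>j\<in>UNIV. c j * d j l)" for l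
    using c(1) d(1) by (simp add: sum_nonneg)
  moreover have "- w \<beta> \<in> \<Phi>" using weyl_root[OF assms(1) b] by simp
  ultimately have "- w \<beta> \<in> \<Phi>pos"
    by (intro pos_rootsI[of _ "\<lambda>l. \<Sum>j\<in>UNIV. c j * d j l"]) simp_all
  then show ?thesis using not_pos_and_neg by blast
qed

text \<open>A descent i of w w'^-1 makes w' w^-1 \<alpha>_i negative. Its opposite is positive, and
  w'^-1 sends it to - w^-1 \<alpha>_i, which is positive although w'^-1 negates all positive
  roots.\<close>

lemma longest_unique_aux:
  assumes "w \<in> W" "\<And>i. inv w (\<alpha> i) \<notin> \<Phi>pos" "w' \<in> W" "\<And>i. inv w' (\<alpha> i) \<notin> \<Phi>pos"
  shows "w = w'"
proof (rule ccontr)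
  assume "w \<noteq> w'"
  let ?u = "w \<circ> inv w'"
  have u: "?u \<in> W" using assms by simp
  have "?u \<noteq> id"
    using \<open>w \<noteq> w'\<close> assms by (metis comp_assoc comp_id id_comp weyl_inv_comp(1))
  then obtain i where i: "inv ?u (\<alpha> i) \<notin> \<Phi>pos" using ex_descent[OF u] descent_iff(1)[OF u] by blast
  have "inv ?u (\<alpha> i) = w' (inv w (\<alpha> i))"
    using inv_weyl_comp[of w "inv w'"] assms by simp
  then have "- w' (inv w (\<alpha> i)) \<in> \<Phi>pos"
    using i assms root_pos_or_neg[of "inv ?u (\<alpha> i)"] u by simp
  then have "inv w' (- w' (inv w (\<alpha> i))) \<notin> \<Phi>pos"
    using all_descents_neg[of "inv w'"] assms by simp
  moreover have "inv w' (- w' (inv w (\<alpha> i))) = - inv w (\<alpha> i)"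
    using assms weyl_minus[of "inv w'"] by simp
  ultimately have "- inv w (\<alpha> i) \<notin> \<Phi>pos" by simp
  then show False using assms root_pos_or_neg[of "inv w (\<alpha> i)"] by simp
qed

lemma longest: "lo \<in> W" "v \<in> W \<Longrightarrow> len v \<le> len lo"
proof -
  have "\<exists>w\<in>W. \<forall>v\<in>W. len v \<le> len w"
  proof -
    have "len ` W \<noteq> {}" "finite (len ` W)" using id_in_weyl by (simp_all, blast)
    then have "Max (len ` W) \<in> len ` W" by (rule Max_in[rotated])
    then show ?thesis using \<open>finite (len ` W)\<close> by (metis (no_types, lifting) Max_ge image_iff)
  qed
  then obtain w where w: "w \<in> W" "\<forall>v\<in>W. len v \<le> len w" by blast
  have "\<exists>!w. w \<in> W \<and> (\<forall>v\<in>W. len v \<le> len w)"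
  proof (rule ex1I[of _ w])
    fix u assume u: "u \<in> W \<and> (\<forall>v\<in>W. len v \<le> len u)"
    show "u = w"
      by (rule longest_unique_aux) (use u w longest_all_descents in blast)+
  qed (use w in blast)
  from theI'[OF this] show "lo \<in> W" "v \<in> W \<Longrightarrow> len v \<le> len lo"
    unfolding longest_def by auto
qed

lemma inv_longest_neg: "\<beta> \<in> \<Phi>pos \<Longrightarrow> inv lo \<beta> \<notin> \<Phi>pos"
  using all_descents_neg[of "inv lo"] longest_all_descents[of "lo"] longest by simp

lemma len_less_longest: "v \<in> W \<Longrightarrow> v \<noteq> lo \<Longrightarrow> len v < len lo"
proof (rule ccontr)
  assume v: "v \<in> W" "v \<noteq> lo" and "\<not> len v < len lo"
  then have "\<forall>u\<in>W. len u \<le> len v" using longest(2) by (meson le_trans not_le)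
  then have "v = lo"
    by (intro longest_unique_aux) (use v longest longest_all_descents in blast)+
  then show False using v by simp
qed

lemma longest_neg: assumes "\<beta> \<in> \<Phi>pos" shows "lo \<beta> \<notin> \<Phi>pos"
proof
  assume "lo \<beta> \<in> \<Phi>pos"
  from inv_longest_neg[OF this] show False using assms longest(1) by simp
qed

subsection \<open>Bruhat order\<close>

abbreviation "bruhat \<equiv> bruhat_le A"

definition bruhat_edge :: "'i wg \<Rightarrow> 'i wg \<Rightarrow> bool" where
  "bruhat_edge a b \<longleftrightarrow> (\<exists>r\<in>reflections A. b = a \<circ> r \<and> len a < len b)"

lemma bruhat_alt: "bruhat v w \<longleftrightarrow> v \<in> W \<and> bruhat_edge\<^sup>*\<^sup>* v w"
  by (simp add: bruhat_le_def bruhat_edge_def[abs_def])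

text \<open>The order is defined by right multiplication, the root criterion for lengths by left
  multiplication; conjugating by a passes between them. Replacing u by \<open>u \<circ> s i\<close>
  changes the sign of the root but not the reflection, so the root can be taken positive.\<close>

lemma bruhat_edge_left:
  assumes "a \<in> W" "bruhat_edge a b"
  obtains u i where "u \<in> W" "u (\<alpha> i) \<in> \<Phi>pos" "b = (u \<circ> s i \<circ> inv u) \<circ> a" "len a < len b"
proof -
  obtain x i where x: "x \<in> W" "b = a \<circ> (x \<circ> s i \<circ> inv x)" "len a < len b"
    using assms by (auto simp: bruhat_edge_def reflections_def)
  let ?u = "a \<circ> x"
  have u: "?u \<in> W" using x assms by simp
  have b: "b = (?u \<circ> s i \<circ> inv ?u) \<circ> a"
    using x assms by (simp add: inv_weyl_comp fun_eq_iff weyl_apply_inv)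
  show thesis
  proof (cases "?u (\<alpha> i) \<in> \<Phi>pos")
    case True
    then show ?thesis using that u b x(3) by blast
  next
    case False
    let ?u' = "?u \<circ> s i"
    have "?u' (\<alpha> i) = - ?u (\<alpha> i)" using u by (simp only: o_apply sref_simple_root weyl_minus x(1) assms(1))
    then have "?u' (\<alpha> i) \<in> \<Phi>pos"
      using False minus_pos_iff[of "?u (\<alpha> i)"] weyl_root[OF u] by (metis simple_root_in_roots)
    moreover have "?u' \<circ> s i \<circ> inv ?u' = ?u \<circ> s i \<circ> inv ?u"
      using u by (simp only: inv_weyl_comp sref_in_weyl inv_sref) (simp add: fun_eq_iff)
    ultimately show ?thesis using that[of ?u' i] u b x(3) by (metis sref_in_weyl weyl_comp)
  qed
qed

lemma bruhat_edgeI: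
  assumes "u \<in> W" "a \<in> W" "len a < len ((u \<circ> s i \<circ> inv u) \<circ> a)"
  shows "bruhat_edge a ((u \<circ> s i \<circ> inv u) \<circ> a)"
  unfolding bruhat_edge_def
proof (intro bexI conjI assms(3))
  let ?x = "inv a \<circ> u"
  show "?x \<circ> s i \<circ> inv ?x \<in> reflections A" unfolding reflections_def using assms by auto
  show "(u \<circ> s i \<circ> inv u) \<circ> a = a \<circ> (?x \<circ> s i \<circ> inv ?x)"
    using assms by (simp add: inv_weyl_comp fun_eq_iff weyl_apply_inv)
qed

lemma bruhat_edge_sref: "w \<in> W \<Longrightarrow> len w < len (s i \<circ> w) \<Longrightarrow> bruhat_edge w (s i \<circ> w)"
  using bruhat_edgeI[of id w i] by (simp add: inv_id)

lemma bruhat_edge_in_weyl: "bruhat_edge a b \<Longrightarrow> a \<in> W \<Longrightarrow> b \<in> W"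
  by (metis bruhat_edge_left sref_in_weyl weyl_comp weyl_inv)

lemma bruhat_refl [simp]: "w \<in> W \<Longrightarrow> bruhat w w"
  by (simp add: bruhat_alt)

lemma bruhat_trans: "bruhat u v \<Longrightarrow> bruhat v w \<Longrightarrow> bruhat u w"
  by (auto simp: bruhat_alt)

lemma bruhat_weyl: assumes "bruhat v w" shows "v \<in> W" "w \<in> W"
proof -
  show v: "v \<in> W" using assms by (simp add: bruhat_alt)
  from assms have "bruhat_edge\<^sup>*\<^sup>* v w" by (simp add: bruhat_alt)
  then show "w \<in> W" by (induction rule: rtranclp_induct) (auto simp: v bruhat_edge_in_weyl)
qed

lemma bruhat_len: "bruhat v w \<Longrightarrow> v = w \<or> len v < len w"
proof -
  assume "bruhat v w"
  then have "bruhat_edge\<^sup>*\<^sup>* v w" by (simp add: bruhat_alt)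
  then show ?thesis by (induction rule: rtranclp_induct) (auto simp: bruhat_edge_def)
qed

lemma bruhat_lt_len: "bruhat_lt A v w \<Longrightarrow> len v < len w"
  using bruhat_len by (auto simp: bruhat_lt_def)

lemma bruhat_sref: "w \<in> W \<Longrightarrow> len w < len (s i \<circ> w) \<Longrightarrow> bruhat w (s i \<circ> w)"
  using bruhat_edge_sref by (auto simp: bruhat_alt)

text \<open>Conjugation by \<open>s i\<close> moves the positive root \<beta> of the edge to another
  positive root unless \<beta> = \<alpha>_i, when b is \<open>s i \<circ> a\<close>. The length
  criterion is unaffected, since (s_i a)^-1 (s_i \<beta>) = a^-1 \<beta>.\<close>

lemma bruhat_edge_lift:
  assumes a: "a \<in> W" and e: "bruhat_edge a b"
  shows "s i \<circ> a = b \<or> bruhat_edge (s i \<circ> a) (s i \<circ> b)"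
proof -
  obtain u j where u: "u \<in> W" "u (\<alpha> j) \<in> \<Phi>pos" and b: "b = (u \<circ> s j \<circ> inv u) \<circ> a" and l: "len a < len b"
    using bruhat_edge_left[OF a e] by metis
  show ?thesis
  proof (cases "u (\<alpha> j) = \<alpha> i")
    case True
    then have "u \<circ> s j \<circ> inv u = s i" using reflection_eqI[of u id j i] u by (simp add: inv_id)
    then show ?thesis using b by simp
  next
    case False
    let ?x = "s i \<circ> u"
    have sa: "s i \<circ> a \<in> W" using a by simp
    have x: "?x \<in> W" "?x (\<alpha> j) \<in> \<Phi>pos" using sref_pos[OF u(2) False] u by simp_all
    have sb: "s i \<circ> b = (?x \<circ> s j \<circ> inv ?x) \<circ> (s i \<circ> a)"
      using u by (simp only: b inv_sref_comp comp_assoc sref_o_sref_o)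
    have "inv a (u (\<alpha> j)) \<in> \<Phi>pos"
      using len_reflection_less_iff(2)[OF u(1) a u(2)] l b by simp
    then have "inv (s i \<circ> a) (?x (\<alpha> j)) \<in> \<Phi>pos" using a by (simp add: inv_sref_comp)
    then have "len (s i \<circ> a) < len ((?x \<circ> s j \<circ> inv ?x) \<circ> (s i \<circ> a))"
      using len_reflection_less_iff(2)[OF x(1) sa x(2)] by blast
    then show ?thesis using bruhat_edgeI[OF x(1) sa] sb by metis
  qed
qed

lemma bruhat_sref_cases:
  assumes "bruhat a b" shows "bruhat (s i \<circ> a) b \<or> bruhat (s i \<circ> a) (s i \<circ> b)"
proof -
  have a: "a \<in> W" and "bruhat_edge\<^sup>*\<^sup>* a b" using assms by (auto simp: bruhat_alt)
  from this(2) have "b \<in> W \<and> (bruhat (s i \<circ> a) b \<or> bruhat (s i \<circ> a) (s i \<circ> b))"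
  proof (induction rule: rtranclp_induct)
    case base
    show ?case using a bruhat_refl[of "s i \<circ> a"] sref_comp_in_weyl_iff by blast
  next
    case (step b b')
    have b: "b \<in> W" using step by simp
    then have b': "b' \<in> W" using step bruhat_edge_in_weyl by blast
    have 1: "bruhat b b'" using step b by (auto simp: bruhat_alt)
    have "s i \<circ> b = b' \<or> bruhat (s i \<circ> b) (s i \<circ> b')"
      using bruhat_edge_lift[OF b step(2), of i] b by (auto simp: bruhat_alt)
    then show ?case using step.IH 1 bruhat_trans b' by blast
  qed
  then show ?thesis by simp
qed

text \<open>The instance of the lifting property that controls the support of the Kazhdan--Lusztig
  basis when a simple generator is multiplied on.\<close>

lemma bruhat_lift:
  assumes "bruhat (s i \<circ> x) v" "len v < len (s i \<circ> v)"
  shows "bruhat x (s i \<circ> v)"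
  using bruhat_sref_cases[OF assms(1), of i] bruhat_sref[OF bruhat_weyl(2)[OF assms(1)] assms(2)]
    bruhat_trans by auto

end

text \<open>Models \<open>uop\<close> on a 2m-gon. A function produced by one generator is constant
  along every second edge, so \<open>F\<close> is indexed by edges; the other generator combines the
  two neighbours of an edge with weights \<open>q k\<close> and \<open>c - q k\<close>.\<close>

definition edge_op :: "'r::idom \<Rightarrow> (int \<Rightarrow> 'r) \<Rightarrow> (int \<Rightarrow> 'r) \<Rightarrow> int \<Rightarrow> 'r" where
  "edge_op c q F k = q k * F (k - 1) + (c - q k) * F (k + 1)"

text \<open>The left-hand sides are the Chebyshev polynomials that express the symmetrizer of the dihedral
  Hecke algebra through \<open>edge_op\<close>. The relations on \<open>q\<close> are the addition formula for the
  roots of type \<open>A\<^sub>2\<close>, \<open>B\<^sub>2\<close> and \<open>G\<^sub>2\<close> in convex order.\<close>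

lemma edge_op_3:
  assumes per: "\<forall>k\<ge>0. q (k + 3) = c - q k" and "q 1 * (q 0 + q 2 - c) = q 0 * q 2 - 1"
  shows "edge_op c q (edge_op c q F) 2 - F 2 = F 0 * (q 1 * q 2) + F 2 * (q 3 * q 4) + F 4 * (q 5 * q 6)" (is ?A)
    and "edge_op c q (edge_op c q F) 3 - F 3 = F 1 * (q 2 * q 3) + F 3 * (q 4 * q 5) + F 5 * (q 6 * q 7)" (is ?B)
proof -
  note q = per[rule_format, of 0, simplified] per[rule_format, of 1, simplified] per[rule_format, of 2, simplified] per[rule_format, of 3, simplified] per[rule_format, of 4, simplified]
  show ?A
    apply (simp add: edge_op_def q)
    using assms(2-) by algebra
  show ?B
    apply (simp add: edge_op_def q)
    using assms(2-) by algebra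
qed

lemma edge_op_4:
  assumes per: "\<forall>k\<ge>0. q (k + 4) = c - q k" and
    "q 1 * (q 0 + q 2 - c) = q 0 * q 2 - 1" "q 2 * (q 0 + q 3 - c) = q 0 * q 3 - 1"
  shows "edge_op c q (edge_op c q (edge_op c q F)) 3 - 2 * edge_op c q F 3 = F 0 * (q 1 * q 2 * q 3) + F 2 * (q 3 * q 4 * q 5) + F 4 * (q 5 * q 6 * q 7) + F 6 * (q 7 * q 8 * q 9)" (is ?A)
    and "edge_op c q (edge_op c q (edge_op c q F)) 4 - 2 * edge_op c q F 4 = F 1 * (q 2 * q 3 * q 4) + F 3 * (q 4 * q 5 * q 6) + F 5 * (q 6 * q 7 * q 8) + F 7 * (q 8 * q 9 * q 10)" (is ?B)
proof -
  note q = per[rule_format, of 0, simplified] per[rule_format, of 1, simplified] per[rule_format, of 2, simplified] per[rule_format, of 3, simplified] per[rule_format, of 4, simplified] per[rule_format, of 5, simplified] per[rule_format, of 6, simplified]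
  show ?A
    apply (simp add: edge_op_def q)
    using assms(2-) by algebra
  show ?B
    apply (simp add: edge_op_def q)
    using assms(2-) by algebra
qed

text \<open>In convex order the positive roots of G2 are (1,0), (3,1), (2,1), (3,2), (1,1), (0,1).
  The five relations correspond to all ways of writing one of them as a sum of two others.\<close>

lemma edge_op_6:
  assumes per: "\<forall>k\<ge>0. q (k + 6) = c - q k" and
    "q 1 * (q 0 + q 2 - c) = q 0 * q 2 - 1" "q 2 * (q 0 + q 4 - c) = q 0 * q 4 - 1"
    "q 4 * (q 0 + q 5 - c) = q 0 * q 5 - 1" "q 3 * (q 2 + q 4 - c) = q 2 * q 4 - 1"
    "q 3 * (q 1 + q 5 - c) = q 1 * q 5 - 1"
  shows "edge_op c q (edge_op c q (edge_op c q (edge_op c q (edge_op c q F)))) 5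
      - 4 * edge_op c q (edge_op c q (edge_op c q F)) 5 + 3 * edge_op c q F 5
    = F 0 * (q 1 * q 2 * q 3 * q 4 * q 5) + F 2 * (q 3 * q 4 * q 5 * q 6 * q 7)
      + F 4 * (q 5 * q 6 * q 7 * q 8 * q 9) + F 6 * (q 7 * q 8 * q 9 * q 10 * q 11)
      + F 8 * (q 9 * q 10 * q 11 * q 12 * q 13) + F 10 * (q 11 * q 12 * q 13 * q 14 * q 15)" (is ?A)
    and "edge_op c q (edge_op c q (edge_op c q (edge_op c q (edge_op c q F)))) 6
      - 4 * edge_op c q (edge_op c q (edge_op c q F)) 6 + 3 * edge_op c q F 6
    = F 1 * (q 2 * q 3 * q 4 * q 5 * q 6) + F 3 * (q 4 * q 5 * q 6 * q 7 * q 8)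
      + F 5 * (q 6 * q 7 * q 8 * q 9 * q 10) + F 7 * (q 8 * q 9 * q 10 * q 11 * q 12)
      + F 9 * (q 10 * q 11 * q 12 * q 13 * q 14) + F 11 * (q 12 * q 13 * q 14 * q 15 * q 16)" (is ?B)
proof -
  note q = per[rule_format, of 0, simplified] per[rule_format, of 1, simplified] per[rule_format, of 2, simplified] per[rule_format, of 3, simplified] per[rule_format, of 4, simplified] per[rule_format, of 5, simplified] per[rule_format, of 6, simplified] per[rule_format, of 7, simplified] per[rule_format, of 8, simplified] per[rule_format, of 9, simplified] per[rule_format, of 10, simplified]
  show ?A
    apply (simp add: edge_op_def q)
    using assms(2-) by algebra
  show ?B
    apply (simp add: edge_op_def q)
    using assms(2-) by algebra
qed

section \<open>Braid relations\<close>

fun alt :: "'a \<Rightarrow> 'a \<Rightarrow> nat \<Rightarrow> 'a list" where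
  "alt i j 0 = []"
| "alt i j (Suc n) = i # alt j i n"

lemma length_alt [simp]: "length (alt i j n) = n"
  by (induction n arbitrary: i j) simp_all

lemma alt_snoc: "alt i j (Suc n) = alt i j n @ [if even n then i else j]"
  by (induction n arbitrary: i j) simp_all

lemma alt_add: "alt i j (a + b) = alt i j a @ (if even a then alt i j b else alt j i b)"
  by (induction a arbitrary: i j) auto

lemma rev_alt: "rev (alt i j n) = (if even n then alt j i n else alt i j n)"
proof (induction n arbitrary: i j)
  case (Suc n)
  have "rev (alt i j (Suc n)) = (if even n then i else j) # rev (alt i j n)"
    by (simp only: alt_snoc rev_append rev.simps append.simps)
  then show ?case by (auto simp: Suc)
qed simp

context cartan_datum
begin

subsection \<open>Rank two\<close>

definition rt :: "'i \<Rightarrow> 'i \<Rightarrow> int \<Rightarrow> int \<Rightarrow> 'i wt" where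
  "rt i j x y = (\<lambda>k. x * A k i + y * A k j)"

text \<open>Coordinates of the consecutive positive roots of the rank two system with Cartan entries
  \<open>-a\<close>, \<open>-b\<close>.\<close>

fun root_coords :: "int \<Rightarrow> int \<Rightarrow> nat \<Rightarrow> int \<times> int" where
  "root_coords a b 0 = (1, 0)"
| "root_coords a b (Suc k) = (case root_coords b a k of (x, y) \<Rightarrow> (a * x - y, x))"

text \<open>The order of the product of the two simple reflections. For distinct indices the last
  branch occurs only for product 3, by \<open>cartan_product_less_4\<close>.\<close>

definition cox :: "'i \<Rightarrow> 'i \<Rightarrow> nat" where
  "cox i j = (if A i j * A j i = 0 then 2 else if A i j * A j i = 1 then 3
     else if A i j * A j i = 2 then 4 else 6)"

lemma cox_commute: "cox i j = cox j i"
  by (simp add: cox_def mult.commute)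

lemma sref_rt:
  "s i (rt i j x y) = rt i j (- x - y * A i j) y"
  "s j (rt i j x y) = rt i j x (- y - x * A j i)"
  by (simp_all add: sref_def rt_def fun_eq_iff algebra_simps)

lemma sref_diff_rt:
  "s i (lam - rt i j x y) = lam - rt i j (lam i - x - y * A i j) y"
  "s j (lam - rt i j x y) = lam - rt i j x (lam j - y - x * A j i)"
  by (simp_all add: sref_def rt_def fun_eq_iff algebra_simps)

lemma rt_swap: "rt j i x y = rt i j y x"
  by (simp add: rt_def add.commute)

lemma simple_root_rt: "\<alpha> i = rt i j 1 0" "\<alpha> j = rt i j 0 1"
  by (simp_all add: rt_def simple_root_def)

lemma rt_comb:
  assumes "i \<noteq> j"
  shows "rt i j x y = comb (\<lambda>k. if k = i then x else if k = j then y else 0)"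
proof -
  have "(\<lambda>k. if k = i then x else if k = j then y else 0)
      = (\<lambda>k. if k = i then x else 0) + (\<lambda>k. if k = j then y else 0)"
    using assms by (simp add: fun_eq_iff)
  then have "comb (\<lambda>k. if k = i then x else if k = j then y else 0)
      = (\<lambda>k. x * \<alpha> i k) + (\<lambda>k. y * \<alpha> j k)"
    by (simp only: comb_add comb_unit)
  then show ?thesis by (simp add: rt_def simple_root_def fun_eq_iff)
qed

lemma rt_add: "rt i j x y + rt i j x' y' = rt i j (x + x') (y + y')"
  by (simp add: rt_def fun_eq_iff algebra_simps)

lemma rt_minus: "- rt i j x y = rt i j (- x) (- y)"
  by (simp add: rt_def fun_eq_iff)

text \<open>The Gram determinant of two simple roots is positive. It appears, times
  \<open>nsq j\<close>, as the norm of the nonzero vector \<open>?v\<close>, a multiple of the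
  projection of \<alpha>_i orthogonal to \<alpha>_j.\<close>

lemma cartan_product_less_4:
  assumes "i \<noteq> j" shows "A i j * A j i < 4"
proof -
  let ?b = "form (\<alpha> i) (\<alpha> j)"
  let ?v = "rt i j (nsq j) (- ?b)"
  have "?v \<noteq> 0"
  proof
    assume "?v = 0"
    then have "?v = rt i j 0 0" by (simp add: rt_def zero_fun_def)
    then have "comb (\<lambda>k. if k = i then nsq j else if k = j then - ?b else 0)
        = comb (\<lambda>k. if k = i then 0 else if k = j then 0 else 0)"
      by (simp only: rt_comb[OF assms, symmetric])
    from fun_cong[OF comb_inj[THEN iffD1, OF this], of i] show False using nsq_pos[of j] by simp
  qed
  then have "form ?v ?v > 0" by (rule form_pos)
  moreover have v: "?v = (\<lambda>k. nsq j * \<alpha> i k) + (\<lambda>k. (- ?b) * \<alpha> j k)"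
    by (simp add: rt_def simple_root_def fun_eq_iff)
  have fv: "form ?v a = nsq j * form (\<alpha> i) a - ?b * form (\<alpha> j) a" for a
  proof -
    have "form ?v a = form (\<lambda>k. nsq j * \<alpha> i k) a + form (\<lambda>k. (- ?b) * \<alpha> j k) a"
      by (subst v) (rule form_add)
    then show ?thesis unfolding form_scale by simp
  qed
  then have "form ?v ?v = nsq j * (nsq j * nsq i - ?b * ?b) - ?b * (nsq j * ?b - ?b * nsq j)"
    using fv[of ?v] fv[of "\<alpha> i"] fv[of "\<alpha> j"] form_commute[of "\<alpha> i" ?v] form_commute[of "\<alpha> j" ?v]
      form_commute[of "\<alpha> j" "\<alpha> i"] by metis
  ultimately have "nsq j * (nsq j * nsq i - ?b * ?b) > 0" by (simp add: algebra_simps)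
  then have "?b * ?b < nsq i * nsq j" using nsq_pos[of j] by (simp add: zero_less_mult_iff mult.commute)
  moreover have "(nsq i * nsq j) * (A i j * A j i) = 4 * (?b * ?b)"
  proof -
    have "(nsq i * nsq j) * (A i j * A j i) = (A i j * nsq i) * (A j i * nsq j)" by (simp add: algebra_simps)
    also have "\<dots> = (2 * ?b) * (2 * ?b)"
      by (simp only: form_simple_root_cartan[symmetric] form_commute[of "\<alpha> j" "\<alpha> i"])
    finally show ?thesis by simp
  qed
  ultimately have "(nsq i * nsq j) * (A i j * A j i) < (nsq i * nsq j) * 4" by linarith
  then show ?thesis using nsq_pos[of i] nsq_pos[of j] by (simp add: mult_less_cancel_left_pos)
qed

lemma cartan_pair_cases:
  assumes "i \<noteq> j"
  obtains "A i j = 0" "A j i = 0" | "A i j = -1" "A j i = -1"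
    | "A i j = -2" "A j i = -1" | "A i j = -1" "A j i = -2"
    | "A i j = -3" "A j i = -1" | "A i j = -1" "A j i = -3"
proof -
  have z: "A i j = 0 \<longleftrightarrow> A j i = 0" using finite_type by (auto simp: finite_type_cartan_def)
  define a b where "a = - A i j" and "b = - A j i"
  have ab: "a \<ge> 0" "b \<ge> 0" "a * b < 4" "a = 0 \<longleftrightarrow> b = 0"
    using cartan_off_diag[of i j] cartan_off_diag[of j i] assms cartan_product_less_4[of i j] z
    by (auto simp: a_def b_def)
  have "x < 4" if "0 \<le> y" "x * y < 4" "y = 0 \<longrightarrow> x = 0" for x y :: int
  proof (rule ccontr)
    assume "\<not> x < 4"
    then have "4 * 1 \<le> x * y" using that by (intro mult_mono) auto
    then show False using that by simp
  qed
  from this[of b a] this[of a b] have "a < 4" "b < 4" using ab mult.commute[of a b] by linarith+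
  then have "a \<in> {0, 1, 2, 3}" "b \<in> {0, 1, 2, 3}" using ab by auto
  moreover have "A i j = - a" "A j i = - b" by (simp_all add: a_def b_def)
  ultimately show thesis using ab that by (elim insertE emptyE) simp_all
qed

lemma word_elt_alt_commute:
  assumes "i \<noteq> j" shows "elt (alt i j (cox i j)) = elt (alt j i (cox i j))"
proof
  fix lam
  \<comment> \<open>The zero correction puts \<open>lam\<close> in the shape on which
    \<open>sref_diff_rt\<close> computes; both words then subtract the same combination of
    \<alpha>_i and \<alpha>_j.\<close>
  have lam: "lam = lam - rt i j 0 0" by (simp add: rt_def fun_eq_iff)
  have "elt (alt i j (cox i j)) (lam - rt i j 0 0) = elt (alt j i (cox i j)) (lam - rt i j 0 0)"
    by (rule cartan_pair_cases[OF assms]; simp add: cox_def eval_nat_numeral sref_diff_rt; simp add: algebra_simps)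
  then show "elt (alt i j (cox i j)) lam = elt (alt j i (cox i j)) lam"
    using lam by simp
qed

lemma word_elt_alt_root:
  "elt (alt i j k) (\<alpha> (if even k then i else j))
    = rt i j (fst (root_coords (- A i j) (- A j i) k)) (snd (root_coords (- A i j) (- A j i) k))"
proof (induction k arbitrary: i j)
  case 0
  then show ?case by (simp add: simple_root_rt(1)[of i j])
next
  case (Suc k)
  let ?c = "root_coords (- A j i) (- A i j) k"
  have "elt (alt i j (Suc k)) (\<alpha> (if even (Suc k) then i else j))
      = s i (elt (alt j i k) (\<alpha> (if even k then j else i)))"
    by simp
  also have "\<dots> = rt i j (- snd ?c - fst ?c * A i j) (fst ?c)" by (simp only: Suc rt_swap[of j i] sref_rt)
  also have "- snd ?c - fst ?c * A i j = - A i j * fst ?c - snd ?c" by simp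
  finally show ?case by (simp only: root_coords.simps case_prod_beta fst_conv snd_conv)
qed

lemma rank_two_roots:
  assumes "i \<noteq> j" "k < cox i j"
  shows "\<exists>x y. 0 \<le> x \<and> 0 \<le> y \<and> elt (alt i j k) (\<alpha> (if even k then i else j)) = rt i j x y"
proof -
  have "k < 6" using assms(2) by (simp add: cox_def split: if_splits)
  then have k: "k = 0 \<or> k = 1 \<or> k = 2 \<or> k = 3 \<or> k = 4 \<or> k = 5" by presburger
  have "0 \<le> fst (root_coords (- A i j) (- A j i) k) \<and> 0 \<le> snd (root_coords (- A i j) (- A j i) k)"
    using k assms(2) by (rule_tac cartan_pair_cases[OF assms(1)])
      (elim disjE; simp add: cox_def eval_nat_numeral)+
  then show ?thesis using word_elt_alt_root by blast
qed

text \<open>After m letters the sequence of rank two roots starts again with opposite sign; this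
  yields \<open>q_period\<close>.\<close>

lemma alt_cox_root:
  assumes "i \<noteq> j"
  shows "elt (alt i j (cox i j)) (\<alpha> (if even (cox i j) then i else j)) = - \<alpha> i"
  by (rule cartan_pair_cases[OF assms]; simp add: cox_def;
      simp add: eval_nat_numeral simple_root_rt(1)[of i j] simple_root_rt(2)[of j i] sref_rt rt_minus)

subsection \<open>Reduced words\<close>

lemma neg_rt:
  assumes "w \<in> W" "w (\<alpha> i) \<notin> \<Phi>pos" "w (\<alpha> j) \<notin> \<Phi>pos" "i \<noteq> j" "0 \<le> x" "0 \<le> y" "rt i j x y \<in> \<Phi>"
  shows "w (rt i j x y) \<notin> \<Phi>pos"
proof -
  have "- w (\<alpha> i) \<in> \<Phi>pos" "- w (\<alpha> j) \<in> \<Phi>pos"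
    using assms minus_pos_iff[of "w (\<alpha> i)"] minus_pos_iff[of "w (\<alpha> j)"] by simp_all
  then obtain c d where c: "\<And>k. 0 \<le> c k" "- w (\<alpha> i) = comb c" and d: "\<And>k. 0 \<le> d k" "- w (\<alpha> j) = comb d"
    by (auto simp: pos_roots_iff)
  have "rt i j x y = (\<lambda>k. x * \<alpha> i k) + (\<lambda>k. y * \<alpha> j k)"
    by (simp add: rt_def simple_root_def fun_eq_iff)
  then have "w (rt i j x y) = (\<lambda>k. x * w (\<alpha> i) k) + (\<lambda>k. y * w (\<alpha> j) k)"
    by (simp only: weyl_add[OF assms(1)] weyl_scale[OF assms(1)])
  then have "- w (rt i j x y) = (\<lambda>k. x * (- w (\<alpha> i)) k) + (\<lambda>k. y * (- w (\<alpha> j)) k)"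
    by (simp add: fun_eq_iff)
  also have "\<dots> = comb ((\<lambda>k. x * c k) + (\<lambda>k. y * d k))"
    by (simp only: c d comb_add comb_scale)
  finally have "- w (rt i j x y) \<in> \<Phi>pos"
    by (rule pos_rootsI[rotated]) (use assms c d in simp_all)
  then show ?thesis using not_pos_and_neg by blast
qed

text \<open>Each stripped letter is a descent: the corresponding root is a nonnegative combination
  of \<alpha>_i and \<alpha>_j, both of which inv w makes negative. The bound
  \<open>k \<le> cox i j\<close> keeps the coordinates nonnegative.\<close>

lemma two_descents_alt:
  assumes w: "w \<in> W" and ij: "i \<noteq> j" and di: "inv w (\<alpha> i) \<notin> \<Phi>pos" and dj: "inv w (\<alpha> j) \<notin> \<Phi>pos"
    and "k \<le> cox i j"
  shows "len (elt (rev (alt i j k)) \<circ> w) + k = len w"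
  using assms(5)
proof (induction k)
  case 0
  then show ?case by (simp add: id_comp)
next
  case (Suc k)
  let ?x = "if even k then i else j"
  let ?v = "elt (rev (alt i j k)) \<circ> w"
  have v: "?v \<in> W" using w by simp
  obtain x y where xy: "0 \<le> x" "0 \<le> y" and r: "elt (alt i j k) (\<alpha> ?x) = rt i j x y"
    using rank_two_roots[OF ij, of k] Suc.prems by auto
  have "inv ?v = inv w \<circ> elt (alt i j k)"
    using inv_weyl_comp[of "elt (rev (alt i j k))" w] w by (simp only: inv_word_elt rev_rev_ident word_elt_in_weyl)
  then have "inv ?v (\<alpha> ?x) = inv w (rt i j x y)" by (simp only: r o_apply)
  moreover have "rt i j x y \<in> \<Phi>" by (metis r simple_root_in_roots weyl_root word_elt_in_weyl)
  ultimately have "inv ?v (\<alpha> ?x) \<notin> \<Phi>pos" using neg_rt[of "inv w" i j x y] w ij di dj xy by simp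
  then have "len (s ?x \<circ> ?v) < len ?v" using descent_iff(1)[OF v] by blast
  then have "Suc (len (s ?x \<circ> ?v)) = len ?v" using len_descent[OF v] by metis
  moreover have "elt (rev (alt i j (Suc k))) \<circ> w = s ?x \<circ> ?v"
    by (simp only: alt_snoc rev_append rev.simps append.simps word_elt_Cons comp_assoc)
  moreover have "len ?v + k = len w" by (rule Suc.IH) (rule Suc_leD[OF Suc.prems])
  ultimately show ?case by (metis add_Suc add_Suc_right)
qed

lemma two_descents_word:
  assumes w: "w \<in> W" and ij: "i \<noteq> j" and d: "desc i w" "desc j w"
  obtains ws where "elt (alt i j (cox i j) @ ws) = w" "reduced (alt i j (cox i j) @ ws)"
    "elt (alt j i (cox i j) @ ws) = w" "reduced (alt j i (cox i j) @ ws)"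
proof -
  let ?m = "cox i j"
  let ?v = "elt (rev (alt i j ?m)) \<circ> w"
  have v: "?v \<in> W" using w by simp
  have l: "len ?v + ?m = len w"
    using two_descents_alt[OF w ij _ _ order_refl] d descent_iff(1)[OF w] by blast
  have eq: "elt (alt i j ?m @ red_word A ?v) = w"
    using red_word(1)[OF v] weyl_inv_comp(4)[of "elt (alt i j ?m)" w]
    by (simp only: word_elt_append inv_word_elt word_elt_in_weyl)
  moreover have "elt (alt j i ?m @ red_word A ?v) = w"
    using eq word_elt_alt_commute[OF ij] by (simp only: word_elt_append)
  ultimately show thesis using that[of "red_word A ?v"] l red_word(2)[OF v] by (simp add: reduced_def)
qed

text \<open>If the first letters i and j differ, both are descents, so the element also has reduced
  words starting with either alternating word and ending alike. Each shares its first letter with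
  one given word, so induction on tails applies, and the braid relation joins them.\<close>

theorem matsumoto:
  fixes E :: "'i \<Rightarrow> 'x \<Rightarrow> 'x"
  assumes braid: "\<And>i j x. i \<noteq> j \<Longrightarrow> foldr E (alt i j (cox i j)) x = foldr E (alt j i (cox i j)) x"
  assumes "reduced us" "reduced vs" "elt us = elt vs"
  shows "foldr E us x = foldr E vs x"
  using assms(2-)
proof (induction "length us" arbitrary: us vs)
  case 0
  then have "length vs = 0" by (metis reduced_def)
  then show ?case using 0 by simp
next
  case (Suc n)
  have len: "length vs = length us" using Suc.prems by (metis reduced_def)
  obtain i us' where us: "us = i # us'" using Suc.hyps by (cases us) auto
  obtain j vs' where vs: "vs = j # vs'" using Suc.hyps len by (cases vs) auto
  have red: "reduced us'" "reduced vs'" using Suc.prems us vs by (auto simp: reduced_Cons)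
  show ?case
  proof (cases "i = j")
    case True
    then have "elt us' = elt vs'"
      using Suc.prems(3) us vs by (metis sref_o_sref_o word_elt_Cons)
    then show ?thesis using Suc.hyps us vs red True by (metis Suc_inject foldr.simps(2) length_Cons o_apply)
  next
    case ij: False
    let ?w = "elt us"
    have "desc i ?w"
      using Suc.prems(1) us len_word_elt_le[of us'] by (simp only: reduced_def word_elt_Cons sref_o_sref_o) simp
    moreover have "desc j ?w"
      using Suc.prems(2,3) vs len_word_elt_le[of vs'] by (simp only: reduced_def word_elt_Cons sref_o_sref_o) simp
    ultimately obtain ws where ws: "elt (alt i j (cox i j) @ ws) = ?w" "reduced (alt i j (cox i j) @ ws)"
      "elt (alt j i (cox i j) @ ws) = ?w" "reduced (alt j i (cox i j) @ ws)"
      using two_descents_word[OF word_elt_in_weyl ij] by metis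
    obtain m where m: "cox i j = Suc m" by (metis cox_def numeral_eq_Suc)
    have tail: "foldr E (k # as) x = foldr E (k # bs) x"
      if "reduced (k # as)" "reduced (k # bs)" "elt (k # as) = elt (k # bs)" "length as = n" for k as bs
    proof -
      have "elt as = elt bs" using that(3) by (metis sref_o_sref_o word_elt_Cons)
      moreover have "reduced as" "reduced bs" using that by (auto simp: reduced_Cons)
      ultimately show ?thesis using Suc.hyps(1)[of as bs] that(4) by simp
    qed
    have "foldr E us x = foldr E (alt i j (cox i j) @ ws) x"
      using tail[of i us' "alt j i m @ ws"] us ws Suc.prems Suc.hyps(2) m by simp
    also have "\<dots> = foldr E (alt j i (cox i j) @ ws) x" using braid[OF ij] by simp
    also have "\<dots> = foldr E vs x"
      using tail[of j vs' "alt i j m @ ws"] vs ws Suc.prems Suc.hyps(2) m len by simp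
    finally show ?thesis .
  qed
qed

text \<open>Independence of the reduced word turns the arbitrary choice in \<open>red_word\<close>
  into a recursion along ascents.\<close>

lemma foldr_red_word_ascent:
  assumes "\<And>us vs. reduced us \<Longrightarrow> reduced vs \<Longrightarrow> elt us = elt vs \<Longrightarrow> foldr E us f = foldr E vs f"
    and "x \<in> W" "\<not> desc i x"
  shows "foldr E (red_word A (s i \<circ> x)) f = E i (foldr E (red_word A x) f)"
proof -
  have "s i \<circ> x \<in> W" using assms by simp
  then have "foldr E (red_word A (s i \<circ> x)) f = foldr E (i # red_word A x) f"
    using assms(1)[OF reduced_red_word reduced_Cons_red_word[OF assms(2,3)]] assms(2)
    by (metis red_word(1) word_elt_Cons)
  then show ?thesis by simp
qed

subsection \<open>Demazure--Lusztig type operators\<close>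

text \<open>\<open>uop\<close> is \<open>dop + t\<close>; it is constant along the edges \<open>{u, s i \<circ> u}\<close>.\<close>

definition hecke_weight :: "'r::idom \<Rightarrow> ('i wt \<Rightarrow> 'r) \<Rightarrow> bool" where
  "hecke_weight c p \<longleftrightarrow> (\<forall>\<beta>\<in>\<Phi>. p (- \<beta>) = c - p \<beta>)
     \<and> (\<forall>\<beta>\<in>\<Phi>. \<forall>\<gamma>\<in>\<Phi>. \<beta> + \<gamma> \<in> \<Phi> \<longrightarrow> p (\<beta> + \<gamma>) * (p \<beta> + p \<gamma> - c) = p \<beta> * p \<gamma> - 1)"

definition uop :: "'r::idom \<Rightarrow> ('i wt \<Rightarrow> 'r) \<Rightarrow> 'i \<Rightarrow> ('i wg \<Rightarrow> 'r) \<Rightarrow> 'i wg \<Rightarrow> 'r" where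
  "uop c p i g = (\<lambda>u. if u \<in> W
     then p (inv u (\<alpha> i)) * g u + (c - p (inv u (\<alpha> i))) * g (s i \<circ> u) else 0)"

definition dop :: "'r::idom \<Rightarrow> 'r \<Rightarrow> ('i wt \<Rightarrow> 'r) \<Rightarrow> 'i \<Rightarrow> ('i wg \<Rightarrow> 'r) \<Rightarrow> 'i wg \<Rightarrow> 'r" where
  "dop t c p i g = (\<lambda>u. if u \<in> W
     then (p (inv u (\<alpha> i)) - t) * g u + (c - p (inv u (\<alpha> i))) * g (s i \<circ> u) else 0)"

lemma hecke_weight_minus: "hecke_weight c p \<Longrightarrow> \<beta> \<in> \<Phi> \<Longrightarrow> p (- \<beta>) = c - p \<beta>"
  by (simp add: hecke_weight_def)

lemma dop_uop: "u \<in> W \<Longrightarrow> dop t c p i g u = uop c p i g u - t * g u"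
  by (simp add: dop_def uop_def algebra_simps)

lemma uop_dop: "uop c p i (dop t c p j g) = (\<lambda>u. uop c p i (uop c p j g) u - t * uop c p i g u)"
  by (rule ext) (simp add: uop_def dop_def algebra_simps)

lemma uop_diff: "uop c p i (\<lambda>u. f u - t * g u) = (\<lambda>u. uop c p i f u - t * uop c p i g u)"
  by (rule ext) (simp add: uop_def algebra_simps)

lemma uop_scale: "uop c p i (\<lambda>u. x * g u) = (\<lambda>u. x * uop c p i g u)"
  by (rule ext) (simp add: uop_def algebra_simps)

lemma inv_sref_root:
  assumes "u \<in> W" shows "inv (s i \<circ> u) (\<alpha> i) = - inv u (\<alpha> i)"
  unfolding inv_sref_comp[OF assms] by (simp add: sref_simple_root weyl_minus[OF weyl_inv[OF assms]])

text \<open>At the other end of the edge the root is negated, so the weights p and c - p are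
  interchanged together with the two values of g.\<close>

lemma uop_edge:
  assumes "hecke_weight c p" "u \<in> W" shows "uop c p i g (s i \<circ> u) = uop c p i g u"
proof -
  have "p (- inv u (\<alpha> i)) = c - p (inv u (\<alpha> i))"
    by (rule hecke_weight_minus[OF assms(1)]) (use assms in simp)
  then show ?thesis
    using assms(2) unfolding uop_def sref_comp_in_weyl_iff inv_sref_root[OF assms(2)] sref_o_sref_o
    by simp
qed

lemma uop_uop:
  assumes "hecke_weight c p" shows "uop c p i (uop c p i g) = (\<lambda>u. c * uop c p i g u)"
proof
  fix u
  show "uop c p i (uop c p i g) u = c * uop c p i g u"
  proof (cases "u \<in> W")
    case True
    have "uop c p i (uop c p i g) u
        = p (inv u (\<alpha> i)) * uop c p i g u + (c - p (inv u (\<alpha> i))) * uop c p i g (s i \<circ> u)"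
      unfolding uop_def[of c p i "uop c p i g"] using True by simp
    then show ?thesis unfolding uop_edge[OF assms True] by (simp add: algebra_simps)
  qed (simp add: uop_def)
qed

end

text \<open>A closed walk around the orbit of a rank two parabolic subgroup: \<open>V k\<close> are its vertices and
  \<open>q k\<close> is the weight at the \<open>k\<close>-th edge.\<close>

locale rank_two_walk = cartan_datum A for A :: "'i::finite \<Rightarrow> 'i \<Rightarrow> int" +
  fixes c :: "'r::idom" and p :: "'i wt \<Rightarrow> 'r" and i j :: 'i and u :: "'i wg"
  assumes weight: "hecke_weight c p" and u: "u \<in> weyl A" and ij: "i \<noteq> j"
begin

abbreviation "m \<equiv> int (cox i j)"
abbreviation "rc \<equiv> root_coords (- A i j) (- A j i)"

definition lab :: "int \<Rightarrow> 'i" where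
  "lab k = (if even k then i else j)"

definition V :: "int \<Rightarrow> 'i wg" where
  "V k = elt (rev (alt i j (nat k))) \<circ> u"

definition q :: "int \<Rightarrow> 'r" where
  "q k = p (inv (V k) (\<alpha> (lab k)))"

lemma V_in_weyl [simp]: "V k \<in> W"
  using u by (simp add: V_def)

lemma V_step: assumes "0 \<le> k" shows "V (k + 1) = s (lab k) \<circ> V k"
proof -
  have "nat (k + 1) = Suc (nat k)" "even (nat k) = even k" using assms by (simp_all add: even_nat_iff)
  then show ?thesis
    unfolding V_def lab_def by (simp only: alt_snoc rev_append rev.simps append.simps word_elt_Cons comp_assoc)
qed

lemma inv_V: "inv (V k) = inv u \<circ> elt (alt i j (nat k))"
  unfolding V_def using inv_weyl_comp[OF word_elt_in_weyl u] by (simp only: inv_word_elt rev_rev_ident)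

lemma q_root_coords:
  assumes "0 \<le> k"
  shows "q k = p (inv u (rt i j (fst (rc (nat k)))
    (snd (rc (nat k)))))"
proof -
  have "lab k = (if even (nat k) then i else j)" using assms by (simp add: lab_def even_nat_iff)
  then show ?thesis unfolding q_def inv_V by (simp only: o_apply word_elt_alt_root)
qed

lemma q_root: "0 \<le> k \<Longrightarrow> rt i j (fst (rc (nat k)))
    (snd (rc (nat k))) \<in> \<Phi>"
  using word_elt_alt_root[of i j "nat k"] by (metis simple_root_in_roots weyl_root word_elt_in_weyl)

lemma uop_V:
  assumes "0 \<le> k"
  shows "uop c p (lab k) g (V k) = q k * g (V k) + (c - q k) * g (V (k + 1))"
    and "uop c p (lab k) g (V (k + 1)) = uop c p (lab k) g (V k)"
proof -
  show "uop c p (lab k) g (V k) = q k * g (V k) + (c - q k) * g (V (k + 1))"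
    unfolding V_step[OF assms] uop_def q_def by simp
  show "uop c p (lab k) g (V (k + 1)) = uop c p (lab k) g (V k)"
    unfolding V_step[OF assms] by (rule uop_edge[OF weight V_in_weyl])
qed

lemma q_period: assumes "0 \<le> k" shows "q (k + m) = c - q k"
proof -
  define n where "n = nat k"
  have n: "nat (k + m) = n + cox i j" "even k = even n" using assms by (simp_all add: n_def nat_add_distrib even_nat_iff)
  have "elt (alt (lab k) (if even n then j else i) (cox i j)) (\<alpha> (lab (k + m))) = - \<alpha> (lab k)"
    using alt_cox_root[OF ij] alt_cox_root[OF ij[symmetric]] cox_commute[of i j]
    by (auto simp: lab_def n(2))
  then have "inv (V (k + m)) (\<alpha> (lab (k + m))) = inv u (elt (alt i j n) (- \<alpha> (lab k)))"
    unfolding inv_V n alt_add word_elt_append by (auto simp: lab_def n(2))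
  also have "\<dots> = - inv (V k) (\<alpha> (lab k))"
    unfolding inv_V n_def[symmetric] using weyl_minus[OF weyl_inv[OF u]] by (simp add: weyl_minus[OF word_elt_in_weyl])
  finally show ?thesis unfolding q_def using hecke_weight_minus[OF weight] by simp
qed

lemma q_relation:
  assumes "0 \<le> k" "0 \<le> k'" "0 \<le> l"
    and "fst (rc (nat l))
      = fst (rc (nat k)) + fst (rc (nat k'))"
    and "snd (rc (nat l))
      = snd (rc (nat k)) + snd (rc (nat k'))"
  shows "q l * (q k + q k' - c) = q k * q k' - 1"
proof -
  define r where "r n = rt i j (fst (rc (nat n)))
    (snd (rc (nat n)))" for n
  have r: "r k \<in> \<Phi>" "r k' \<in> \<Phi>" "r l \<in> \<Phi>" using q_root assms(1-3) by (auto simp: r_def)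
  have q: "q n = p (inv u (r n))" if "0 \<le> n" for n unfolding r_def by (rule q_root_coords[OF that])
  have "r l = r k + r k'" by (simp only: r_def rt_add assms(4,5))
  then have "inv u (r l) = inv u (r k) + inv u (r k')" using weyl_add[OF weyl_inv[OF u]] by simp
  moreover have "inv u (r n) \<in> \<Phi>" if "r n \<in> \<Phi>" for n using that u by simp
  ultimately show ?thesis using weight r unfolding q[OF assms(1)] q[OF assms(2)] q[OF assms(3)] hecke_weight_def
    by metis
qed

text \<open>The alternating word of length 2m is one alternating word of length m followed by the
  reverse of the other. As both represent the same element, the product is trivial.\<close>

lemma V_period: "V (2 * m) = V 0"
proof -
  have alt2: "alt i j (2 * cox i j) = alt i j (cox i j) @ rev (alt j i (cox i j))"
    using alt_add[of i j "cox i j" "cox i j"] by (simp add: rev_alt mult_2)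
  have "elt (alt i j (2 * cox i j)) = id"
    unfolding alt2 word_elt_append inv_word_elt[symmetric] word_elt_alt_commute[OF ij, symmetric]
    by (rule weyl_inv_comp) simp
  then have "inv (V (2 * m)) = inv (V 0)" unfolding inv_V by (simp add: nat_mult_distrib)
  then show ?thesis by (metis V_in_weyl weyl_inv_inv)
qed

abbreviation "Ui \<equiv> uop c p i"
abbreviation "Uj \<equiv> uop c p j"

lemma uop_V_even: "0 \<le> k \<Longrightarrow> even k \<Longrightarrow> Ui g (V k) = q k * g (V k) + (c - q k) * g (V (k + 1))"
  and uop_V_odd: "0 \<le> k \<Longrightarrow> odd k \<Longrightarrow> Uj g (V k) = q k * g (V k) + (c - q k) * g (V (k + 1))"
  using uop_V(1)[of k g] by (simp_all add: lab_def)

lemma uop_uop_V_even: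
  assumes "1 \<le> k" "even k"
  shows "Ui (Uj g) (V k) = q k * Uj g (V (k - 1)) + (c - q k) * Uj g (V (k + 1))"
  using uop_V_even[of k] uop_V(2)[of "k - 1" g] assms by (simp add: lab_def)

lemma uop_uop_V_odd:
  assumes "1 \<le> k" "odd k"
  shows "Uj (Ui g) (V k) = q k * Ui g (V (k - 1)) + (c - q k) * Ui g (V (k + 1))"
  using uop_V_odd[of k] uop_V(2)[of "k - 1" g] assms by (simp add: lab_def)

lemmas walk_simps = uop_uop_V_even uop_uop_V_odd edge_op_def

lemma uop_braid_2:
  assumes "cox i j = 2"
  shows "Uj (Ui g) (V 2) = Ui (Uj g) (V 2)"
proof -
  have V4: "V 4 = V 0" using V_period assms by simp
  have q: "q 2 = c - q 0" "q 3 = c - q 1" using q_period[of 0] q_period[of 1] assms by simp_all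
  have V21: "Uj (Ui g) (V 2) = Uj (Ui g) (V 1)"
    using uop_V(2)[of 1 "Ui g"] by (simp add: lab_def)
  show ?thesis
    unfolding V21 by (simp add: walk_simps, simp add: uop_V_even uop_V_odd V4 q) algebra
qed

text \<open>Expanding the edge values of g and using q(k+m) = c - q(k), each side becomes the sum
  over all 2m vertices of g(V k) q(k) q(k+1) ... q(k+m-1). The same cancellation works for m = 4 and
  m = 6.\<close>

lemma uop_braid_3:
  assumes "A i j = -1" "A j i = -1"
  shows "Ui (Uj (Ui g)) (V 3) - Ui g (V 3)
    = Uj (Ui (Uj g)) (V 3) - Uj g (V 3)" (is "?X = ?Y")
proof -
  have m: "m = 3" using assms by (simp add: cox_def)
  have V6: "V 6 = V 0" using V_period m by simp
  have per: "\<forall>k\<ge>0. q (k + 3) = c - q k" using q_period m by simp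
  have rel: "q 1 * (q 0 + q 2 - c) = q 0 * q 2 - 1"
    by (rule q_relation; simp add: assms eval_nat_numeral)
  define Fi where "Fi = (\<lambda>k. Ui g (V k))"
  define Fj where "Fj = (\<lambda>k. Uj g (V k))"
  have V32: "Ui f (V 3) = Ui f (V 2)" for f
    using uop_V(2)[of 2 f] by (simp add: lab_def)
  have X: "?X = edge_op c q (edge_op c q Fi) 2 - Fi 2"
    unfolding V32 by (simp add: walk_simps Fi_def Fj_def)
  have Y: "?Y = edge_op c q (edge_op c q Fj) 3 - Fj 3"
    by (simp add: walk_simps Fi_def Fj_def)
  show ?thesis
    unfolding X Y unfolding edge_op_3[OF per rel, of Fi] edge_op_3[OF per rel, of Fj]
    unfolding Fi_def Fj_def
    by (simp add: uop_V_even uop_V_odd V6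
        per[rule_format, of 0, simplified] per[rule_format, of 1, simplified] per[rule_format, of 2, simplified] per[rule_format, of 3, simplified] per[rule_format, of 4, simplified]) algebra
qed

lemma uop_braid_4:
  assumes "A i j = -2" "A j i = -1"
  shows "Uj (Ui (Uj (Ui g))) (V 4) - 2 * Uj (Ui g) (V 4)
    = Ui (Uj (Ui (Uj g))) (V 4) - 2 * Ui (Uj g) (V 4)" (is "?X = ?Y")
proof -
  have m: "m = 4" using assms by (simp add: cox_def)
  have V8: "V 8 = V 0" using V_period m by simp
  have per: "\<forall>k\<ge>0. q (k + 4) = c - q k" using q_period m by simp
  have rel: "q 1 * (q 0 + q 2 - c) = q 0 * q 2 - 1" "q 2 * (q 0 + q 3 - c) = q 0 * q 3 - 1"
    by (rule q_relation; simp add: assms eval_nat_numeral)+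
  define Fi where "Fi = (\<lambda>k. Ui g (V k))"
  define Fj where "Fj = (\<lambda>k. Uj g (V k))"
  have V43: "Uj f (V 4) = Uj f (V 3)" for f
    using uop_V(2)[of 3 f] by (simp add: lab_def)
  have X: "?X = edge_op c q (edge_op c q (edge_op c q Fi)) 3
        - 2 * edge_op c q Fi 3"
    unfolding V43 by (simp add: walk_simps Fi_def Fj_def)
  have Y: "?Y = edge_op c q (edge_op c q (edge_op c q Fj)) 4
        - 2 * edge_op c q Fj 4"
    by (simp add: walk_simps Fi_def Fj_def)
  show ?thesis
    unfolding X Y unfolding edge_op_4[OF per rel, of Fi] edge_op_4[OF per rel, of Fj]
    unfolding Fi_def Fj_def
    by (simp add: uop_V_even uop_V_odd V8
        per[rule_format, of 0, simplified] per[rule_format, of 1, simplified] per[rule_format, of 2, simplified] per[rule_format, of 3, simplified] per[rule_format, of 4, simplified] per[rule_format, of 5, simplified] per[rule_format, of 6, simplified]) algebra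
qed

lemma uop_braid_6:
  assumes "A i j = -3" "A j i = -1"
  shows "Uj (Ui (Uj (Ui (Uj (Ui g))))) (V 6)
      - 4 * Uj (Ui (Uj (Ui g))) (V 6) + 3 * Uj (Ui g) (V 6)
    = Ui (Uj (Ui (Uj (Ui (Uj g))))) (V 6)
      - 4 * Ui (Uj (Ui (Uj g))) (V 6) + 3 * Ui (Uj g) (V 6)" (is "?X = ?Y")
proof -
  have m: "m = 6" using assms by (simp add: cox_def)
  have V12: "V 12 = V 0" using V_period m by simp
  have per: "\<forall>k\<ge>0. q (k + 6) = c - q k" using q_period m by simp
  have rel: "q 1 * (q 0 + q 2 - c) = q 0 * q 2 - 1" "q 2 * (q 0 + q 4 - c) = q 0 * q 4 - 1"
    "q 4 * (q 0 + q 5 - c) = q 0 * q 5 - 1" "q 3 * (q 2 + q 4 - c) = q 2 * q 4 - 1"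
    "q 3 * (q 1 + q 5 - c) = q 1 * q 5 - 1"
    by (rule q_relation; simp add: assms eval_nat_numeral)+
  define Fi where "Fi = (\<lambda>k. Ui g (V k))"
  define Fj where "Fj = (\<lambda>k. Uj g (V k))"
  have V65: "Uj f (V 6) = Uj f (V 5)" for f
    using uop_V(2)[of 5 f] by (simp add: lab_def)
  have X: "?X = edge_op c q (edge_op c q (edge_op c q (edge_op c q (edge_op c q Fi)))) 5
      - 4 * edge_op c q (edge_op c q (edge_op c q Fi)) 5
      + 3 * edge_op c q Fi 5"
    unfolding V65 by (simp add: walk_simps Fi_def Fj_def)
  have Y: "?Y = edge_op c q (edge_op c q (edge_op c q (edge_op c q (edge_op c q Fj)))) 6
      - 4 * edge_op c q (edge_op c q (edge_op c q Fj)) 6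
      + 3 * edge_op c q Fj 6"
    by (simp add: walk_simps Fi_def Fj_def)
  show ?thesis
    unfolding X Y unfolding edge_op_6[OF per rel, of Fi] edge_op_6[OF per rel, of Fj]
    unfolding Fi_def Fj_def
    by (simp add: uop_V_even uop_V_odd V12
        per[rule_format, of 0, simplified] per[rule_format, of 1, simplified] per[rule_format, of 2, simplified] per[rule_format, of 3, simplified] per[rule_format, of 4, simplified] per[rule_format, of 5, simplified] per[rule_format, of 6, simplified] per[rule_format, of 7, simplified] per[rule_format, of 8, simplified] per[rule_format, of 9, simplified] per[rule_format, of 10, simplified]) algebra
qed

end

context cartan_datum
begin

text \<open>Substituting \<open>dop\<close> = \<open>uop\<close> - t and using that
  \<open>uop\<close> squares to c times itself, the difference of the two braid words becomes the
  difference of the two sides of the Chebyshev identity; all lower terms cancel because t t' =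
  1.\<close>

lemma dop_braid_aux:
  assumes "hecke_weight c p" "c = t + t'" "t * t' = 1" and ij: "i \<noteq> j" and x: "x \<in> W"
    and A: "A i j = 0 \<and> A j i = 0 \<or> A i j = -1 \<and> A j i = -1 \<or> A i j = -2 \<and> A j i = -1 \<or> A i j = -3 \<and> A j i = -1"
  shows "foldr (dop t c p) (alt i j (cox i j)) g x = foldr (dop t c p) (alt j i (cox i j)) g x"
proof -
  \<comment> \<open>The base point is chosen so that x becomes the vertex \<open>V m\<close>,
    opposite \<open>V 0\<close>. All indices reached by the iterated edge operators then lie between
    0 and 2m.\<close>
  define u where "u = inv (elt (rev (alt i j (cox i j)))) \<circ> x"
  have u: "u \<in> W" using x by (simp add: u_def)
  interpret rank_two_walk A c p i j u
    by unfold_locales (use assms u in simp_all)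
  have Vm: "V m = x" unfolding V_def nat_int unfolding u_def by (rule weyl_inv_comp(4)[OF word_elt_in_weyl])
  define U where "U = uop c p"
  note expand = dop_uop[OF x, of t c p, folded U_def] uop_dop[of c p, folded U_def]
    uop_diff[of c p, folded U_def] uop_scale[of c p, folded U_def] uop_uop[OF assms(1), folded U_def]
  consider (2) "A i j = 0" "A j i = 0" | (3) "A i j = -1" "A j i = -1"
    | (4) "A i j = -2" "A j i = -1" | (6) "A i j = -3" "A j i = -1"
    using A by blast
  then show ?thesis
  proof cases
    case 2
    then have m: "cox i j = 2" by (simp add: cox_def)
    note E = uop_braid_2[OF m, of g, unfolded Vm[unfolded m of_nat_numeral], folded U_def]
    have "foldr (dop t c p) (alt i j 2) g x = foldr (dop t c p) (alt j i 2) g x"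
      apply (simp add: eval_nat_numeral expand)
      using E by (simp add: algebra_simps)
    then show ?thesis by (simp add: m)
  next
    case 3
    then have m: "cox i j = 3" by (simp add: cox_def)
    note E = uop_braid_3[OF 3, of g, unfolded Vm[unfolded m of_nat_numeral], folded U_def]
    have "foldr (dop t c p) (alt i j 3) g x = foldr (dop t c p) (alt j i 3) g x"
      apply (simp add: eval_nat_numeral expand)
      using E assms(2,3) by algebra
    then show ?thesis by (simp add: m)
  next
    case 4
    then have m: "cox i j = 4" by (simp add: cox_def)
    note E = uop_braid_4[OF 4, of g, unfolded Vm[unfolded m of_nat_numeral], folded U_def]
    have "foldr (dop t c p) (alt i j 4) g x = foldr (dop t c p) (alt j i 4) g x"
      apply (simp add: eval_nat_numeral expand)
      using E assms(2,3) by algebra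
    then show ?thesis by (simp add: m)
  next
    case 6
    then have m: "cox i j = 6" by (simp add: cox_def)
    note E = uop_braid_6[OF 6, of g, unfolded Vm[unfolded m of_nat_numeral], folded U_def]
    have "foldr (dop t c p) (alt i j 6) g x = foldr (dop t c p) (alt j i 6) g x"
      apply (simp add: eval_nat_numeral expand)
      using E assms(2,3) by algebra
    then show ?thesis by (simp add: m)
  qed
qed

theorem dop_braid:
  assumes "hecke_weight c p" "c = t + t'" "t * t' = 1" and ij: "i \<noteq> j"
  shows "foldr (dop t c p) (alt i j (cox i j)) g = foldr (dop t c p) (alt j i (cox i j)) g"
proof
  fix x
  obtain n where n: "cox i j = Suc n" by (metis cox_def numeral_eq_Suc)
  show "foldr (dop t c p) (alt i j (cox i j)) g x = foldr (dop t c p) (alt j i (cox i j)) g x"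
  proof (cases "x \<in> W")
    case True
    show ?thesis
      using dop_braid_aux[OF assms True, of g] dop_braid_aux[OF assms(1-3) ij[symmetric] True, of g]
      by (rule_tac cartan_pair_cases[OF ij]) (simp_all add: cox_commute[of j i])
  next
    case False
    then have "dop t c p k f x = 0" for k f by (simp add: dop_def)
    then show ?thesis by (simp add: n)
  qed
qed

theorem dop_reduced_word:
  assumes "hecke_weight c p" "c = t + t'" "t * t' = 1"
    and "reduced us" "reduced vs" "elt us = elt vs"
  shows "foldr (dop t c p) us g = foldr (dop t c p) vs g"
  by (rule matsumoto[OF dop_braid[OF assms(1-3)] assms(4-6)])

end

section \<open>Laurent polynomials\<close>

type_synonym laurent = "(int, int) poly_mapping"

abbreviation lookup where "lookup \<equiv> Poly_Mapping.lookup"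
abbreviation keys where "keys \<equiv> Poly_Mapping.keys"

text \<open>\<phi> n plays the role of the n-th power of the variable. One definition covers the bar
  involution and the specializations at t and at 1/t; it is multiplicative as soon as \<phi>
  is.\<close>

definition evl :: "(int \<Rightarrow> 'r::comm_ring_1) \<Rightarrow> laurent \<Rightarrow> 'r" where
  "evl \<phi> p = (\<Sum>n\<in>keys p. of_int (lookup p n) * \<phi> n)"

lemma evl_superset: "finite S \<Longrightarrow> keys p \<subseteq> S \<Longrightarrow> evl \<phi> p = (\<Sum>n\<in>S. of_int (lookup p n) * \<phi> n)"
  unfolding evl_def by (rule sum.mono_neutral_left) (auto simp: in_keys_iff)

lemma evl_add: "evl \<phi> (p + q) = evl \<phi> p + evl \<phi> q"
proof -
  let ?S = "keys p \<union> keys q"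
  have "keys (p + q) \<subseteq> ?S" by (rule keys_add)
  then show ?thesis
    by (simp add: evl_superset[of ?S] lookup_add algebra_simps sum.distrib)
qed

lemma evl_zero [simp]: "evl \<phi> 0 = 0"
  by (simp add: evl_def)

lemma evl_single [simp]: "evl \<phi> (Poly_Mapping.single n a) = of_int a * \<phi> n"
  by (simp add: evl_def)

lemma evl_sum: "evl \<phi> (\<Sum>x\<in>X. f x) = (\<Sum>x\<in>X. evl \<phi> (f x))"
  by (induction X rule: infinite_finite_induct) (simp_all add: evl_add)

lemma evl_minus: "evl \<phi> (- p) = - evl \<phi> p"
  using evl_add[of \<phi> p "- p"] by (simp add: eq_neg_iff_add_eq_0 add.commute)

lemma evl_diff: "evl \<phi> (p - q) = evl \<phi> p - evl \<phi> q"
  using evl_add[of \<phi> p "- q"] evl_minus[of \<phi> q] by simp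

lemma laurent_expand: "(\<Sum>n\<in>keys p. Poly_Mapping.single n (lookup p n)) = p"
  by (rule poly_mapping_eqI)
    (simp add: lookup_sum lookup_single when_def, simp add: in_keys_iff)

lemma evl_mult:
  assumes "\<And>a b. \<phi> (a + b) = \<phi> a * \<phi> b"
  shows "evl \<phi> (p * q) = evl \<phi> p * evl \<phi> q"
proof -
  have "p * q = (\<Sum>a\<in>keys p. \<Sum>b\<in>keys q. Poly_Mapping.single (a + b) (lookup p a * lookup q b))"
    using laurent_expand[of p] laurent_expand[of q] sum_product[of "\<lambda>n. Poly_Mapping.single n (lookup p n)"
        "keys p" "\<lambda>n. Poly_Mapping.single n (lookup q n)" "keys q"] by (simp add: mult_single)
  then have "evl \<phi> (p * q) = (\<Sum>a\<in>keys p. \<Sum>b\<in>keys q. of_int (lookup p a * lookup q b) * \<phi> (a + b))"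
    by (simp only: evl_sum evl_single)
  also have "\<dots> = evl \<phi> p * evl \<phi> q"
    by (simp add: evl_def assms sum_product algebra_simps)
  finally show ?thesis .
qed

definition tp :: "int \<Rightarrow> laurent" where
  "tp n = Poly_Mapping.single n 1"

lemma tp_mult: "tp a * tp b = tp (a + b)"
  by (simp add: tp_def mult_single)

lemma tp_0 [simp]: "tp 0 = 1"
  by (simp add: tp_def)

lemma tp_cancel [simp]: "tp a * (tp (- a) * p) = p" "tp (- a) * (tp a * p) = p"
  by (simp_all add: mult.assoc[symmetric] tp_mult)

lemma lookup_of_int_mult: "lookup (of_int a * p) n = a * lookup p n" for p :: laurent
proof -
  have "of_int a * p = (\<Sum>m\<in>keys p. Poly_Mapping.single m (a * lookup p m))"
    by (subst (1) laurent_expand[symmetric])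
      (simp add: sum_distrib_left mult_single flip: single_of_int)
  then show ?thesis
    by (simp add: lookup_sum lookup_single when_def sum.delta' in_keys_iff)
qed

lemma lookup_tp_mult: "lookup (tp k * p) n = lookup p (n - k)"
proof -
  have "tp k * p = (\<Sum>m\<in>keys p. Poly_Mapping.single (k + m) (lookup p m))"
    by (subst (1) laurent_expand[symmetric]) (simp add: tp_def sum_distrib_left mult_single)
  then have "lookup (tp k * p) n = (\<Sum>m\<in>keys p. if m = n - k then lookup p m else 0)"
    by (simp add: lookup_sum lookup_single when_def algebra_simps eq_diff_eq)
  then show ?thesis by (simp add: sum.delta in_keys_iff)
qed

definition lbar :: "laurent \<Rightarrow> laurent" where
  "lbar = evl (\<lambda>n. tp (- n))"

lemma lbar_add: "lbar (p + q) = lbar p + lbar q"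
  and lbar_diff: "lbar (p - q) = lbar p - lbar q"
  and lbar_sum: "lbar (\<Sum>x\<in>X. f x) = (\<Sum>x\<in>X. lbar (f x))"
  and lbar_0 [simp]: "lbar 0 = 0"
  by (simp_all add: lbar_def evl_add evl_diff evl_minus evl_sum)

lemma lbar_mult: "lbar (p * q) = lbar p * lbar q"
  unfolding lbar_def by (rule evl_mult) (simp add: tp_mult)

lemma lbar_tp [simp]: "lbar (tp n) = tp (- n)"
  by (simp add: lbar_def tp_def)

lemma lbar_1 [simp]: "lbar 1 = 1"
  using lbar_tp[of 0] by simp

lemma lbar_of_int [simp]: "lbar (of_int a) = of_int a"
proof -
  have "Poly_Mapping.single 0 a = (of_int a :: laurent)" by (metis single_of_int of_int_eq_id id_apply)
  then show ?thesis using evl_single[of "\<lambda>n. tp (- n)" 0 a] by (simp add: lbar_def)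
qed

lemma lookup_lbar: "lookup (lbar p) n = lookup p (- n)"
proof -
  have "lookup (lbar p) n = (\<Sum>m\<in>keys p. lookup p m * lookup (tp (- m)) n)"
    by (simp add: lbar_def evl_def lookup_sum lookup_of_int_mult)
  also have "\<dots> = (\<Sum>m\<in>keys p. if m = - n then lookup p m else 0)"
    by (rule sum.cong) (auto simp: tp_def lookup_single when_def)
  finally show ?thesis by (simp add: sum.delta in_keys_iff)
qed

lemma lbar_lbar [simp]: "lbar (lbar p) = p"
  by (rule poly_mapping_eqI) (simp add: lookup_lbar)

text \<open>Membership in tZ[t], the lattice in which the off-diagonal Kazhdan--Lusztig coefficients
  lie. It meets the bar invariant Laurent polynomials only in 0.\<close>

definition lpos :: "laurent \<Rightarrow> bool" where
  "lpos p \<longleftrightarrow> (\<forall>n\<le>0. lookup p n = 0)"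

lemma lpos_0 [simp]: "lpos 0"
  and lpos_add: "lpos p \<Longrightarrow> lpos q \<Longrightarrow> lpos (p + q)"
  and lpos_diff: "lpos p \<Longrightarrow> lpos q \<Longrightarrow> lpos (p - q)"
  and lpos_of_int_mult: "lpos p \<Longrightarrow> lpos (of_int a * p)"
  by (simp_all add: lpos_def lookup_add lookup_minus lookup_of_int_mult)

lemma lpos_sum: "(\<And>x. x \<in> X \<Longrightarrow> lpos (f x)) \<Longrightarrow> lpos (\<Sum>x\<in>X. f x)"
  by (simp add: lpos_def lookup_sum)

lemma lpos_tp_mult: "lpos p \<Longrightarrow> 0 \<le> k \<Longrightarrow> lpos (tp k * p)"
  by (simp add: lpos_def lookup_tp_mult)

lemma lpos_mult:
  assumes "lpos p" "lpos q" shows "lpos (p * q)"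
proof -
  have "0 < n" if n: "n \<in> keys (p * q)" for n
  proof -
    obtain a b where "n = a + b" "a \<in> keys p" "b \<in> keys q" using subsetD[OF keys_mult n] by blast
    moreover have "0 < a" "0 < b"
      using calculation(2,3) assms by (auto simp: lpos_def in_keys_iff not_le[symmetric])
    ultimately show ?thesis by simp
  qed
  then show ?thesis unfolding lpos_def by (metis in_keys_iff not_le)
qed

lemma lpos_lbar_eq: "lpos p \<Longrightarrow> lbar p = p \<Longrightarrow> p = 0"
  by (rule poly_mapping_eqI) (metis lookup_lbar lookup_zero lpos_def linear neg_0_le_iff_le)

section \<open>The generic Hecke algebra in its regular representation\<close>

context cartan_datum
begin

text \<open>A function f stands for the sum of the f(x) T_x in the Hecke algebra with T_i^2 = z T_i
  + 1. This is left multiplication by T_i, read on coefficients; \<open>linv\<close> is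
  multiplication by the inverse T_i - z.\<close>

definition lop :: "'r::comm_ring_1 \<Rightarrow> 'i \<Rightarrow> ('i wg \<Rightarrow> 'r) \<Rightarrow> 'i wg \<Rightarrow> 'r" where
  "lop z i f = (\<lambda>x. if x \<in> W then f (s i \<circ> x) + (if desc i x then z * f x else 0) else 0)"

definition linv :: "'r::comm_ring_1 \<Rightarrow> 'i \<Rightarrow> ('i wg \<Rightarrow> 'r) \<Rightarrow> 'i wg \<Rightarrow> 'r" where
  "linv z i f = (\<lambda>x. if x \<in> W then f (s i \<circ> x) - (if desc i x then 0 else z * f x) else 0)"

definition supp :: "('i wg \<Rightarrow> 'r::zero) \<Rightarrow> bool" where
  "supp f \<longleftrightarrow> (\<forall>x. x \<notin> W \<longrightarrow> f x = 0)"

definition unit_e :: "'i wg \<Rightarrow> 'r::zero_neq_one" where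
  "unit_e = (\<lambda>x. if x = id then 1 else 0)"

lemma unit_e_id: "unit_e id = 1" and unit_e_nz: "unit_e x \<noteq> 0 \<Longrightarrow> x = id"
  by (auto simp: unit_e_def split: if_splits)

lemma supp_lop [simp]: "supp (lop z i f)"
  and supp_linv [simp]: "supp (linv z i f)"
  and supp_unit_e [simp]: "supp unit_e"
  by (auto simp: supp_def lop_def linv_def unit_e_def)

lemma linv_nz:
  assumes "linv z i f y \<noteq> 0" shows "y \<in> W" "f (s i \<circ> y) \<noteq> 0 \<or> f y \<noteq> 0"
proof -
  show y: "y \<in> W" using assms supp_linv[of z i f] unfolding supp_def by blast
  have "linv z i f y = 0" if "f (s i \<circ> y) = 0" "f y = 0" unfolding linv_def that by simp
  then show "f (s i \<circ> y) \<noteq> 0 \<or> f y \<noteq> 0" using assms by blast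
qed

lemma len_sref_iff: "x \<in> W \<Longrightarrow> desc i x \<longleftrightarrow> \<not> len x < len (s i \<circ> x)"
  using len_sref_neq[of x i] by linarith

lemma linv_lop_diff: "supp f \<Longrightarrow> linv z i f = (\<lambda>x. lop z i f x - z * f x)"
  by (auto simp: linv_def lop_def supp_def fun_eq_iff)

lemma lop_lop: "supp f \<Longrightarrow> lop z i (lop z i f) = (\<lambda>x. z * lop z i f x + f x)"
proof
  fix x assume f: "supp f"
  show "lop z i (lop z i f) x = z * lop z i f x + f x"
    using f len_sref_iff[of x i] by (cases "x \<in> W") (simp_all add: lop_def supp_def algebra_simps)
qed

lemma lop_sum: "lop z i (\<lambda>y. \<Sum>x\<in>X. a x * g x y) = (\<lambda>y. \<Sum>x\<in>X. a x * lop z i (g x) y)"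
proof
  fix x
  show "lop z i (\<lambda>y. \<Sum>x\<in>X. a x * g x y) x = (\<Sum>k\<in>X. a k * lop z i (g k) x)"
    by (cases "x \<in> W"; cases "desc i x")
      (simp_all add: lop_def sum_distrib_left sum.distrib algebra_simps)
qed

lemma linv_sum: "linv z i (\<lambda>y. \<Sum>x\<in>X. a x * g x y) = (\<lambda>y. \<Sum>x\<in>X. a x * linv z i (g x) y)"
proof
  fix x
  show "linv z i (\<lambda>y. \<Sum>x\<in>X. a x * g x y) x = (\<Sum>k\<in>X. a k * linv z i (g k) x)"
    by (cases "x \<in> W"; cases "desc i x")
      (simp_all add: linv_def sum_distrib_left sum_subtractf algebra_simps)
qed

lemma linv_scale: "linv z i (\<lambda>y. a * g y) = (\<lambda>y. a * linv z i g y)"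
  by (auto simp: linv_def fun_eq_iff algebra_simps)

definition tt :: laurent where "tt = tp 1"
definition ti :: laurent where "ti = tp (- 1)"
definition zz :: laurent where "zz = ti - tt"

lemma tt_ti [simp]: "tt * ti = 1" "ti * tt = 1"
  by (simp_all add: tt_def ti_def tp_mult)

lemma lbar_zz [simp]: "lbar zz = - zz"
  and lbar_tt [simp]: "lbar tt = ti" and lbar_ti [simp]: "lbar ti = tt"
  by (simp_all add: zz_def tt_def ti_def lbar_diff)

text \<open>The limit of (1/t - t e^(-\<beta>)) / (1 - e^(-\<beta>)) when e^(-\<beta>) tends to
  infinity for positive \<beta>, hence to 0 for negative \<beta>.\<close>

definition limit_weight :: "'i wt \<Rightarrow> laurent" where
  "limit_weight \<beta> = (if \<beta> \<in> \<Phi>pos then tt else ti)"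

lemma pos_roots_add: "\<beta> \<in> \<Phi>pos \<Longrightarrow> \<gamma> \<in> \<Phi>pos \<Longrightarrow> \<beta> + \<gamma> \<in> \<Phi> \<Longrightarrow> \<beta> + \<gamma> \<in> \<Phi>pos"
proof -
  assume "\<beta> \<in> \<Phi>pos" "\<gamma> \<in> \<Phi>pos" "\<beta> + \<gamma> \<in> \<Phi>"
  then obtain c d where "\<And>j. 0 \<le> c j" "\<beta> = comb c" "\<And>j. 0 \<le> d j" "\<gamma> = comb d" "\<beta> + \<gamma> \<in> \<Phi>"
    by (auto simp: pos_roots_iff)
  then show ?thesis by (intro pos_rootsI[of _ "c + d"]) (simp_all add: comb_add)
qed

lemma hecke_weight_limit: "hecke_weight (tt + ti) limit_weight"
  unfolding hecke_weight_def
proof (intro conjI ballI impI)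
  fix \<beta> assume b: "\<beta> \<in> \<Phi>"
  then show "limit_weight (- \<beta>) = tt + ti - limit_weight \<beta>"
    using minus_pos_iff[of \<beta>] by (simp add: limit_weight_def)
  fix \<gamma> assume g: "\<gamma> \<in> \<Phi>" and bg: "\<beta> + \<gamma> \<in> \<Phi>"
  have "\<beta> + \<gamma> \<in> \<Phi>pos" if "\<beta> \<in> \<Phi>pos" "\<gamma> \<in> \<Phi>pos" using pos_roots_add that bg by blast
  moreover have "\<beta> + \<gamma> \<notin> \<Phi>pos" if "\<beta> \<notin> \<Phi>pos" "\<gamma> \<notin> \<Phi>pos"
  proof -
    have "- \<beta> + - \<gamma> = - (\<beta> + \<gamma>)" by simp
    then have "- (\<beta> + \<gamma>) \<in> \<Phi>pos"
      using pos_roots_add[of "- \<beta>" "- \<gamma>"] that minus_pos_iff[OF b] minus_pos_iff[OF g] bg minus_root_iff by metis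
    then show ?thesis using minus_pos_iff[OF bg] by blast
  qed
  ultimately show "limit_weight (\<beta> + \<gamma>) * (limit_weight \<beta> + limit_weight \<gamma> - (tt + ti))
      = limit_weight \<beta> * limit_weight \<gamma> - 1"
    by (auto simp: limit_weight_def algebra_simps)
qed

abbreviation gauge :: "('i wg \<Rightarrow> laurent) \<Rightarrow> 'i wg \<Rightarrow> laurent" where
  "gauge h \<equiv> \<lambda>x. tp (- int (len x)) * h x"

text \<open>\<open>lop\<close> and \<open>linv\<close> are degenerate Demazure--Lusztig operators, up to rescaling at \<open>x\<close> by \<open>tp (len x)\<close>.\<close>

lemma lop_gauge: "lop zz i (gauge h) = gauge (dop tt (tt + ti) limit_weight i h)"
  and linv_gauge: "linv zz i (gauge h) = gauge (dop ti (tt + ti) limit_weight i h)"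
proof -
  have "lop zz i (gauge h) x = tp (- int (len x)) * dop tt (tt + ti) limit_weight i h x
    \<and> linv zz i (gauge h) x = tp (- int (len x)) * dop ti (tt + ti) limit_weight i h x" for x
  proof (cases "x \<in> W")
    case x: True
    show ?thesis
    proof (cases "desc i x")
      case True
      then have "inv x (\<alpha> i) \<notin> \<Phi>pos" using descent_iff[OF x] by blast
      moreover have "tp (- int (len (s i \<circ> x))) = tp (- int (len x)) * tt"
        using len_descent[OF x True] by (simp add: tt_def tp_mult)
      ultimately show ?thesis using x True
        by (simp add: lop_def linv_def dop_def limit_weight_def zz_def algebra_simps)
    next
      case False
      then have "inv x (\<alpha> i) \<in> \<Phi>pos" using descent_iff[OF x] by blast
      moreover have "tp (- int (len (s i \<circ> x))) = tp (- int (len x)) * ti"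
        using len_ascent[OF x False] by (simp add: ti_def tp_mult algebra_simps)
      ultimately show ?thesis using x False
        by (simp add: lop_def linv_def dop_def limit_weight_def zz_def algebra_simps)
    qed
  qed (simp add: lop_def linv_def dop_def)
  then show "lop zz i (gauge h) = gauge (dop tt (tt + ti) limit_weight i h)"
    and "linv zz i (gauge h) = gauge (dop ti (tt + ti) limit_weight i h)"
    by auto
qed

lemma gauge_foldr:
  assumes "\<And>i h. E i (gauge h) = gauge (F i h)"
  shows "foldr E ws f = gauge (foldr F ws (\<lambda>x. tp (int (len x)) * f x))"
  by (induction ws) (simp_all add: assms)

text \<open>One weight serves both families since c = t + 1/t is symmetric: \<open>linv\<close> is
  the case in which t and 1/t change places.\<close>

lemma
  assumes "reduced us" "reduced vs" "elt us = elt vs"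
  shows lop_reduced_word: "foldr (lop zz) us f = foldr (lop zz) vs f"
    and linv_reduced_word: "foldr (linv zz) us f = foldr (linv zz) vs f"
  using dop_reduced_word[OF hecke_weight_limit refl tt_ti(1) assms]
    dop_reduced_word[OF hecke_weight_limit add.commute tt_ti(2) assms]
  by (simp_all only: gauge_foldr[of "lop zz" "dop tt (tt + ti) limit_weight", OF lop_gauge]
      gauge_foldr[of "linv zz" "dop ti (tt + ti) limit_weight", OF linv_gauge])

definition Lw :: "'i wg \<Rightarrow> ('i wg \<Rightarrow> laurent) \<Rightarrow> 'i wg \<Rightarrow> laurent" where
  "Lw x = foldr (lop zz) (red_word A x)"

definition Liw :: "'i wg \<Rightarrow> ('i wg \<Rightarrow> laurent) \<Rightarrow> 'i wg \<Rightarrow> laurent" where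
  "Liw x = foldr (linv zz) (red_word A x)"

lemma Lw_ascent: "x \<in> W \<Longrightarrow> \<not> desc i x \<Longrightarrow> Lw (s i \<circ> x) f = lop zz i (Lw x f)"
  unfolding Lw_def by (rule foldr_red_word_ascent[OF lop_reduced_word])

lemma Liw_ascent: "x \<in> W \<Longrightarrow> \<not> desc i x \<Longrightarrow> Liw (s i \<circ> x) f = linv zz i (Liw x f)"
  unfolding Liw_def by (rule foldr_red_word_ascent[OF linv_reduced_word])

lemma Lw_id [simp]: "Lw id f = f" and Liw_id [simp]: "Liw id f = f"
  by (simp_all add: Lw_def Liw_def)

lemma supp_Lw: "supp f \<Longrightarrow> supp (Lw x f)"
  unfolding Lw_def by (cases "red_word A x") simp_all

lemma supp_Liw: "supp f \<Longrightarrow> supp (Liw x f)"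
  unfolding Liw_def by (cases "red_word A x") simp_all

lemma lop_Lw:
  assumes x: "x \<in> W" and f: "supp f"
  shows "lop zz i (Lw x f) = (\<lambda>y. Lw (s i \<circ> x) f y + (if desc i x then zz * Lw x f y else 0))"
proof (cases "desc i x")
  case True
  have sx: "s i \<circ> x \<in> W" using x by simp
  have "Lw (s i \<circ> (s i \<circ> x)) f = lop zz i (Lw (s i \<circ> x) f)"
    by (rule Lw_ascent[OF sx]) (unfold sref_o_sref_o, use True in simp)
  then have "Lw x f = lop zz i (Lw (s i \<circ> x) f)" by (simp only: sref_o_sref_o)
  then have "lop zz i (Lw x f) = (\<lambda>y. zz * Lw x f y + Lw (s i \<circ> x) f y)"
    using lop_lop[OF supp_Lw[OF f], of zz i "s i \<circ> x"] by metis
  then show ?thesis using True by (simp add: add.commute)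
qed (use Lw_ascent[OF x] in simp)

lemma linv_linv: "supp f \<Longrightarrow> linv z i (linv z i f) = (\<lambda>x. f x - z * linv z i f x)"
proof
  fix x assume f: "supp f"
  show "linv z i (linv z i f) x = f x - z * linv z i f x"
    using f len_sref_iff[of x i] by (cases "x \<in> W") (simp_all add: linv_def supp_def algebra_simps)
qed

lemma linv_Liw:
  assumes x: "x \<in> W" and f: "supp f"
  shows "linv zz i (Liw x f) = (\<lambda>y. Liw (s i \<circ> x) f y - (if desc i x then zz * Liw x f y else 0))"
proof (cases "desc i x")
  case True
  have sx: "s i \<circ> x \<in> W" using x by simp
  have "Liw (s i \<circ> (s i \<circ> x)) f = linv zz i (Liw (s i \<circ> x) f)"
    by (rule Liw_ascent[OF sx]) (unfold sref_o_sref_o, use True in simp)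
  then have "Liw x f = linv zz i (Liw (s i \<circ> x) f)" by (simp only: sref_o_sref_o)
  then have "linv zz i (Liw x f) = (\<lambda>y. Liw (s i \<circ> x) f y - zz * Liw x f y)"
    using linv_linv[OF supp_Liw[OF f], of zz i "s i \<circ> x"] by metis
  then show ?thesis using True by simp
qed (use Liw_ascent[OF x] in simp)

subsection \<open>The bar involution\<close>

text \<open>The semilinear bar involution, sending T_x to the inverse of T_(x^-1): multiplying the
  inverses T_i^-1 along a reduced word of x gives exactly this element.\<close>

definition barM :: "('i wg \<Rightarrow> laurent) \<Rightarrow> 'i wg \<Rightarrow> laurent" where
  "barM f = (\<lambda>y. \<Sum>x\<in>W. lbar (f x) * Liw x unit_e y)"

lemma supp_barM [simp]: "supp (barM f)"
  using supp_Liw[OF supp_unit_e] by (auto simp: supp_def barM_def)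

lemma sum_weyl_sref: "(\<Sum>x\<in>W. f (s i \<circ> x)) = (\<Sum>x\<in>W. f x)"
  by (rule sum_weyl_left) simp

text \<open>Reindexing by \<open>s i\<close> transposes the operator. When H is a family indexed by
  the group on which T_i acts by the Hecke rule, the bracket on the right is T_i applied to that
  family; this makes \<open>barM\<close>, \<open>hprod\<close> and \<open>hecke_map\<close>
  compatible with the generators.\<close>

lemma lop_adjoint:
  "(\<Sum>x\<in>W. lop z i f x * H x)
    = (\<Sum>x\<in>W. f x * (H (s i \<circ> x) + (if desc i x then z * H x else 0)))"
proof -
  have "(\<Sum>x\<in>W. lop z i f x * H x) = (\<Sum>x\<in>W. f (s i \<circ> x) * H (s i \<circ> (s i \<circ> x)))
      + (\<Sum>x\<in>W. (if desc i x then z * f x * H x else 0))"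
    unfolding sum.distrib[symmetric] sref_o_sref_o
    by (rule sum.cong[OF refl]) (simp add: lop_def algebra_simps)
  also have "(\<Sum>x\<in>W. f (s i \<circ> x) * H (s i \<circ> (s i \<circ> x))) = (\<Sum>x\<in>W. f x * H (s i \<circ> x))"
    by (rule sum_weyl_sref[of "\<lambda>x. f x * H (s i \<circ> x)"])
  finally show ?thesis
    unfolding sum.distrib[symmetric] by (simp add: algebra_simps if_distrib cong: if_cong)
qed

lemma lbar_lop: "lbar (lop zz i f x) = lop (- zz) i (\<lambda>x. lbar (f x)) x"
  by (simp add: lop_def lbar_add lbar_mult)

lemma barM_lop: "barM (lop zz i f) = linv zz i (barM f)"
proof
  fix y
  have "barM (lop zz i f) y = (\<Sum>x\<in>W. lbar (f x) * linv zz i (Liw x unit_e) y)"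
    unfolding barM_def lbar_lop lop_adjoint by (rule sum.cong[OF refl]) (simp add: linv_Liw)
  then show "barM (lop zz i f) y = linv zz i (barM f) y" unfolding barM_def by (simp add: linv_sum)
qed

lemma barM_unit_e [simp]: "barM unit_e = unit_e"
proof
  fix y
  have "barM unit_e y = (\<Sum>x\<in>W. if x = id then Liw x unit_e y else 0)"
    unfolding barM_def by (rule sum.cong) (auto simp: unit_e_def)
  then show "barM unit_e y = unit_e y" by (simp add: sum.delta)
qed

lemma barM_add: "barM (\<lambda>x. f x + g x) = (\<lambda>x. barM f x + barM g x)"
  and barM_diff: "barM (\<lambda>x. f x - g x) = (\<lambda>x. barM f x - barM g x)"
  and barM_scale: "barM (\<lambda>x. a * f x) = (\<lambda>x. lbar a * barM f x)"
  by (simp_all add: barM_def lbar_add lbar_diff lbar_mult algebra_simps sum.distrib sum_subtractf sum_distrib_left)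

lemma barM_sum: "barM (\<lambda>x. \<Sum>k\<in>K. a k * g k x) = (\<lambda>x. \<Sum>k\<in>K. lbar (a k) * barM (g k) x)"
proof
  fix y
  have "barM (\<lambda>x. \<Sum>k\<in>K. a k * g k x) y = (\<Sum>x\<in>W. \<Sum>k\<in>K. lbar (a k) * (lbar (g k x) * Liw x unit_e y))"
    by (simp add: barM_def lbar_sum lbar_mult sum_distrib_right mult.assoc)
  also have "\<dots> = (\<Sum>k\<in>K. \<Sum>x\<in>W. lbar (a k) * (lbar (g k x) * Liw x unit_e y))" by (rule sum.swap)
  finally show "barM (\<lambda>x. \<Sum>k\<in>K. a k * g k x) y = (\<Sum>k\<in>K. lbar (a k) * barM (g k) y)"
    by (simp add: barM_def sum_distrib_left)
qed

lemma Liw_triangular: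
  assumes "x \<in> W" "Liw x unit_e y \<noteq> 0" shows "y = x \<or> len y < len x"
proof (rule length_triangular[of x "\<lambda>x. Liw x unit_e"])
  fix i x u assume x: "x \<in> W" "\<not> desc i x" and "Liw (s i \<circ> x) unit_e u \<noteq> 0"
  then have "linv zz i (Liw x unit_e) u \<noteq> 0" using Liw_ascent[OF x] by metis
  from linv_nz(2)[OF this] show "Liw x unit_e u \<noteq> 0 \<or> Liw x unit_e (s i \<circ> u) \<noteq> 0" by blast
next
  show "u \<in> W" if "Liw x unit_e u \<noteq> 0" for x u using that supp_Liw[OF supp_unit_e] unfolding supp_def by blast
  show "u = id" if "Liw id unit_e u \<noteq> 0" for u using that unit_e_nz unfolding Liw_id by blast
qed (use assms in blast)+

lemma Liw_diag: assumes "x \<in> W" shows "Liw x unit_e x = 1"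
  using assms
proof (induction rule: reduced_induct)
  case id
  show ?case unfolding Liw_id by (rule unit_e_id)
next
  case (sref i x)
  have "linv zz i (Liw x unit_e) (s i \<circ> x) = 1"
    using sref len_ascent[OF sref(1,2)] Liw_triangular[OF sref(1), of "s i \<circ> x"]
    unfolding linv_def sref_o_sref_o by simp
  then show ?case unfolding Liw_ascent[OF sref(1,2)] .
qed

lemma barM_top:
  assumes "y \<in> W" "\<And>x. x \<in> W \<Longrightarrow> len y < len x \<Longrightarrow> f x = 0"
  shows "barM f y = lbar (f y)"
proof -
  have "barM f y = (\<Sum>x\<in>W. if x = y then lbar (f x) * Liw x unit_e y else 0)"
    unfolding barM_def
  proof (rule sum.cong[OF refl])
    fix x assume x: "x \<in> W"
    show "lbar (f x) * Liw x unit_e y = (if x = y then lbar (f x) * Liw x unit_e y else 0)"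
      using assms(2)[OF x] Liw_triangular[OF x, of y]
      by (cases "f x = 0"; cases "Liw x unit_e y = 0") auto
  qed
  then show ?thesis using assms(1) Liw_diag[OF assms(1)] by (simp add: sum.delta)
qed

text \<open>At an element of maximal length in the support, unitriangularity reduces
  \<open>barM\<close> to \<open>lbar\<close>, so the value there is a bar invariant member of
  tZ[t].\<close>

lemma bar_invariant_lpos_zero:
  assumes f: "supp f" "barM f = f" and pos: "\<And>x. lpos (f x)"
  shows "f = (\<lambda>x. 0)"
proof (rule ccontr)
  assume "f \<noteq> (\<lambda>x. 0)"
  then obtain x0 where x0: "f x0 \<noteq> 0" by auto
  define S where "S = {x \<in> W. f x \<noteq> 0}"
  have S: "finite S" "S \<noteq> {}" using x0 f by (auto simp: S_def supp_def)
  obtain y where y: "y \<in> S" "\<And>x. x \<in> S \<Longrightarrow> len x \<le> len y"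
  proof -
    have "Max (len ` S) \<in> len ` S" using S by (intro Max_in) auto
    then obtain y where "y \<in> S" "len y = Max (len ` S)" by (metis imageE)
    then show thesis using that[of y] S(1) by simp
  qed
  have "barM f y = lbar (f y)"
    by (rule barM_top) (use y in \<open>auto simp: S_def not_le[symmetric]\<close>)
  then have "f y = 0" using f pos[of y] lpos_lbar_eq by metis
  then show False using y by (simp add: S_def)
qed

subsection \<open>Sign twist and product\<close>

definition lsgn :: "'i wg \<Rightarrow> laurent" where
  "lsgn x = of_int ((- 1) ^ len x)"

text \<open>The semilinear ring automorphism T_i -> -T_i, t -> 1/t, which respects the quadratic
  relation because z changes sign as well. It commutes with the bar involution and takes the
  Kazhdan--Lusztig basis to its dual variant up to sign.\<close>

definition twist :: "('i wg \<Rightarrow> laurent) \<Rightarrow> 'i wg \<Rightarrow> laurent" where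
  "twist f = (\<lambda>x. lsgn x * lbar (f x))"

lemma lsgn_sref: "x \<in> W \<Longrightarrow> lsgn (s i \<circ> x) = - lsgn x"
  using len_ascent[of x i] len_descent[of x i] by (cases "desc i x") (simp_all add: lsgn_def)

lemma lsgn_square: "lsgn x * lsgn x = 1"
  unfolding lsgn_def of_int_mult[symmetric] power_mult_distrib[symmetric] by simp

lemma lbar_lsgn [simp]: "lbar (lsgn x) = lsgn x"
  by (simp only: lsgn_def lbar_of_int)

lemma twist_linv: "twist (linv zz i f) = (\<lambda>x. - linv zz i (twist f) x)"
proof
  fix x
  show "twist (linv zz i f) x = - linv zz i (twist f) x"
  proof (cases "x \<in> W")
    case True
    then show ?thesis using lsgn_sref[OF True, of i]
      by (simp add: twist_def linv_def lbar_diff lbar_mult algebra_simps)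
  qed (simp add: twist_def linv_def)
qed

lemma twist_Liw:
  assumes "x \<in> W" shows "twist (Liw x unit_e) = (\<lambda>y. lsgn x * Liw x unit_e y)"
  using assms
proof (induction rule: reduced_induct)
  case id
  have "lsgn y * lbar (unit_e y) = unit_e y" for y
    by (cases "y = id") (auto simp: unit_e_def lsgn_def)
  moreover have l: "lsgn id = 1" by (simp add: lsgn_def)
  ultimately show ?case unfolding twist_def Liw_id l by simp
next
  case (sref i x)
  show ?case unfolding Liw_ascent[OF sref(1,2)] twist_linv sref(3) lsgn_sref[OF sref(1)]
    by (simp add: linv_scale)
qed

lemma barM_twist: "barM (twist f) = twist (barM f)"
proof
  fix y
  have "barM (twist f) y = (\<Sum>x\<in>W. f x * (lsgn x * Liw x unit_e y))"
    unfolding barM_def by (rule sum.cong[OF refl]) (simp add: twist_def lbar_mult algebra_simps)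
  also have "\<dots> = (\<Sum>x\<in>W. f x * twist (Liw x unit_e) y)"
    by (rule sum.cong[OF refl]) (simp add: twist_Liw)
  also have "\<dots> = twist (barM f) y"
    by (simp add: twist_def barM_def lbar_sum lbar_mult sum_distrib_left algebra_simps)
  finally show "barM (twist f) y = twist (barM f) y" .
qed

definition hprod :: "('i wg \<Rightarrow> laurent) \<Rightarrow> ('i wg \<Rightarrow> laurent) \<Rightarrow> 'i wg \<Rightarrow> laurent" where
  "hprod f g = (\<lambda>y. \<Sum>x\<in>W. f x * Lw x g y)"

lemma hprod_lop:
  assumes g: "supp g" shows "hprod (lop zz i f) g = lop zz i (hprod f g)"
proof
  fix y
  have "hprod (lop zz i f) g y = (\<Sum>x\<in>W. f x * lop zz i (Lw x g) y)"
    unfolding hprod_def lop_adjoint by (rule sum.cong[OF refl]) (simp add: lop_Lw g)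
  then show "hprod (lop zz i f) g y = lop zz i (hprod f g) y" unfolding hprod_def by (simp add: lop_sum)
qed

lemma supp_hprod: "supp g \<Longrightarrow> supp (hprod f g)"
  using supp_Lw[of g] by (simp add: supp_def hprod_def)

lemma hprod_linv:
  assumes f: "supp f" and g: "supp g" shows "hprod (linv zz i f) g = linv zz i (hprod f g)"
proof -
  have "hprod (linv zz i f) g = (\<lambda>y. hprod (lop zz i f) g y - zz * hprod f g y)"
    unfolding linv_lop_diff[OF f] by (simp add: hprod_def algebra_simps sum_subtractf sum_distrib_left)
  then show ?thesis unfolding linv_lop_diff[OF supp_hprod[OF g]] hprod_lop[OF g] .
qed

lemma hprod_unit_e: "hprod unit_e g = g"
proof
  fix y
  have "hprod unit_e g y = (\<Sum>x\<in>W. if x = id then Lw x g y else 0)"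
    unfolding hprod_def by (rule sum.cong) (auto simp: unit_e_def)
  then show "hprod unit_e g y = g y" by (simp add: sum.delta)
qed

lemma hprod_Liw:
  assumes "x \<in> W" "supp g" shows "hprod (Liw x unit_e) g = Liw x g"
  using assms(1)
proof (induction rule: reduced_induct)
  case id
  show ?case unfolding Liw_id by (rule hprod_unit_e)
next
  case (sref i x)
  show ?case unfolding Liw_ascent[OF sref(1,2)]
    using hprod_linv[OF supp_Liw[OF supp_unit_e] assms(2)] sref(3) by simp
qed

lemma barM_Lw:
  assumes "x \<in> W" shows "barM (Lw x g) = Liw x (barM g)"
  using assms
proof (induction rule: reduced_induct)
  case id
  show ?case unfolding Liw_id Lw_id ..
next
  case (sref i x)
  show ?case unfolding Liw_ascent[OF sref(1,2)] Lw_ascent[OF sref(1,2)] barM_lop sref(3) ..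
qed

lemma barM_hprod: "barM (hprod f g) = hprod (barM f) (barM g)"
proof
  fix y
  have "barM (hprod f g) y = (\<Sum>x\<in>W. lbar (f x) * Liw x (barM g) y)"
    unfolding hprod_def barM_sum by (simp add: barM_Lw)
  also have "\<dots> = (\<Sum>x\<in>W. lbar (f x) * hprod (Liw x unit_e) (barM g) y)"
    by (simp add: hprod_Liw)
  also have "\<dots> = (\<Sum>x\<in>W. \<Sum>v\<in>W. lbar (f x) * (Liw x unit_e v * Lw v (barM g) y))"
    by (simp add: hprod_def sum_distrib_left)
  also have "\<dots> = (\<Sum>v\<in>W. \<Sum>x\<in>W. lbar (f x) * (Liw x unit_e v * Lw v (barM g) y))" by (rule sum.swap)
  also have "\<dots> = hprod (barM f) (barM g) y"
    by (simp add: hprod_def barM_def[of f] sum_distrib_right mult.assoc)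
  finally show "barM (hprod f g) y = hprod (barM f) (barM g) y" .
qed

lemma reduced_rev: "reduced (rev ws) \<longleftrightarrow> reduced ws"
  using len_inv[of "elt ws"] by (simp add: reduced_def inv_word_elt)

text \<open>The last letter i moves onto g as T_i g, whose bar conjugate is T_i^-1 bar(g). At the
  point where it is evaluated i is a descent, since lo reverses signs of roots, so
  \<open>linv\<close> merely shifts the argument without a correction term.\<close>

lemma lop_word_top:
  assumes "reduced ws"
  shows "foldr (lop zz) ws g lo = lbar (barM g (inv (elt ws) \<circ> lo))"
  using assms
proof (induction ws arbitrary: g rule: rev_induct)
  case Nil
  have "barM g lo = lbar (g lo)"
    by (rule barM_top) (use longest in \<open>auto simp: not_less[symmetric]\<close>)
  then show ?case by (simp add: inv_id)
next
  case (snoc i ws)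
  let ?w = "elt ws"
  let ?u = "inv ?w \<circ> lo"
  have u: "?u \<in> W" using longest(1) by simp
  have "reduced (i # rev ws)" using snoc.prems reduced_rev[of "ws @ [i]"] by simp
  then have red: "reduced (rev ws)" and "\<not> len (s i \<circ> elt (rev ws)) < len (elt (rev ws))"
    using reduced_Cons by blast+
  then have "inv (elt (rev ws)) (\<alpha> i) \<in> \<Phi>pos" using descent_iff(1)[OF word_elt_in_weyl] by blast
  then have pos: "?w (\<alpha> i) \<in> \<Phi>pos" by (simp add: inv_word_elt)
  have "inv ?u = inv lo \<circ> ?w" 
    using inv_weyl_comp[OF weyl_inv[OF word_elt_in_weyl] longest(1)] weyl_inv_inv[OF word_elt_in_weyl] by metis
  then have "inv ?u (\<alpha> i) = inv lo (?w (\<alpha> i))" by (simp only: o_apply)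
  then have "desc i ?u" using descent_iff(1)[OF u] inv_longest_neg[OF pos] by metis
  then have "linv zz i (barM g) ?u = barM g (s i \<circ> ?u)" using u unfolding linv_def by simp
  moreover have "foldr (lop zz) (ws @ [i]) g lo = lbar (barM (lop zz i g) ?u)"
  proof -
    have "foldr (lop zz) (ws @ [i]) g = foldr (lop zz) ws (lop zz i g)" by simp
    then show ?thesis using snoc.IH[OF red[unfolded reduced_rev], of "lop zz i g"] by metis
  qed
  moreover have "inv (elt (ws @ [i])) \<circ> lo = s i \<circ> ?u"
    using inv_weyl_comp[of ?w "s i"] by (simp only: word_elt_append word_elt_Cons word_elt_Nil comp_id
      sref_in_weyl word_elt_in_weyl inv_sref comp_assoc)
  ultimately show ?case by (simp only: barM_lop)
qed

lemma Lw_top: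
  "x \<in> W \<Longrightarrow> Lw x g lo = lbar (barM g (inv x \<circ> lo))"
  unfolding Lw_def using lop_word_top[of "red_word A x" g] by (simp only: reduced_red_word red_word)

section \<open>Kazhdan--Lusztig elements and polynomials\<close>

text \<open>Bar invariance and the condition in tZ[t] already determine C. The support, degree and
  parity clauses travel through the construction in order to match C x with t^(l(w)-l(x))
  P_{x,w}(t^-2).\<close>

definition is_kl :: "'i wg \<Rightarrow> ('i wg \<Rightarrow> laurent) \<Rightarrow> bool" where
  "is_kl w C \<longleftrightarrow> supp C \<and> barM C = C \<and> C w = 1 \<and> (\<forall>x. x \<noteq> w \<longrightarrow> lpos (C x))
     \<and> (\<forall>x. C x \<noteq> 0 \<longrightarrow> bruhat x w)
     \<and> (\<forall>x n. x \<in> W \<longrightarrow> lookup (C x) n \<noteq> 0 \<longrightarrow>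
          n \<le> int (len w) - int (len x) \<and> even (int (len w) - int (len x) - n))"

text \<open>Multiplication by T_i + t, the bar invariant Kazhdan--Lusztig element of a simple
  reflection: T_i^-1 + 1/t = T_i + t.\<close>

definition kop :: "'i \<Rightarrow> ('i wg \<Rightarrow> laurent) \<Rightarrow> 'i wg \<Rightarrow> laurent" where
  "kop i f = (\<lambda>x. lop zz i f x + tt * f x)"

lemma supp_kop: "supp f \<Longrightarrow> supp (kop i f)"
  using supp_lop[of zz i f] by (simp add: supp_def kop_def)

lemma kop_at:
  assumes "x \<in> W"
  shows "kop i f x = f (s i \<circ> x) + (if desc i x then ti else tt) * f x"
  unfolding kop_def lop_def using assms by (simp add: zz_def algebra_simps)

lemma barM_kop: assumes "supp f" shows "barM (kop i f) = kop i (barM f)"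
proof -
  have "barM (kop i f) = (\<lambda>x. linv zz i (barM f) x + ti * barM f x)"
    unfolding kop_def barM_add barM_scale barM_lop by simp
  then show ?thesis
    unfolding linv_lop_diff[OF supp_barM] kop_def by (simp add: zz_def algebra_simps)
qed

lemma is_kl_unique: assumes "is_kl w C" "is_kl w D" shows "C = D"
proof -
  have "(\<lambda>x. C x - D x) = (\<lambda>x. 0)"
  proof (rule bar_invariant_lpos_zero)
    show "supp (\<lambda>x. C x - D x)" using assms by (simp add: is_kl_def supp_def)
    show "barM (\<lambda>x. C x - D x) = (\<lambda>x. C x - D x)" using assms by (simp add: barM_diff is_kl_def)
    show "lpos (C x - D x)" for x using assms by (cases "x = w") (auto simp: is_kl_def intro: lpos_diff)
  qed
  then show ?thesis by (metis eq_iff_diff_eq_0 ext)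
qed

lemma is_kl_id: "is_kl id unit_e"
proof -
  have pos: "lpos (unit_e x)" if "x \<noteq> id" for x using that unit_e_nz[of x] by (metis lpos_0)
  have deg: "n \<le> int (len id) - int (len x) \<and> even (int (len id) - int (len x) - n)"
    if nz: "lookup (unit_e x) n \<noteq> 0" for x n
  proof -
    have "x = id" using nz unit_e_nz[of x] by (metis lookup_zero)
    moreover from this have "n = 0" using nz unfolding \<open>x = id\<close> unit_e_id by (auto simp: lookup_one when_def split: if_splits)
    ultimately show ?thesis by simp
  qed
  have "bruhat x id" if "unit_e x \<noteq> (0 :: laurent)" for x using unit_e_nz[OF that] bruhat_refl by simp
  then show ?thesis unfolding is_kl_def using pos deg supp_unit_e barM_unit_e unit_e_id by blast
qed

abbreviation descents_below :: "'i \<Rightarrow> 'i wg \<Rightarrow> 'i wg set" where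
  "descents_below i v \<equiv> {z \<in> W. bruhat_lt A z v \<and> desc i z}"

text \<open>The product of T_i + t with C_v is bar invariant but may have constant terms below the
  top. Their values are the linear coefficients of C_v; subtracting these integer multiples of
  earlier basis elements preserves bar invariance and restores tZ[t].\<close>

lemma is_kl_step:
  assumes v: "v \<in> W" and up: "len v < len (s i \<circ> v)"
    and kl: "\<And>z. z \<in> W \<Longrightarrow> len z \<le> len v \<Longrightarrow> is_kl z (C z)"
  shows "is_kl (s i \<circ> v)
    (\<lambda>x. kop i (C v) x - (\<Sum>z\<in>descents_below i v. of_int (lookup (C v z) 1) * C z x))"
    (is "is_kl ?w ?X")
proof -
  let ?D = "descents_below i v"
  let ?\<mu> = "\<lambda>z. lookup (C v z) 1"
  have w: "?w \<in> W" using v by simp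
  have lw: "len ?w = Suc (len v)" using len_ascent[OF v, of i] up by simp
  have klv: "is_kl v (C v)" using kl[OF v] by simp
  have klz: "is_kl z (C z)" "len z < len v" "bruhat z v" "z \<noteq> v" if "z \<in> ?D" for z
    using that kl[of z] bruhat_lt_len[of z v] by (auto simp: bruhat_lt_def)
  have fin: "finite ?D" by simp
  have supp: "supp ?X"
    using supp_kop[of "C v" i] klv klz(1) by (auto simp: supp_def is_kl_def intro!: sum.neutral)
  have bar: "barM ?X = ?X"
  proof -
    have "barM ?X = (\<lambda>x. kop i (barM (C v)) x - (\<Sum>z\<in>?D. of_int (?\<mu> z) * barM (C z) x))"
      unfolding barM_diff barM_sum lbar_of_int using barM_kop[of "C v"] klv by (simp add: is_kl_def)
    moreover have "barM (C v) = C v" using klv by (simp add: is_kl_def)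
    moreover have "barM (C z) = C z" if "z \<in> ?D" for z using klz(1)[OF that] by (simp add: is_kl_def)
    ultimately show ?thesis by simp
  qed
  have zero: "C z x = 0" if "z \<in> ?D \<or> z = v" "len z < len x" for z x
  proof (rule ccontr)
    have "is_kl z (C z)" using that(1) klz(1) klv by blast
    moreover assume "C z x \<noteq> 0"
    ultimately have "bruhat x z" unfolding is_kl_def by blast
    then show False using bruhat_len[of x z] that(2) by auto
  qed
  have at_w: "?X ?w = 1"
  proof -
    have "kop i (C v) ?w = C v v + (if len v < len ?w then ti else tt) * C v ?w"
      using kop_at[OF w, of i "C v"] unfolding sref_o_sref_o .
    moreover have "C v ?w = 0" using zero[of v ?w] up by simp
    moreover have "C z ?w = 0" if "z \<in> ?D" for z using zero[of z ?w] that klz(2)[OF that] up by simp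
    ultimately show ?thesis using klv by (simp add: is_kl_def)
  qed
  have pos: "lpos (?X x)" if xw: "x \<noteq> ?w" for x
  proof (cases "x \<in> W")
    case False
    then show ?thesis using supp unfolding supp_def by simp
  next
    case x: True
    have sxv: "s i \<circ> x \<noteq> v" using xw by (metis sref_o_sref_o)
    then have p1: "lpos (C v (s i \<circ> x))" using klv by (simp add: is_kl_def)
    show ?thesis
    proof (cases "desc i x")
      case False
      have "lpos (tt * C v x)"
      proof (cases "x = v")
        case True
        then show ?thesis using klv by (simp add: is_kl_def tt_def lpos_def tp_def lookup_single when_def)
      next
        case False
        then show ?thesis using klv by (simp add: is_kl_def tt_def lpos_tp_mult)
      qed
      moreover have "lpos (of_int (?\<mu> z) * C z x)" if "z \<in> ?D" for z
        by (rule lpos_of_int_mult) (use klz(1)[OF that] that False in \<open>auto simp: is_kl_def\<close>)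
      ultimately show ?thesis
        unfolding kop_at[OF x] using p1 False by (auto intro!: lpos_diff lpos_add lpos_sum)
    next
      case down: True
      have xv: "x \<noteq> v" using down up by auto
      show ?thesis unfolding lpos_def
      proof (intro allI impI)
        fix n :: int assume n: "n \<le> 0"
        \<comment> \<open>At a descent x the value C_v(x) is divided by t, so its linear coefficient
          becomes the constant term. In the correction sum only z = x contributes to it, as C_x(x) =
          1.\<close>
        have "lookup (kop i (C v) x) n = lookup (C v (s i \<circ> x)) n + lookup (C v x) (n + 1)"
          unfolding kop_at[OF x] using down by (simp add: lookup_add ti_def lookup_tp_mult)
        also have "\<dots> = lookup (C v x) (n + 1)" using p1 n by (simp add: lpos_def)
        also have "\<dots> = (if n = 0 then ?\<mu> x else 0)"
          using klv xv n by (auto simp: is_kl_def lpos_def)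
        finally have k: "lookup (kop i (C v) x) n = (if n = 0 then ?\<mu> x else 0)" .
        have "(\<Sum>z\<in>?D. ?\<mu> z * lookup (C z x) n) = (\<Sum>z\<in>?D. if z = x then (if n = 0 then ?\<mu> x else 0) else 0)"
        proof (rule sum.cong[OF refl])
          fix z assume z: "z \<in> ?D"
          show "?\<mu> z * lookup (C z x) n = (if z = x then (if n = 0 then ?\<mu> x else 0) else 0)"
            using klz(1)[OF z] n by (auto simp: is_kl_def lpos_def lookup_one when_def)
        qed
        also have "\<dots> = (if x \<in> ?D then (if n = 0 then ?\<mu> x else 0) else 0)" by (simp add: fin)
        also have "\<dots> = (if n = 0 then ?\<mu> x else 0)"
        proof (cases "x \<in> ?D")
          case False
          then have "\<not> bruhat x v" using x xv down by (auto simp: bruhat_lt_def)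
          then have "C v x = 0" using klv by (auto simp: is_kl_def)
          then show ?thesis by simp
        qed simp
        finally show "lookup (?X x) n = 0"
          using k by (simp add: lookup_minus lookup_sum lookup_of_int_mult)
      qed
    qed
  qed
  have br: "bruhat x ?w" if X: "?X x \<noteq> 0" for x
  proof -
    have x: "x \<in> W" using X supp unfolding supp_def by blast
    have vw: "bruhat v ?w" by (rule bruhat_sref[OF v up])
    consider "C v (s i \<circ> x) \<noteq> 0" | "C v x \<noteq> 0" | z where "z \<in> ?D" "C z x \<noteq> 0"
    proof (cases "C v (s i \<circ> x) = 0 \<and> C v x = 0")
      case True
      then have "(\<Sum>z\<in>?D. of_int (?\<mu> z) * C z x) \<noteq> 0" using X unfolding kop_at[OF x] by simp
      then obtain z where "z \<in> ?D" "of_int (?\<mu> z) * C z x \<noteq> 0" by (rule sum.not_neutral_contains_not_neutral)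
      then show thesis using that(3)[of z] by simp
    qed (use that in blast)
    then show ?thesis
    proof cases
      case 1
      then have "bruhat (s i \<circ> x) v" using klv unfolding is_kl_def by blast
      then show ?thesis by (rule bruhat_lift[OF _ up])
    next
      case 2
      then have "bruhat x v" using klv unfolding is_kl_def by blast
      then show ?thesis using vw by (rule bruhat_trans)
    next
      case 3
      then have "bruhat x z" using klz(1) unfolding is_kl_def by blast
      then show ?thesis using klz(3)[OF 3(1)] vw bruhat_trans by blast
    qed
  qed
  have deg: "n \<le> int (len ?w) - int (len x) \<and> even (int (len ?w) - int (len x) - n)"
    if x: "x \<in> W" and X: "lookup (?X x) n \<noteq> 0" for x n
  proof -
    have dv: "n \<le> int (len v) - int (len y) \<and> even (int (len v) - int (len y) - n)"
      if "y \<in> W" "lookup (C v y) n \<noteq> 0" for y n using klv that unfolding is_kl_def by blast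
    let ?e = "if desc i x then - 1 else 1 :: int"
    have "lookup (?X x) n = lookup (C v (s i \<circ> x)) n + lookup (C v x) (n - ?e)
        - (\<Sum>z\<in>?D. ?\<mu> z * lookup (C z x) n)"
      unfolding kop_at[OF x]
      by (simp add: lookup_minus lookup_add lookup_sum lookup_of_int_mult ti_def tt_def lookup_tp_mult)
    then consider "lookup (C v (s i \<circ> x)) n \<noteq> 0" | "lookup (C v x) (n - ?e) \<noteq> 0"
      | z where "z \<in> ?D" "?\<mu> z \<noteq> 0" "lookup (C z x) n \<noteq> 0"
    proof (cases "lookup (C v (s i \<circ> x)) n = 0 \<and> lookup (C v x) (n - ?e) = 0")
      case True
      then have "(\<Sum>z\<in>?D. ?\<mu> z * lookup (C z x) n) \<noteq> 0"
        using X \<open>lookup (?X x) n = _\<close> by simp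
      then obtain z where "z \<in> ?D" "?\<mu> z * lookup (C z x) n \<noteq> 0" by (rule sum.not_neutral_contains_not_neutral)
      then show thesis using that(3)[of z] by simp
    qed (use that in blast)
    then show ?thesis
    proof cases
      case 1
      have sx: "s i \<circ> x \<in> W" using x by simp
      have "int (len (s i \<circ> x)) = int (len x) + ?e"
        using len_ascent[OF x, of i] len_descent[OF x, of i] by auto
      then show ?thesis using dv[OF sx 1] lw by (auto split: if_splits)
    next
      case 2
      then show ?thesis using dv[OF x 2] lw by (auto split: if_splits)
    next
      case 3
      \<comment> \<open>A nonzero linear coefficient forces l(v) - l(z) to be odd, so l(w) - l(z) is
        even and the parity for z transfers to w.\<close>
      have "even (int (len v) - int (len z) - 1)" using dv[of z 1] 3 by simp
      moreover have "n \<le> int (len z) - int (len x) \<and> even (int (len z) - int (len x) - n)"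
        using klz(1)[OF 3(1)] 3(3) x unfolding is_kl_def by blast
      ultimately show ?thesis using lw klz(2)[OF 3(1)] by presburger
    qed
  qed
  show ?thesis unfolding is_kl_def using supp bar at_w pos br deg by blast
qed

lemma ex_is_kl: "w \<in> W \<Longrightarrow> \<exists>C. is_kl w C"
proof (induction "len w" arbitrary: w rule: less_induct)
  case less
  show ?case
  proof (cases "w = id")
    case True
    then show ?thesis using is_kl_id by blast
  next
    case False
    then obtain i where i: "desc i w" using ex_descent less.prems by blast
    let ?v = "s i \<circ> w"
    have v: "?v \<in> W" using less.prems by simp
    have "\<exists>C. is_kl z C" if "z \<in> W" "len z \<le> len ?v" for z
      using less.hyps[OF le_less_trans[OF that(2) i] that(1)] .
    then have "is_kl z (SOME C. is_kl z C)" if "z \<in> W" "len z \<le> len ?v" for z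
      using that someI_ex by metis
    from is_kl_step[OF v _ this, of i] i show ?thesis unfolding sref_o_sref_o by blast
  qed
qed

definition klb :: "'i wg \<Rightarrow> 'i wg \<Rightarrow> laurent" where
  "klb w = (SOME C. is_kl w C)"

lemma is_kl_klb: "w \<in> W \<Longrightarrow> is_kl w (klb w)"
  unfolding klb_def using ex_is_kl someI_ex by metis

lemma klb_recursion:
  assumes "v \<in> W" "len v < len (s i \<circ> v)"
  shows "klb (s i \<circ> v) x
    = kop i (klb v) x - (\<Sum>z\<in>descents_below i v. of_int (lookup (klb v z) 1) * klb z x)"
proof -
  have w: "s i \<circ> v \<in> W" using assms by simp
  have k: "is_kl (s i \<circ> v)
      (\<lambda>x. kop i (klb v) x - (\<Sum>z\<in>descents_below i v. of_int (lookup (klb v z) 1) * klb z x))"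
    by (rule is_kl_step[OF assms]) (rule is_kl_klb)
  show ?thesis by (rule fun_cong[OF is_kl_unique[OF is_kl_klb[OF w] k]])
qed

lemma klb_bar: "w \<in> W \<Longrightarrow> barM (klb w) = klb w"
  and klb_diag: "w \<in> W \<Longrightarrow> klb w w = 1"
  and klb_pos: "w \<in> W \<Longrightarrow> x \<noteq> w \<Longrightarrow> lpos (klb w x)"
  and klb_bruhat: "w \<in> W \<Longrightarrow> klb w x \<noteq> 0 \<Longrightarrow> bruhat x w"
  and klb_degree: "w \<in> W \<Longrightarrow> x \<in> W \<Longrightarrow> lookup (klb w x) n \<noteq> 0 \<Longrightarrow>
     n \<le> int (len w) - int (len x) \<and> even (int (len w) - int (len x) - n)"
  using is_kl_klb[of w] unfolding is_kl_def by blast+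

text \<open>By \<open>Lw_top\<close> and bar invariance of the second factor, the coefficient is a
  signed sum over x of \<open>klb w x\<close> times \<open>klb y (inv x \<circ> lo)\<close>. The
  first factor lies in tZ[t] unless x = w, the second unless x = v; for x = w = v the term is 1. Bar
  invariance of the product then removes the remainder.\<close>

theorem kl_inversion:
  assumes w: "w \<in> W" and v: "v \<in> W" and y: "y = inv v \<circ> lo"
  shows "(\<Sum>x\<in>W. klb w x * Lw x (\<lambda>u. lsgn y * twist (klb y) u) lo) = (if w = v then 1 else 0)"
proof -
  let ?g = "\<lambda>u. lsgn y * twist (klb y) u"
  let ?S = "hprod (klb w) ?g lo"
  have yW: "y \<in> W" using v y longest(1) by simp
  have barg: "barM ?g = ?g"
    unfolding barM_scale barM_twist klb_bar[OF yW] by simp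
  have "barM (hprod (klb w) ?g) = hprod (klb w) ?g"
    unfolding barM_hprod barg klb_bar[OF w] ..
  moreover have "barM (hprod (klb w) ?g) lo = lbar ?S"
    by (rule barM_top) (use longest in \<open>auto simp: not_less[symmetric]\<close>)
  ultimately have barS: "lbar ?S = ?S" by metis
  define F where "F x = klb w x * (lsgn y * (lsgn (inv x \<circ> lo) * klb y (inv x \<circ> lo)))" for x
  have S: "?S = (\<Sum>x\<in>W. F x)"
    unfolding hprod_def F_def
  proof (rule sum.cong[OF refl])
    fix x assume "x \<in> W"
    from Lw_top[OF this, of ?g] show "klb w x * Lw x ?g lo
        = klb w x * (lsgn y * (lsgn (inv x \<circ> lo) * klb y (inv x \<circ> lo)))"
      unfolding barg by (simp add: twist_def lbar_mult)
  qed
  have eqy: "inv x \<circ> lo = y \<longleftrightarrow> x = v" if x: "x \<in> W" for x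
  proof
    assume "inv x \<circ> lo = y"
    then have "inv x = inv v" unfolding y using longest(1) by (metis bij_betw_weyl_right comp_assoc comp_id weyl_inv_comp(2))
    then show "x = v" using x v weyl_inv_inv by metis
  qed (simp add: y)
  have lsgn_lpos: "lpos (lsgn u * p)" if "lpos p" for u p
    unfolding lsgn_def by (rule lpos_of_int_mult[OF that])
  have "lpos (F x - (if x = w \<and> w = v then 1 else 0))" if x: "x \<in> W" for x
  proof (cases "x = w")
    case xw: True
    show ?thesis
    proof (cases "w = v")
      case True
      then have "F x = 1" unfolding F_def using xw eqy[OF x] klb_diag[OF w] klb_diag[OF yW] lsgn_square by simp
      then show ?thesis using xw True by simp
    next
      case False
      then have "inv x \<circ> lo \<noteq> y" using eqy[OF x] xw by simp
      then have "lpos (klb y (inv x \<circ> lo))" using klb_pos[OF yW] by blast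
      then have "lpos (F x)" unfolding F_def xw klb_diag[OF w] by (simp add: lsgn_lpos)
      then show ?thesis using False by simp
    qed
  next
    case False
    then have p: "lpos (klb w x)" using klb_pos[OF w] by blast
    have "lpos (F x)"
    proof (cases "x = v")
      case True
      then have "inv x \<circ> lo = y" using eqy[OF x] by simp
      then have "F x = klb w x" unfolding F_def using klb_diag[OF yW] lsgn_square[of y] by simp
      then show ?thesis using p by simp
    next
      case False
      then have "lpos (klb y (inv x \<circ> lo))" using klb_pos[OF yW] eqy[OF x] by blast
      then show ?thesis unfolding F_def by (intro lpos_mult p lsgn_lpos)
    qed
    then show ?thesis using False by simp
  qed
  then have P: "lpos (\<Sum>x\<in>W. F x - (if x = w \<and> w = v then 1 else 0))" by (rule lpos_sum)
  have E: "(\<Sum>x\<in>W. F x - (if x = w \<and> w = v then 1 else 0)) = ?S - (if w = v then 1 else 0)"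
  proof -
    have d: "(\<Sum>x\<in>W. if x = w \<and> w = v then 1 else 0) = (if w = v then 1 else 0 :: laurent)"
    proof (cases "w = v")
      case True
      have "(\<Sum>x\<in>W. if x = w then 1 else 0) = (1 :: laurent)" using w by (simp add: sum.delta)
      then show ?thesis using True by (simp only: simp_thms if_True)
    next
      case False
      then show ?thesis by (simp only: simp_thms if_False sum.neutral_const)
    qed
    show ?thesis by (simp only: sum_subtractf d S)
  qed
  have B: "lbar (?S - (if w = v then 1 else 0)) = ?S - (if w = v then 1 else 0)"
  proof -
    have "lbar (if w = v then 1 else 0) = (if w = v then 1 else 0)" by simp
    then show ?thesis by (simp only: lbar_diff barS)
  qed
  have "?S - (if w = v then 1 else 0) = 0" by (rule lpos_lbar_eq[OF P[unfolded E] B])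
  then have "?S = (if w = v then 1 else 0)" by (simp only: right_minus_eq)
  then show ?thesis unfolding hprod_def .
qed

section \<open>Kazhdan--Lusztig polynomials read off from the basis\<close>

definition klp :: "'i wg \<Rightarrow> 'i wg \<Rightarrow> int poly" where
  "klp x w = (if x \<in> W \<and> w \<in> W
     then \<Sum>k\<le>len w. monom (lookup (klb w x) (int (len w) - int (len x) - 2 * int k)) k else 0)"

text \<open>Cutting off at k = l(w) loses nothing: for larger k the exponent is negative, where the
  basis coefficients vanish.\<close>

lemma coeff_klp:
  assumes x: "x \<in> W" and w: "w \<in> W"
  shows "coeff (klp x w) k = lookup (klb w x) (int (len w) - int (len x) - 2 * int k)"
proof -
  have "lookup (klb w x) (int (len w) - int (len x) - 2 * int k) = 0" if "\<not> k \<le> len w"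
  proof (cases "x = w")
    case True
    then show ?thesis using that klb_diag[OF w] by (simp add: lookup_one)
  next
    case False
    then show ?thesis using that klb_pos[OF w False] by (simp add: lpos_def)
  qed
  then show ?thesis using x w by (simp add: klp_def coeff_sum)
qed

lemma coeff_X_power_mult: "coeff ([:0, 1:] ^ a * p) k = (if a \<le> k then coeff p (k - a) else 0)"
  for p :: "'a::comm_ring_1 poly"
  by (simp add: monom_altdef[of 1, simplified, symmetric] coeff_monom_mult)

lemma odd_int_diff: "a < b \<Longrightarrow> even (b - a) \<Longrightarrow> odd (int b - int a - 1)" for a b :: nat
  by presburger

lemma half_int_diff: "a < b \<Longrightarrow> even (int b - int a - 1) \<Longrightarrow> 2 * int ((Suc b - a) div 2) = int (Suc b) - int a"
  for a b :: nat
  by presburger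

lemma kl_mu_klp:
  assumes v: "v \<in> W" and z: "z \<in> W" and lt: "bruhat_lt A z v"
  shows "kl_mu A klp z v = lookup (klb v z) 1"
proof (cases "odd (len v - len z)")
  case True
  then obtain n where "len v - len z = 2 * n + 1" by (rule oddE)
  then have "int (len v) - int (len z) - 2 * int ((len v - len z - 1) div 2) = 1"
    by simp
  then show ?thesis using True lt by (simp add: kl_mu_def coeff_klp[OF z v])
next
  case False
  have "len z < len v" by (rule bruhat_lt_len[OF lt])
  from odd_int_diff[OF this] False have "odd (int (len v) - int (len z) - 1)" by blast
  then show ?thesis using False klb_degree[OF v z, of 1] by (auto simp: kl_mu_def)
qed

text \<open>The basis recursion compared coefficient by coefficient. The factor t or 1/t coming from
  T_i + t, combined with the change of length from x to \<open>s i \<circ> x\<close>, accounts for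
  the powers q^(1-c) and q^c.\<close>

lemma kl_family_klp: "kl_family A klp"
  unfolding kl_family_def Let_def
proof (intro conjI allI ballI impI)
  fix x w assume "x \<notin> W \<or> w \<notin> W \<or> \<not> bruhat x w"
  then show "klp x w = 0"
  proof (cases "x \<in> W \<and> w \<in> W")
    case True
    with \<open>_ \<or> _\<close> have "klb w x = 0" using klb_bruhat by blast
    then show ?thesis using True by (intro poly_eqI) (simp add: coeff_klp)
  qed (auto simp: klp_def)
next
  show "klp id id = 1"
    by (rule poly_eqI) (simp add: coeff_klp klb_diag lookup_one when_def coeff_1)
next
  fix x w i assume x: "x \<in> W" and w: "w \<in> W" and down: "desc i w"
  let ?v = "s i \<circ> w"
  let ?c = "if desc i x then 1 else 0 :: nat"
  have v: "?v \<in> W" and sx: "s i \<circ> x \<in> W" using w x by simp_all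
  have lw: "len w = Suc (len ?v)" by (rule len_descent[OF w down])
  show "klp x w = [:0, 1:] ^ (1 - ?c) * klp (s i \<circ> x) ?v + [:0, 1:] ^ ?c * klp x ?v
      - (\<Sum>z\<in>descents_below i ?v. smult (kl_mu A klp z ?v) ([:0, 1:] ^ ((len w - len z) div 2) * klp x z))"
  proof (rule poly_eqI)
    fix k
    let ?n = "int (len w) - int (len x) - 2 * int k"
    have zero: "lookup (klb u y) n = 0" if "u \<in> W" "y \<in> W" "n > int (len u) - int (len y)" for u y n
      using klb_degree[OF that(1,2), of n] that(3) by linarith
    have up: "len ?v < len (s i \<circ> ?v)" unfolding sref_o_sref_o by (rule down)
    have "klb w x = kop i (klb ?v) x - (\<Sum>z\<in>descents_below i ?v. of_int (lookup (klb ?v z) 1) * klb z x)"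
      using klb_recursion[OF v up, of x] unfolding sref_o_sref_o .
    then have rec: "coeff (klp x w) k = lookup (kop i (klb ?v) x) ?n
        - (\<Sum>z\<in>descents_below i ?v. lookup (klb ?v z) 1 * lookup (klb z x) ?n)"
      by (simp add: coeff_klp[OF x w] lookup_minus lookup_sum lookup_of_int_mult)
    have 1: "lookup (kop i (klb ?v) x) ?n
        = coeff ([:0, 1:] ^ (1 - ?c) * klp (s i \<circ> x) ?v) k + coeff ([:0, 1:] ^ ?c * klp x ?v) k"
    proof (cases "desc i x")
      case True
      have l: "len x = Suc (len (s i \<circ> x))" by (rule len_descent[OF x True])
      have "lookup (kop i (klb ?v) x) ?n = lookup (klb ?v (s i \<circ> x)) ?n + lookup (klb ?v x) (?n + 1)"
        unfolding kop_at[OF x] using True by (simp add: lookup_add ti_def lookup_tp_mult)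
      moreover have "?n = int (len ?v) - int (len (s i \<circ> x)) - 2 * int k" using l lw by simp
      moreover have "lookup (klb ?v x) (?n + 1) = (if 1 \<le> k then coeff (klp x ?v) (k - 1) else 0)"
      proof (cases "1 \<le> k")
        case True
        then have "?n + 1 = int (len ?v) - int (len x) - 2 * int (k - 1)" using lw by simp
        then show ?thesis using True by (simp only: coeff_klp[OF x v] if_True)
      next
        case False
        then show ?thesis using zero[OF v x, of "?n + 1"] lw by simp
      qed
      ultimately show ?thesis using True
        by (simp only: coeff_X_power_mult coeff_klp[OF sx v]) simp
    next
      case False
      have l: "len (s i \<circ> x) = Suc (len x)" by (rule len_ascent[OF x False])
      have "lookup (kop i (klb ?v) x) ?n = lookup (klb ?v (s i \<circ> x)) ?n + lookup (klb ?v x) (?n - 1)"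
        unfolding kop_at[OF x] using False by (simp add: lookup_add tt_def lookup_tp_mult)
      moreover have "?n - 1 = int (len ?v) - int (len x) - 2 * int k" using lw by simp
      moreover have "lookup (klb ?v (s i \<circ> x)) ?n = (if 1 \<le> k then coeff (klp (s i \<circ> x) ?v) (k - 1) else 0)"
      proof (cases "1 \<le> k")
        case True
        then have "?n = int (len ?v) - int (len (s i \<circ> x)) - 2 * int (k - 1)" using lw l by simp
        then show ?thesis using True by (simp only: coeff_klp[OF sx v] if_True)
      next
        case False
        then show ?thesis using zero[OF v sx, of ?n] lw l by simp
      qed
      ultimately show ?thesis using False
        by (simp only: coeff_X_power_mult coeff_klp[OF x v]) simp
    qed
    have 2: "lookup (klb ?v z) 1 * lookup (klb z x) ?n
        = coeff (smult (kl_mu A klp z ?v) ([:0, 1:] ^ ((len w - len z) div 2) * klp x z)) k"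
      if z: "z \<in> descents_below i ?v" for z
    proof -
      have zW: "z \<in> W" and lt: "bruhat_lt A z ?v" using z by auto
      have lz: "len z < len ?v" by (rule bruhat_lt_len[OF lt])
      have mu: "kl_mu A klp z ?v = lookup (klb ?v z) 1" by (rule kl_mu_klp[OF v zW lt])
      show ?thesis
      proof (cases "lookup (klb ?v z) 1 = 0")
        case False
        \<comment> \<open>Nonvanishing of the linear coefficient makes l(w) - l(z) even, so the
          division by 2 in the exponent of q is exact.\<close>
        then have "even (int (len ?v) - int (len z) - 1)" using klb_degree[OF v zW] by blast
        then have e: "2 * int ((len w - len z) div 2) = int (len w) - int (len z)"
          using half_int_diff[OF lz] unfolding lw by blast
        show ?thesis
        proof (cases "(len w - len z) div 2 \<le> k")
          case True
          then have "int (len z) - int (len x) - 2 * int (k - (len w - len z) div 2) = ?n"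
            using e by (simp add: of_nat_diff)
          then show ?thesis using True by (simp only: mu coeff_smult coeff_X_power_mult if_True coeff_klp[OF x zW])
        next
          case k: False
          then have "?n > int (len z) - int (len x)" using e by linarith
          then show ?thesis using k zero[OF zW x] by (simp add: mu coeff_X_power_mult)
        qed
      qed (simp add: mu)
    qed
    show "coeff (klp x w) k = coeff ([:0, 1:] ^ (1 - ?c) * klp (s i \<circ> x) ?v + [:0, 1:] ^ ?c * klp x ?v
      - (\<Sum>z\<in>descents_below i ?v. smult (kl_mu A klp z ?v) ([:0, 1:] ^ ((len w - len z) div 2) * klp x z))) k"
      unfolding rec 1 coeff_diff coeff_add coeff_sum by (simp only: 2 cong: sum.cong)
  qed
qed

text \<open>Every w other than \<open>id\<close> has a left descent, so the recursion determines all
  values by induction on length; this justifies the definite description in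
  \<open>kl_poly\<close>.\<close>

lemma kl_family_unique:
  assumes P: "kl_family A P" and Q: "kl_family A Q" shows "P = Q"
proof -
  have zero: "R x w = 0" if "kl_family A R" "x \<notin> W \<or> w \<notin> W \<or> \<not> bruhat x w" for R x w
    using that unfolding kl_family_def by blast
  have rec: "R x w = [:0,1:] ^ (1 - (if desc i x then 1 else 0 :: nat)) * R (s i \<circ> x) (s i \<circ> w)
      + [:0,1:] ^ (if desc i x then 1 else 0 :: nat) * R x (s i \<circ> w)
      - (\<Sum>z\<in>descents_below i (s i \<circ> w). smult (kl_mu A R z (s i \<circ> w)) ([:0,1:] ^ ((len w - len z) div 2) * R x z))"
    if "kl_family A R" "x \<in> W" "w \<in> W" "desc i w" for R x w i
    using that unfolding kl_family_def Let_def by blast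
  have "P x w = Q x w" if "w \<in> W" for x w
    using that
  proof (induction "len w" arbitrary: w x rule: less_induct)
    case less
    show ?case
    proof (cases "x \<in> W")
      case False
      then show ?thesis using zero[OF P, of x w] zero[OF Q, of x w] by metis
    next
      case x: True
      show ?thesis
      proof (cases "w = id")
        case True
        show ?thesis
        proof (cases "x = id")
          case x: True
          have "P id id = 1" "Q id id = 1" using P Q unfolding kl_family_def by blast+
          then show ?thesis unfolding True x by metis
        next
          case False
          then have "\<not> bruhat x w" using bruhat_len[of x id] True by auto
          then show ?thesis using zero[OF P, of x w] zero[OF Q, of x w] by metis
        qed
      next
        case False
        then obtain i where i: "desc i w" using ex_descent less.prems by blast
        have v: "s i \<circ> w \<in> W" using less.prems by simp
        have IH: "P y u = Q y u" if "u \<in> W" "len u < len w" for y u using less.hyps that by blast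
        have Pv: "P y (s i \<circ> w) = Q y (s i \<circ> w)" for y by (rule IH[OF v i])
        have mu: "kl_mu A P z (s i \<circ> w) = kl_mu A Q z (s i \<circ> w)" for z unfolding kl_mu_def Pv ..
        have "(\<Sum>z\<in>descents_below i (s i \<circ> w). smult (kl_mu A P z (s i \<circ> w)) ([:0,1:] ^ ((len w - len z) div 2) * P x z))
          = (\<Sum>z\<in>descents_below i (s i \<circ> w). smult (kl_mu A Q z (s i \<circ> w)) ([:0,1:] ^ ((len w - len z) div 2) * Q x z))"
        proof (rule sum.cong[OF refl])
          fix z assume "z \<in> descents_below i (s i \<circ> w)"
          then have "z \<in> W" "len z < len w" using bruhat_lt_len[of z "s i \<circ> w"] i by auto
          then have "P x z = Q x z" by (rule IH)
          then show "smult (kl_mu A P z (s i \<circ> w)) ([:0,1:] ^ ((len w - len z) div 2) * P x z)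
            = smult (kl_mu A Q z (s i \<circ> w)) ([:0,1:] ^ ((len w - len z) div 2) * Q x z)" unfolding mu by simp
        qed
        then show ?thesis unfolding rec[OF P x less.prems i] rec[OF Q x less.prems i] Pv by simp
      qed
    qed
  qed
  moreover have "P x w = Q x w" if "w \<notin> W" for x w
    using that zero[OF P, of x w] zero[OF Q, of x w] by metis
  ultimately show ?thesis by (metis ext)
qed

lemma kl_poly_eq: "kl_poly A = klp"
  unfolding kl_poly_def
  by (rule the_equality[where P = "kl_family A"], rule kl_family_klp, erule kl_family_unique, rule kl_family_klp)

end

section \<open>The twisted group algebra\<close>

locale twisted_datum = cartan_datum A for A :: "'i::finite \<Rightarrow> 'i \<Rightarrow> int" +
  fixes t :: "'k::field" and e :: "'i wt \<Rightarrow> 'k" and act :: "'i wg \<Rightarrow> 'k \<Rightarrow> 'k"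
  assumes t_nz: "t \<noteq> 0" and e_zero: "e 0 = 1"
    and e_add: "e (lam + mu) = e lam * e mu"
    and e_roots: "\<beta> \<in> roots A \<Longrightarrow> e \<beta> \<noteq> 1"
    and act_add: "u \<in> weyl A \<Longrightarrow> act u (a + b) = act u a + act u b"
    and act_mult: "u \<in> weyl A \<Longrightarrow> act u (a * b) = act u a * act u b"
    and act_one: "u \<in> weyl A \<Longrightarrow> act u 1 = 1"
    and act_t: "u \<in> weyl A \<Longrightarrow> act u t = t"
    and act_e: "u \<in> weyl A \<Longrightarrow> act u (e lam) = e (u lam)"
begin

lemma e_minus: "e (- lam) * e lam = 1"
  using e_add[of "- lam" lam] e_zero by simp

lemma e_nz: "e lam \<noteq> 0"
  using e_minus[of lam] by auto

lemma e_neq_1: "\<beta> \<in> \<Phi> \<Longrightarrow> e (- \<beta>) \<noteq> 1"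
  by (rule e_roots) simp

lemma act_zero: "u \<in> W \<Longrightarrow> act u 0 = 0"
proof -
  assume "u \<in> W"
  then have "act u 0 + act u 0 = act u 0 + 0" using act_add[of u 0 0] by (simp only: add_0_right)
  then show ?thesis by (rule add_left_imp_eq)
qed

lemma act_minus: "u \<in> W \<Longrightarrow> act u (- a) = - act u a"
  using act_add[of u "- a" a] act_zero[of u] by (simp add: eq_neg_iff_add_eq_0)

lemma act_diff: "u \<in> W \<Longrightarrow> act u (a - b) = act u a - act u b"
  using act_add[of u a "- b"] act_minus[of u b] by simp

lemma act_nz: "u \<in> W \<Longrightarrow> a \<noteq> 0 \<Longrightarrow> act u a \<noteq> 0"
  using act_mult[of u a "inverse a"] act_one[of u] by auto

lemma act_inverse: "u \<in> W \<Longrightarrow> act u (inverse a) = inverse (act u a)"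
proof (cases "a = 0")
  case False
  assume "u \<in> W"
  then have "act u a * act u (inverse a) = 1" using act_mult[of u a "inverse a"] act_one[of u] False by simp
  then show ?thesis by (rule inverse_unique[symmetric])
qed (simp add: act_zero)

lemma act_divide: "u \<in> W \<Longrightarrow> act u (a / b) = act u a / act u b"
  by (simp add: divide_inverse act_mult act_inverse)

lemma act_sum: "u \<in> W \<Longrightarrow> act u (\<Sum>x\<in>X. f x) = (\<Sum>x\<in>X. act u (f x))"
  by (induction X rule: infinite_finite_induct) (simp_all add: act_zero act_add)

lemma act_prod: "u \<in> W \<Longrightarrow> act u (\<Prod>x\<in>X. f x) = (\<Prod>x\<in>X. act u (f x))"
  by (induction X rule: infinite_finite_induct) (simp_all add: act_one act_mult)

text \<open>Only on the subfield generated by \<open>t\<close> and the \<open>e lam\<close> is \<open>act\<close> known to be an action.\<close>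

definition acts_on :: "'k \<Rightarrow> bool" where
  "acts_on y \<longleftrightarrow> act id y = y \<and> (\<forall>u\<in>W. \<forall>v\<in>W. act u (act v y) = act (u \<circ> v) y)"

lemma acts_on_add: "acts_on a \<Longrightarrow> acts_on b \<Longrightarrow> acts_on (a + b)"
  and acts_on_diff: "acts_on a \<Longrightarrow> acts_on b \<Longrightarrow> acts_on (a - b)"
  and acts_on_mult: "acts_on a \<Longrightarrow> acts_on b \<Longrightarrow> acts_on (a * b)"
  and acts_on_divide: "acts_on a \<Longrightarrow> acts_on b \<Longrightarrow> acts_on (a / b)"
  and acts_on_inverse: "acts_on a \<Longrightarrow> acts_on (inverse a)"
  and acts_on_0: "acts_on 0" and acts_on_1: "acts_on 1"
  and acts_on_t: "acts_on t" and acts_on_e: "acts_on (e lam)"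
  unfolding acts_on_def
  by (simp_all add: act_add act_diff act_mult act_divide act_inverse act_zero act_one act_t act_e)

lemma acts_on_sum: "(\<And>x. x \<in> X \<Longrightarrow> acts_on (f x)) \<Longrightarrow> acts_on (\<Sum>x\<in>X. f x)"
  by (induction X rule: infinite_finite_induct) (simp_all add: acts_on_0 acts_on_add)

lemma acts_on_prod: "(\<And>x. x \<in> X \<Longrightarrow> acts_on (f x)) \<Longrightarrow> acts_on (\<Prod>x\<in>X. f x)"
  by (induction X rule: infinite_finite_induct) (simp_all add: acts_on_1 acts_on_mult)

lemma acts_onD: "acts_on y \<Longrightarrow> act id y = y" "acts_on y \<Longrightarrow> u \<in> W \<Longrightarrow> v \<in> W \<Longrightarrow> act u (act v y) = act (u \<circ> v) y"
  by (simp_all add: acts_on_def)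

definition cc :: 'k where "cc = t + inverse t"

text \<open>The coefficient of the identity in \<tau>_i + t at \<beta> = \<alpha>_i; the coefficient
  of \<delta>_i is the value at the opposite root, that is \<open>cc\<close> minus this one.\<close>

definition pw :: "'i wt \<Rightarrow> 'k" where
  "pw \<beta> = (inverse t - t * e (- \<beta>)) / (1 - e (- \<beta>))"

lemma cc_minus_pw:
  assumes "\<beta> \<in> \<Phi>" shows "cc - pw \<beta> = (t - inverse t * e (- \<beta>)) / (1 - e (- \<beta>))"
  using e_neq_1[OF assms] by (simp add: cc_def pw_def field_simps) (simp flip: add_divide_distrib)

lemma hecke_weight_pw: "hecke_weight cc pw"
  unfolding hecke_weight_def
proof (intro conjI ballI impI)
  fix \<beta> assume b: "\<beta> \<in> \<Phi>"
  define x where "x = e (- \<beta>)"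
  have x: "x \<noteq> 1" "x \<noteq> 0" using e_neq_1[OF b] e_nz by (auto simp: x_def)
  have "e \<beta> = inverse x" using e_minus[of \<beta>] unfolding x_def by (simp add: inverse_unique)
  then have "pw (- \<beta>) = (inverse t - t * inverse x) / (1 - inverse x)" by (simp add: pw_def)
  also have "\<dots> = (t - inverse t * x) / (1 - x)" using x t_nz by (simp add: field_simps)
  finally show "pw (- \<beta>) = cc - pw \<beta>" using cc_minus_pw[OF b] by (simp add: x_def)
  fix \<gamma> assume g: "\<gamma> \<in> \<Phi>" and bg: "\<beta> + \<gamma> \<in> \<Phi>"
  define y where "y = e (- \<gamma>)"
  have y: "y \<noteq> 1" using e_neq_1[OF g] by (simp add: y_def)
  have "- (\<beta> + \<gamma>) = - \<beta> + - \<gamma>" by simp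
  then have xy: "e (- (\<beta> + \<gamma>)) = x * y" unfolding x_def y_def by (metis e_add)
  then have xy1: "x * y \<noteq> 1" using e_neq_1[OF bg] by simp
  have p: "pw \<beta> = (inverse t - t * x) / (1 - x)" "pw \<gamma> = (inverse t - t * y) / (1 - y)"
    "pw (\<beta> + \<gamma>) = (inverse t - t * (x * y)) / (1 - x * y)"
    unfolding pw_def xy by (simp_all add: x_def y_def)
  have nz: "1 - x \<noteq> 0" "1 - y \<noteq> 0" "1 - x * y \<noteq> 0" using x y xy1 by auto
  define P Q R where "P = pw \<beta>" and "Q = pw \<gamma>" and "R = pw (\<beta> + \<gamma>)"
  have PQR: "P * (1 - x) = inverse t - t * x" "Q * (1 - y) = inverse t - t * y"
    "R * (1 - x * y) = inverse t - t * (x * y)"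
    unfolding P_def Q_def R_def p using nz by simp_all
  have tt: "t * inverse t = 1" using t_nz by simp
  \<comment> \<open>The addition formula with denominators cleared; multiplicativity of e enters
    only through the value x * y at the sum of the roots.\<close>
  have "(1 - x) * ((1 - y) * ((1 - x * y) * (R * (P + Q - (t + inverse t)) - (P * Q - 1)))) = 0"
    using PQR tt by algebra
  then have "R * (P + Q - (t + inverse t)) - (P * Q - 1) = 0" using nz by simp
  then show "pw (\<beta> + \<gamma>) * (pw \<beta> + pw \<gamma> - cc) = pw \<beta> * pw \<gamma> - 1"
    by (simp add: P_def Q_def R_def cc_def)
qed

lemma act_pw: "u \<in> W \<Longrightarrow> act u (pw \<beta>) = pw (u \<beta>)"
proof -
  assume u: "u \<in> W"
  have "act u (e (- \<beta>)) = e (- u \<beta>)" unfolding act_e[OF u] weyl_minus[OF u] ..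
  then show ?thesis unfolding pw_def by (simp only: u act_divide act_diff act_mult act_inverse act_one act_t)
qed

lemma act_cc: "u \<in> W \<Longrightarrow> act u cc = cc"
  by (simp add: cc_def act_add act_inverse act_t)

lemma acts_on_pw: "acts_on (pw \<beta>)" and acts_on_cc: "acts_on cc"
  unfolding pw_def cc_def
  by (intro acts_on_add acts_on_divide acts_on_diff acts_on_mult acts_on_inverse acts_on_1 acts_on_t acts_on_e)+

section \<open>Demazure--Lusztig elements in the basis of the group\<close>

abbreviation D :: "'i \<Rightarrow> ('i wg \<Rightarrow> 'k) \<Rightarrow> 'i wg \<Rightarrow> 'k" where
  "D \<equiv> dop t cc pw"

text \<open>The coefficients of \<tau>_x placed to the right of the \<delta>_u, so that the usual
  coefficient is \<open>act u (G x u)\<close>.\<close>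

definition G :: "'i wg \<Rightarrow> 'i wg \<Rightarrow> 'k" where
  "G x = foldr D (red_word A x) unit_e"

lemma tmult_at:
  assumes "u \<in> W" shows "tmult A act h h' u = (\<Sum>v\<in>W. h v * act v (h' (inv v \<circ> u)))"
  unfolding tmult_def
proof (rule sum.cong[OF refl])
  fix v assume v: "v \<in> W"
  have "{v' \<in> W. v \<circ> v' = u} = {inv v \<circ> u}"
  proof (intro equalityI subsetI)
    fix x assume "x \<in> {v' \<in> W. v \<circ> v' = u}"
    then show "x \<in> {inv v \<circ> u}" using weyl_inv_comp(3)[OF v, of x] by simp
  next
    fix x assume "x \<in> {inv v \<circ> u}"
    then have "x = inv v \<circ> u" by simp
    then show "x \<in> {v' \<in> W. v \<circ> v' = u}"
      using weyl_inv_comp(4)[OF v, of u] weyl_comp[OF weyl_inv[OF v] assms] by blast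
  qed
  then show "(\<Sum>v'\<in>{v' \<in> W. v \<circ> v' = u}. h v * act v (h' v')) = h v * act v (h' (inv v \<circ> u))" by simp
qed

lemma sref_neq_id: "s i \<noteq> id"
proof
  assume "s i = id"
  then have "\<alpha> i = - \<alpha> i" using sref_simple_root[of i] by simp
  then have "\<alpha> i i = - \<alpha> i i" by (metis uminus_apply)
  then show False by (simp add: simple_root_apply)
qed

lemma tmult_dl_tau:
  assumes u: "u \<in> W"
  shows "tmult A act (dl_tau A t e i) h u
    = (pw (\<alpha> i) - t) * act id (h u) + (cc - pw (\<alpha> i)) * act (s i) (h (s i \<circ> u))"
proof -
  have nz: "1 - e (- \<alpha> i) \<noteq> 0" using e_neq_1[of "\<alpha> i"] by simp
  have d: "dl_tau A t e i id = pw (\<alpha> i) - t" "dl_tau A t e i (s i) = cc - pw (\<alpha> i)"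
    using sref_neq_id[of i] nz cc_minus_pw[of "\<alpha> i"]
    by (simp_all add: dl_tau_def pw_def field_simps)
  have "tmult A act (dl_tau A t e i) h u
      = (\<Sum>v\<in>{id, s i}. dl_tau A t e i v * act v (h (inv v \<circ> u)))"
    unfolding tmult_at[OF u] by (rule sum.mono_neutral_right) (auto simp: dl_tau_def)
  also have "\<dots> = dl_tau A t e i id * act id (h (inv id \<circ> u)) + dl_tau A t e i (s i) * act (s i) (h (inv (s i) \<circ> u))"
    using sref_neq_id[of i] by simp
  finally show ?thesis unfolding d inv_sref inv_id id_comp .
qed

text \<open>Both claims must be proved together: cancelling \<open>act (s i)\<close> against
  \<open>act (s i \<circ> u)\<close> is legitimate only on elements satisfying
  \<open>acts_on\<close>.\<close>

lemma word_product:
  assumes "u \<in> W"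
  shows "foldr (\<lambda>i acc. tmult A act (dl_tau A t e i) acc) ws delta_e u = act u (foldr D ws unit_e u)
    \<and> acts_on (foldr D ws unit_e u)"
  using assms
proof (induction ws arbitrary: u)
  case Nil
  then show ?case by (auto simp: delta_e_def unit_e_def act_one act_zero acts_on_0 acts_on_1)
next
  case (Cons i ws)
  let ?h = "foldr (\<lambda>i acc. tmult A act (dl_tau A t e i) acc) ws delta_e" and ?g = "foldr D ws unit_e"
  have u: "u \<in> W" and su: "s i \<circ> u \<in> W" using Cons.prems by simp_all
  note IH = Cons.IH[OF u] Cons.IH[OF su]
  have g: "D i ?g u = (pw (inv u (\<alpha> i)) - t) * ?g u + (cc - pw (inv u (\<alpha> i))) * ?g (s i \<circ> u)"
    unfolding dop_def using u by simp
  have "tmult A act (dl_tau A t e i) ?h u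
      = (pw (\<alpha> i) - t) * act id (act u (?g u)) + (cc - pw (\<alpha> i)) * act (s i) (act (s i \<circ> u) (?g (s i \<circ> u)))"
    unfolding tmult_dl_tau[OF u] conjunct1[OF IH(1)] conjunct1[OF IH(2)] ..
  also have "act id (act u (?g u)) = act u (?g u)"
    using acts_onD(2)[of "?g u" id u] IH(1) u id_comp by (metis id_in_weyl)
  also have "act (s i) (act (s i \<circ> u) (?g (s i \<circ> u))) = act u (?g (s i \<circ> u))"
    using acts_onD(2)[of "?g (s i \<circ> u)" "s i" "s i \<circ> u"] IH(2) su by (metis sref_in_weyl sref_o_sref_o)
  finally have "tmult A act (dl_tau A t e i) ?h u = act u (D i ?g u)"
    unfolding g using u by (simp add: act_add act_mult act_diff act_pw act_cc act_t weyl_apply_inv)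
  moreover have "acts_on (D i ?g u)"
    unfolding g by (intro acts_on_add acts_on_mult acts_on_diff acts_on_pw acts_on_cc acts_on_t
        conjunct2[OF IH(1)] conjunct2[OF IH(2)])
  ultimately show ?case by simp
qed

lemma tau_w_G: "x \<in> W \<Longrightarrow> u \<in> W \<Longrightarrow> tau_w A t e act x u = act u (G x u)"
  and acts_on_G: "u \<in> W \<Longrightarrow> acts_on (G x u)"
  using word_product[of u "red_word A x"] by (simp_all add: tau_w_def G_def)

lemma t_inverse: "t * inverse t = 1"
  using t_nz by simp

lemma G_ascent: "x \<in> W \<Longrightarrow> \<not> desc i x \<Longrightarrow> G (s i \<circ> x) = D i (G x)"
  unfolding G_def by (rule foldr_red_word_ascent[OF dop_reduced_word[OF hecke_weight_pw cc_def t_inverse]])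

lemma supp_dop: "supp (dop a c p i g)"
  by (simp add: supp_def dop_def)

lemma supp_G: "supp (G x)"
  unfolding G_def by (cases "red_word A x") (simp_all add: supp_dop)

lemma D_D: assumes "supp g" shows "D i (D i g) = (\<lambda>u. (inverse t - t) * D i g u + g u)"
proof
  fix u
  show "D i (D i g) u = (inverse t - t) * D i g u + g u"
  proof (cases "u \<in> W")
    case True
    define X where "X = uop cc pw i g u"
    have "D i (D i g) u = cc * X - t * X - t * (X - t * g u)"
      unfolding dop_uop[OF True] uop_dop uop_uop[OF hecke_weight_pw] X_def ..
    also have "\<dots> = (inverse t - t) * (X - t * g u) + g u"
      using t_inverse unfolding cc_def by algebra
    finally show ?thesis unfolding dop_uop[OF True] X_def .
  qed (use assms in \<open>simp add: dop_def supp_def\<close>)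
qed

lemma D_G:
  assumes x: "x \<in> W"
  shows "D i (G x) = (\<lambda>u. G (s i \<circ> x) u + (if desc i x then (inverse t - t) * G x u else 0))"
proof (cases "desc i x")
  case True
  have sx: "s i \<circ> x \<in> W" using x by simp
  have "G (s i \<circ> (s i \<circ> x)) = D i (G (s i \<circ> x))"
    by (rule G_ascent[OF sx]) (unfold sref_o_sref_o, use True in simp)
  then have "G x = D i (G (s i \<circ> x))" by (simp only: sref_o_sref_o)
  then have "D i (G x) = (\<lambda>u. (inverse t - t) * G x u + G (s i \<circ> x) u)"
    using D_D[OF supp_G, of i "s i \<circ> x"] by metis
  then show ?thesis using True by (simp add: add.commute)
qed (use G_ascent[OF x] in simp)

text \<open>The image of the sum of f(x) T_x under T_x -> \<tau>_x, in the coordinates of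
  \<open>G\<close>; with \<open>gmult_hecke_map\<close> it becomes a ring homomorphism.\<close>

definition hecke_map :: "('i wg \<Rightarrow> 'k) \<Rightarrow> 'i wg \<Rightarrow> 'k" where
  "hecke_map f = (\<lambda>u. \<Sum>x\<in>W. f x * G x u)"

lemma D_sum: "D i (\<lambda>y. \<Sum>x\<in>X. a x * g x y) = (\<lambda>y. \<Sum>x\<in>X. a x * D i (g x) y)"
proof
  fix u
  show "D i (\<lambda>y. \<Sum>x\<in>X. a x * g x y) u = (\<Sum>x\<in>X. a x * D i (g x) u)"
    by (cases "u \<in> W") (simp_all add: dop_def sum_distrib_left sum_distrib_right sum.distrib sum_subtractf algebra_simps)
qed

lemma hecke_map_lop: "hecke_map (lop (inverse t - t) i f) = D i (hecke_map f)"
proof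
  fix y
  have "hecke_map (lop (inverse t - t) i f) y = (\<Sum>x\<in>W. f x * D i (G x) y)"
    unfolding hecke_map_def lop_adjoint by (rule sum.cong[OF refl]) (simp add: D_G)
  then show "hecke_map (lop (inverse t - t) i f) y = D i (hecke_map f) y" unfolding hecke_map_def by (simp add: D_sum)
qed

subsection \<open>Specialization of the generic parameter\<close>

definition ev :: "laurent \<Rightarrow> 'k" where
  "ev = evl (\<lambda>n. t powi n)"

lemma ev_add: "ev (p + q) = ev p + ev q"
  and ev_sum: "ev (\<Sum>x\<in>X. f x) = (\<Sum>x\<in>X. ev (f x))"
  and ev_0 [simp]: "ev 0 = 0"
  by (simp_all add: ev_def evl_add evl_sum)

lemma ev_mult: "ev (p * q) = ev p * ev q"
  unfolding ev_def by (rule evl_mult) (simp add: power_int_add t_nz)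

lemma ev_tp: "ev (tp n) = t powi n"
  by (simp add: ev_def tp_def)

lemma ev_1 [simp]: "ev 1 = 1"
  using ev_tp[of 0] by simp

lemma ev_of_int: "ev (of_int a) = of_int a"
proof -
  have "Poly_Mapping.single 0 a = (of_int a :: laurent)" by (metis single_of_int of_int_eq_id id_apply)
  then show ?thesis using evl_single[of "\<lambda>n. t powi n" 0 a] by (simp add: ev_def)
qed

lemma ev_lsgn: "ev (lsgn x) = (- 1) ^ len x"
  unfolding lsgn_def ev_of_int by simp

lemma ev_zz: "ev zz = inverse t - t"
  by (simp add: zz_def tt_def ti_def ev_def evl_diff tp_def power_int_minus)

lemma ev_lbar: "ev (lbar p) = evl (\<lambda>n. inverse t powi n) p"
proof -
  have "ev (lbar p) = (\<Sum>n\<in>keys p. of_int (lookup p n) * t powi (- n))"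
    unfolding lbar_def evl_def[of _ p] by (simp add: ev_sum ev_mult ev_of_int ev_tp)
  then show ?thesis by (simp add: evl_def power_int_minus power_int_inverse)
qed

lemma act_of_int: "u \<in> W \<Longrightarrow> act u (of_int n) = of_int n"
proof (induction n rule: int_induct[where k = 0])
  case base
  then show ?case by (simp add: act_zero)
next
  case (step1 i)
  then show ?case by (simp add: act_add act_one)
next
  case (step2 i)
  then show ?case by (simp add: act_diff act_one)
qed

lemma act_power: "u \<in> W \<Longrightarrow> act u (a ^ n) = act u a ^ n"
  by (induction n) (simp_all add: act_one act_mult)

lemma act_powi: "u \<in> W \<Longrightarrow> act u (t powi n) = t powi n"
  by (simp add: power_int_def act_inverse act_power act_t)

lemma act_ev: "u \<in> W \<Longrightarrow> act u (ev p) = ev p"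
  by (simp add: ev_def evl_def act_sum act_mult act_of_int act_powi)

lemma acts_on_ev: "acts_on (ev p)"
  by (simp add: acts_on_def act_ev)

lemma ev_lop: "(\<lambda>x. ev (lop zz i f x)) = lop (inverse t - t) i (\<lambda>x. ev (f x))"
  by (rule ext) (simp add: lop_def ev_add ev_mult ev_zz)

lemma hecke_map_Lw: "hecke_map (\<lambda>x. ev (Lw w f x)) = foldr D (red_word A w) (hecke_map (\<lambda>x. ev (f x)))"
proof -
  have "hecke_map (\<lambda>x. ev (foldr (lop zz) ws f x)) = foldr D ws (hecke_map (\<lambda>x. ev (f x)))" for ws
    by (induction ws) (simp_all add: ev_lop hecke_map_lop)
  then show ?thesis by (simp add: Lw_def)
qed

subsection \<open>Products\<close>

text \<open>The product of the twisted group algebra when \<open>g\<close> encodes the element \<open>\<Sum>u. act u (g u) \<delta>\<^sub>u\<close>.\<close>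

definition gmult :: "('i wg \<Rightarrow> 'k) \<Rightarrow> ('i wg \<Rightarrow> 'k) \<Rightarrow> 'i wg \<Rightarrow> 'k" where
  "gmult g g' = (\<lambda>u. if u \<in> W then \<Sum>v\<in>W. act (inv u \<circ> v) (g v) * g' (inv v \<circ> u) else 0)"

text \<open>The weight at v^-1 \<alpha>_i is carried by u^-1 v to the weight at u^-1 \<alpha>_i,
  which does not depend on the summation index. The remaining shift by \<open>s i\<close> is
  absorbed by reindexing.\<close>

lemma gmult_D: "gmult (D i g) g' = D i (gmult g g')"
proof
  fix u
  show "gmult (D i g) g' u = D i (gmult g g') u"
  proof (cases "u \<in> W")
    case u: True
    have su: "s i \<circ> u \<in> W" using u by simp
    let ?p = "pw (inv u (\<alpha> i))"
    have "gmult (D i g) g' u = (\<Sum>v\<in>W. (?p - t) * (act (inv u \<circ> v) (g v) * g' (inv v \<circ> u))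
        + (cc - ?p) * (act (inv u \<circ> v) (g (s i \<circ> v)) * g' (inv v \<circ> u)))"
      unfolding gmult_def if_P[OF u]
    proof (rule sum.cong[OF refl])
      fix v assume v: "v \<in> W"
      have uv: "inv u \<circ> v \<in> W" using u v by simp
      have "(inv u \<circ> v) (inv v (\<alpha> i)) = inv u (\<alpha> i)" using v by (simp add: weyl_apply_inv)
      then have "act (inv u \<circ> v) (D i g v) = (?p - t) * act (inv u \<circ> v) (g v)
          + (cc - ?p) * act (inv u \<circ> v) (g (s i \<circ> v))"
        unfolding dop_def if_P[OF v] act_add[OF uv] act_mult[OF uv] act_diff[OF uv] act_pw[OF uv] act_cc[OF uv] act_t[OF uv]
        by (simp only:)
      then show "act (inv u \<circ> v) (D i g v) * g' (inv v \<circ> u)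
        = (?p - t) * (act (inv u \<circ> v) (g v) * g' (inv v \<circ> u))
        + (cc - ?p) * (act (inv u \<circ> v) (g (s i \<circ> v)) * g' (inv v \<circ> u))"
        by (simp only: distrib_right mult.assoc)
    qed
    also have "\<dots> = (?p - t) * gmult g g' u
        + (cc - ?p) * (\<Sum>v\<in>W. act (inv u \<circ> v) (g (s i \<circ> v)) * g' (inv v \<circ> u))"
      unfolding gmult_def if_P[OF u] by (simp only: sum.distrib sum_distrib_left)
    also have "(\<Sum>v\<in>W. act (inv u \<circ> v) (g (s i \<circ> v)) * g' (inv v \<circ> u)) = gmult g g' (s i \<circ> u)"
    proof -
      have "gmult g g' (s i \<circ> u)
          = (\<Sum>v\<in>W. act (inv (s i \<circ> u) \<circ> (s i \<circ> v)) (g (s i \<circ> v)) * g' (inv (s i \<circ> v) \<circ> (s i \<circ> u)))"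
        unfolding gmult_def if_P[OF su]
        by (rule sum_weyl_sref[symmetric, of "\<lambda>v. act (inv (s i \<circ> u) \<circ> v) (g v) * g' (inv v \<circ> (s i \<circ> u))"])
      also have "\<dots> = (\<Sum>v\<in>W. act (inv u \<circ> v) (g (s i \<circ> v)) * g' (inv v \<circ> u))"
        by (rule sum.cong[OF refl]) (simp only: inv_sref_comp u comp_assoc sref_o_sref_o)
      finally show ?thesis ..
    qed
    finally show ?thesis unfolding dop_def if_P[OF u] .
  qed (simp add: gmult_def dop_def)
qed

lemma gmult_unit_e:
  assumes "supp g'" shows "gmult unit_e g' = g'"
proof
  fix u
  show "gmult unit_e g' u = g' u"
  proof (cases "u \<in> W")
    case u: True
    have "gmult unit_e g' u = (\<Sum>v\<in>W. if v = id then g' u else 0)"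
      unfolding gmult_def if_P[OF u]
    proof (rule sum.cong[OF refl])
      fix v assume v: "v \<in> W"
      have uv: "inv u \<circ> v \<in> W" using u v by simp
      show "act (inv u \<circ> v) (unit_e v) * g' (inv v \<circ> u) = (if v = id then g' u else 0)"
      proof (cases "v = id")
        case True
        have "act (inv u \<circ> v) (unit_e v) = 1" unfolding True unit_e_id using act_one[OF uv] True by metis
        then show ?thesis unfolding True inv_id id_comp by simp
      next
        case False
        then have "unit_e v = (0 :: 'k)" by (simp add: unit_e_def)
        then show ?thesis using False act_zero[OF uv] by simp
      qed
    qed
    then show ?thesis by (simp add: sum.delta)
  qed (use assms in \<open>simp add: gmult_def supp_def\<close>)
qed

lemma supp_hecke_map: "supp (hecke_map f)"
  using supp_G by (simp add: supp_def hecke_map_def)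

lemma gmult_hecke_map:
  "gmult (hecke_map (\<lambda>x. ev (f x))) (hecke_map (\<lambda>x. ev (g x))) = hecke_map (\<lambda>x. ev (hprod f g x))"
proof
  fix u
  let ?g = "hecke_map (\<lambda>x. ev (g x))"
  have G: "gmult (G x) ?g = hecke_map (\<lambda>y. ev (Lw x g y))" for x
  proof -
    have "gmult (foldr D ws unit_e) ?g = foldr D ws ?g" for ws
      by (induction ws) (simp_all add: gmult_D gmult_unit_e supp_hecke_map)
    then show ?thesis unfolding hecke_map_Lw G_def .
  qed
  show "gmult (hecke_map (\<lambda>x. ev (f x))) ?g u = hecke_map (\<lambda>x. ev (hprod f g x)) u"
  proof (cases "u \<in> W")
    case u: True
    have "gmult (hecke_map (\<lambda>x. ev (f x))) ?g u
        = (\<Sum>v\<in>W. \<Sum>x\<in>W. ev (f x) * (act (inv u \<circ> v) (G x v) * ?g (inv v \<circ> u)))"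
      unfolding gmult_def if_P[OF u] hecke_map_def[of "\<lambda>x. ev (f x)"]
    proof (rule sum.cong[OF refl])
      fix v assume v: "v \<in> W"
      have uv: "inv u \<circ> v \<in> W" using u v by simp
      show "act (inv u \<circ> v) (\<Sum>x\<in>W. ev (f x) * G x v) * ?g (inv v \<circ> u)
        = (\<Sum>x\<in>W. ev (f x) * (act (inv u \<circ> v) (G x v) * ?g (inv v \<circ> u)))"
        by (simp only: act_sum[OF uv] act_mult[OF uv] act_ev[OF uv] sum_distrib_right mult.assoc)
    qed
    also have "\<dots> = (\<Sum>x\<in>W. \<Sum>v\<in>W. ev (f x) * (act (inv u \<circ> v) (G x v) * ?g (inv v \<circ> u)))" by (rule sum.swap)
    also have "\<dots> = (\<Sum>x\<in>W. ev (f x) * gmult (G x) ?g u)"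
      unfolding gmult_def if_P[OF u] by (simp only: sum_distrib_left)
    also have "\<dots> = (\<Sum>x\<in>W. \<Sum>y\<in>W. ev (f x) * (ev (Lw x g y) * G y u))"
      unfolding G by (simp only: hecke_map_def sum_distrib_left)
    also have "\<dots> = (\<Sum>y\<in>W. \<Sum>x\<in>W. ev (f x) * (ev (Lw x g y) * G y u))" by (rule sum.swap)
    also have "\<dots> = hecke_map (\<lambda>x. ev (hprod f g x)) u"
      by (simp only: hecke_map_def hprod_def ev_sum ev_mult sum_distrib_right mult.assoc)
    finally show ?thesis .
  next
    case False
    then show ?thesis using supp_hecke_map[of "\<lambda>x. ev (hprod f g x)"] by (simp add: gmult_def supp_def)
  qed
qed

subsection \<open>The top coefficient\<close>

lemma finite_roots: "finite \<Phi>"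
proof -
  have "\<Phi> = (\<lambda>(w, i). w (\<alpha> i)) ` (W \<times> UNIV)" by (auto simp: roots_def)
  then show ?thesis by simp
qed

lemma neg_roots_iff: "\<gamma> \<in> neg_roots A \<longleftrightarrow> - \<gamma> \<in> \<Phi>pos"
  unfolding neg_roots_def by (metis image_iff minus_minus)

lemma neg_roots_root: "\<gamma> \<in> neg_roots A \<Longrightarrow> \<gamma> \<in> \<Phi>"
  using neg_roots_iff pos_roots_root minus_root_iff by metis

lemma finite_neg_roots: "finite (neg_roots A)"
  using finite_subset[OF _ finite_roots] neg_roots_root by blast

lemma G_id: "G id = unit_e"
  by (simp add: G_def)

lemma G_step:
  assumes "x \<in> W" "\<not> desc i x" "u \<in> W"
  shows "G (s i \<circ> x) u = (pw (inv u (\<alpha> i)) - t) * G x u + (cc - pw (inv u (\<alpha> i))) * G x (s i \<circ> u)"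
  unfolding G_ascent[OF assms(1,2)] dop_def using assms(3) by simp

lemma G_triangular:
  assumes "x \<in> W" "G x u \<noteq> 0" shows "u = x \<or> len u < len x"
proof (rule length_triangular[of x G])
  show supp: "u \<in> W" if "G x u \<noteq> 0" for x u using that supp_G[of x] unfolding supp_def by blast
  show "G x u \<noteq> 0 \<or> G x (s i \<circ> u) \<noteq> 0" if "x \<in> W" "\<not> desc i x" "G (s i \<circ> x) u \<noteq> 0" for i x u
    using that(3) unfolding G_step[OF that(1,2) supp[OF that(3)]] by (metis add.right_neutral mult_zero_right)
  show "u = id" if "G id u \<noteq> 0" for u using that unit_e_nz unfolding G_id by blast
qed (use assms in blast)+

text \<open>By triangularity only the \<delta>_i part of \<tau>_i reaches the new top element. Its
  factor belongs to the root - x^-1 \<alpha>_i, exactly the one by which the set of negative roots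
  made positive grows.\<close>

lemma G_diag:
  assumes "x \<in> W" shows "G x x = (\<Prod>\<gamma>\<in>{\<gamma> \<in> neg_roots A. x \<gamma> \<in> \<Phi>pos}. cc - pw \<gamma>)"
  using assms
proof (induction rule: reduced_induct)
  case id
  have "{\<gamma> \<in> neg_roots A. id \<gamma> \<in> \<Phi>pos} = {}" using neg_roots_iff not_pos_and_neg by (auto simp: id_def)
  then show ?case unfolding G_id using unit_e_id by (metis prod.empty)
next
  case (sref i x)
  let ?y = "s i \<circ> x"
  have x: "x \<in> W" and y: "?y \<in> W" using sref(1) by simp_all
  have l: "len ?y = Suc (len x)" by (rule len_ascent[OF sref(1,2)])
  let ?\<gamma> = "- inv x (\<alpha> i)"
  have px: "inv x (\<alpha> i) \<in> \<Phi>pos" using descent_iff(1)[OF x] sref(2) by blast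
  have "?y \<noteq> x" using l by auto
  then have "G x ?y = 0" using G_triangular[OF x, of ?y] l by fastforce
  then have M: "G ?y ?y = (cc - pw ?\<gamma>) * G x x"
    unfolding G_step[OF sref(1,2) y] inv_sref_root[OF x] sref_o_sref_o by simp
  have S: "{\<gamma> \<in> neg_roots A. ?y \<gamma> \<in> \<Phi>pos} = insert ?\<gamma> {\<gamma> \<in> neg_roots A. x \<gamma> \<in> \<Phi>pos}"
  proof (intro equalityI subsetI)
    fix \<gamma> assume "\<gamma> \<in> {\<gamma> \<in> neg_roots A. ?y \<gamma> \<in> \<Phi>pos}"
    then have g: "\<gamma> \<in> neg_roots A" "s i (x \<gamma>) \<in> \<Phi>pos" by simp_all
    show "\<gamma> \<in> insert ?\<gamma> {\<gamma> \<in> neg_roots A. x \<gamma> \<in> \<Phi>pos}"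
    proof (cases "s i (x \<gamma>) = \<alpha> i")
      case True
      then have "x \<gamma> = - \<alpha> i" by (metis sref_simple_root sref_sref)
      then have "\<gamma> = inv x (- \<alpha> i)" by (metis weyl_inv_apply x)
      then have "\<gamma> = ?\<gamma>" using weyl_minus[OF weyl_inv[OF x]] by simp
      then show ?thesis by simp
    next
      case False
      from sref_pos[OF g(2) this] g(1) show ?thesis by simp
    qed
  next
    fix \<gamma> assume "\<gamma> \<in> insert ?\<gamma> {\<gamma> \<in> neg_roots A. x \<gamma> \<in> \<Phi>pos}"
    then consider "\<gamma> = ?\<gamma>" | "\<gamma> \<in> neg_roots A" "x \<gamma> \<in> \<Phi>pos" by blast
    then show "\<gamma> \<in> {\<gamma> \<in> neg_roots A. ?y \<gamma> \<in> \<Phi>pos}"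
    proof cases
      case 1
      have "x ?\<gamma> = - \<alpha> i" by (simp only: weyl_minus[OF x] weyl_apply_inv[OF x])
      then have "s i (x ?\<gamma>) = \<alpha> i" by (metis sref_simple_root sref_sref)
      then have "?y ?\<gamma> \<in> \<Phi>pos" by simp
      moreover have "?\<gamma> \<in> neg_roots A" unfolding neg_roots_iff minus_minus by (rule px)
      ultimately show ?thesis unfolding 1 by blast
    next
      case 2
      have "x \<gamma> \<noteq> \<alpha> i"
      proof
        assume "x \<gamma> = \<alpha> i"
        then have "\<gamma> = inv x (\<alpha> i)" by (metis weyl_inv_apply x)
        then show False using px 2(1) neg_roots_iff not_pos_and_neg by metis
      qed
      then show ?thesis using sref_pos[OF 2(2)] 2(1) by simp
    qed
  qed
  have N: "?\<gamma> \<notin> {\<gamma> \<in> neg_roots A. x \<gamma> \<in> \<Phi>pos}"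
  proof -
    have "x ?\<gamma> = - \<alpha> i" by (simp only: weyl_minus[OF x] weyl_apply_inv[OF x])
    then show ?thesis using not_pos_and_neg[OF simple_root_pos[of i]] by simp
  qed
  have fin: "finite {\<gamma> \<in> neg_roots A. x \<gamma> \<in> \<Phi>pos}" using finite_neg_roots by simp
  show ?case unfolding M S prod.insert[OF fin N] sref(3) ..
qed

lemma longest_neg_roots:
  assumes "\<gamma> \<in> neg_roots A"
  shows "lo \<gamma> \<in> \<Phi>pos"
proof -
  have "lo (- \<gamma>) \<notin> \<Phi>pos" using longest_neg assms neg_roots_iff by blast
  then show ?thesis
    using weyl_minus[OF longest(1), of \<gamma>] minus_pos_iff[of "lo \<gamma>"] neg_roots_root[OF assms] longest(1) by simp
qed

lemma hecke_map_longest: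
  "hecke_map f lo = f lo * (\<Prod>\<gamma>\<in>neg_roots A. cc - pw \<gamma>)"
proof -
  have "f x * G x lo = (if x = lo then f x * G x lo else 0)" if "x \<in> W" for x
    using G_triangular[OF that, of lo] len_less_longest[OF that] by (metis less_asym mult_zero_right)
  then have "hecke_map f lo = (\<Sum>x\<in>W. if x = lo then f x * G x lo else 0)"
    unfolding hecke_map_def by (rule sum.cong[OF refl])
  also have "\<dots> = f lo * G lo lo" using longest(1) by (simp add: sum.delta)
  also have "{\<gamma> \<in> neg_roots A. lo \<gamma> \<in> \<Phi>pos} = neg_roots A"
    using longest_neg_roots by blast
  then have "G lo lo = (\<Prod>\<gamma>\<in>neg_roots A. cc - pw \<gamma>)" using G_diag[OF longest(1)] by metis
  finally show ?thesis .
qed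

subsection \<open>The pairing\<close>

text \<open>Stated for any nonzero \<tau>, since \<open>kl_gamma\<close> uses \<tau> = t, while the
  bar in \<open>twist\<close> calls for \<tau> = 1/t in \<open>kl_gamma_tilde\<close>.\<close>

lemma evl_klb:
  fixes \<tau> :: 'k
  assumes w: "w \<in> W" and v: "v \<in> W" and \<tau>: "\<tau> \<noteq> 0"
  shows "evl (\<lambda>n. \<tau> powi n) (klb w v)
    = \<tau> ^ len w * inverse (\<tau> ^ len v) * poly (map_poly of_int (klp v w)) (inverse \<tau> ^ 2)"
proof -
  define n where "n k = int (len w) - int (len v) - 2 * int k" for k
  have keys: "keys (klb w v) \<subseteq> n ` {..len w}"
  proof
    fix m assume m: "m \<in> keys (klb w v)"
    then have lk: "lookup (klb w v) m \<noteq> 0" by (simp add: in_keys_iff)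
    have "0 \<le> m"
    proof (cases "v = w")
      case True
      then show ?thesis using lk klb_diag[OF w] by (auto simp: lookup_one when_def split: if_splits)
    next
      case False
      then show ?thesis using lk klb_pos[OF w False] unfolding lpos_def by (meson linear)
    qed
    moreover have "m \<le> int (len w) - int (len v)" "even (int (len w) - int (len v) - m)"
      using klb_degree[OF w v lk] by blast+
    moreover from this(2) obtain k where "int (len w) - int (len v) - m = 2 * k" by (rule evenE)
    ultimately have k: "int (len w) - int (len v) - m = 2 * k" "0 \<le> k" "k \<le> int (len w)" by linarith+
    then have "m = n (nat k)" "nat k \<le> len w" by (simp_all add: n_def)
    then show "m \<in> n ` {..len w}" by blast
  qed
  have inj: "inj_on n {..len w}" by (rule inj_onI) (simp add: n_def)
  have pow: "\<tau> powi n k = \<tau> ^ len w * inverse (\<tau> ^ len v) * (inverse \<tau> ^ 2) ^ k" for k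
  proof -
    have "\<tau> powi n k = \<tau> powi int (len w) / \<tau> powi int (len v) / \<tau> powi int (2 * k)"
      using \<tau> by (simp add: n_def power_int_diff)
    then show ?thesis unfolding power_int_of_nat by (simp add: divide_inverse power_mult power_inverse)
  qed
  have deg: "degree (map_poly of_int (klp v w) :: 'k poly) \<le> len w"
    by (rule degree_le) (auto simp: coeff_map_poly klp_def coeff_sum)
  have "poly (map_poly of_int (klp v w)) (inverse \<tau> ^ 2)
      = (\<Sum>k\<le>len w. coeff (map_poly of_int (klp v w)) k * (inverse \<tau> ^ 2) ^ k)"
    unfolding poly_altdef by (rule sum.mono_neutral_left) (use deg in \<open>auto simp: coeff_eq_0\<close>)
  also have "\<dots> = (\<Sum>k\<le>len w. of_int (lookup (klb w v) (n k)) * (inverse \<tau> ^ 2) ^ k)"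
    by (simp add: coeff_map_poly coeff_klp[OF v w] n_def)
  finally have p: "poly (map_poly of_int (klp v w)) (inverse \<tau> ^ 2)
      = (\<Sum>k\<le>len w. of_int (lookup (klb w v) (n k)) * (inverse \<tau> ^ 2) ^ k)" .
  have "evl (\<lambda>n. \<tau> powi n) (klb w v) = (\<Sum>k\<le>len w. of_int (lookup (klb w v) (n k)) * \<tau> powi n k)"
    unfolding evl_superset[OF finite_imageI[OF finite_atMost] keys] by (simp add: sum.reindex[OF inj])
  then show ?thesis unfolding p pow by (simp add: sum_distrib_left mult.assoc mult.left_commute)
qed

lemma kl_gamma_hecke_map:
  assumes w: "w \<in> W" and u: "u \<in> W"
  shows "kl_gamma A t e act w u = act u (hecke_map (\<lambda>x. ev (klb w x)) u)"
proof -
  have "kl_gamma A t e act w u = (\<Sum>x\<in>{v \<in> W. bruhat v w}. ev (klb w x) * act u (G x u))"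
    unfolding kl_gamma_def scal_def kl_poly_eq
    by (rule sum.cong[OF refl]) (simp add: ev_def evl_klb w t_nz tau_w_G u)
  also have "\<dots> = (\<Sum>x\<in>W. ev (klb w x) * act u (G x u))"
  proof (rule sum.mono_neutral_left)
    have "ev (klb w x) = 0" if "\<not> bruhat x w" for x using klb_bruhat[OF w, of x] that ev_0 by metis
    then show "\<forall>x\<in>W - {v \<in> W. bruhat v w}. ev (klb w x) * act u (G x u) = 0" by simp
  qed auto
  also have "\<dots> = act u (hecke_map (\<lambda>x. ev (klb w x)) u)"
    by (simp add: hecke_map_def act_sum act_mult act_ev u)
  finally show ?thesis .
qed

lemma kl_gamma_tilde_hecke_map:
  assumes y: "y \<in> W" and u: "u \<in> W"
  shows "kl_gamma_tilde A t e act y u = act u (hecke_map (\<lambda>x. ev (lsgn y * twist (klb y) x)) u)"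
proof -
  have "kl_gamma_tilde A t e act y u = (\<Sum>x\<in>W. ev (lsgn y * twist (klb y) x) * act u (G x u))"
    unfolding kl_gamma_tilde_def scal_def kl_poly_eq
  proof (rule sum.cong[OF refl])
    fix x assume x: "x \<in> W"
    have "ev (lsgn y * twist (klb y) x) = (-1) ^ len y * ((-1) ^ len x * evl (\<lambda>n. inverse t powi n) (klb y x))"
      by (simp only: twist_def ev_mult ev_lbar ev_lsgn)
    also have "\<dots> = (-1) ^ len y * (-1) ^ len x * inverse (t ^ len y) * t ^ len x
        * poly (map_poly of_int (klp x y)) (t ^ 2)"
      using evl_klb[OF y x, of "inverse t"] t_nz by (simp add: power_inverse)
    finally show "(-1) ^ len y * (-1) ^ len x * inverse (t ^ len y) * t ^ len x
        * poly (map_poly of_int (klp x y)) (t ^ 2) * tau_w A t e act x u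
      = ev (lsgn y * twist (klb y) x) * act u (G x u)"
      by (simp add: tau_w_G x u)
  qed
  also have "\<dots> = act u (hecke_map (\<lambda>x. ev (lsgn y * twist (klb y) x)) u)"
    by (simp add: hecke_map_def act_sum act_mult act_ev u)
  finally show ?thesis .
qed

lemma acts_on_x_Pi: "acts_on (x_Pi A e)"
  unfolding x_Pi_def by (intro acts_on_prod acts_on_diff acts_on_1 acts_on_e)

lemma x_Pi_nz: "x_Pi A e \<noteq> 0"
  unfolding x_Pi_def using e_neq_1[OF neg_roots_root] by (simp add: prod_zero_iff finite_neg_roots)

lemma KL_C_at:
  assumes "u \<in> W"
  shows "KL_C A t e act w u = kl_gamma A t e act w u * act u (x_Pi A e)"
proof -
  have "KL_C A t e act w u
      = (\<Sum>v\<in>W. if v = u then kl_gamma A t e act w v * act v (x_Pi A e) else 0)"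
    unfolding KL_C_def odot_def
  proof (rule sum.cong[OF refl])
    fix v assume v: "v \<in> W"
    have "(\<Sum>x\<in>{x \<in> W. v \<circ> x = u}. kl_gamma A t e act w v * act v (pt A act e id x))
        = (\<Sum>x\<in>{x \<in> {id}. v = u}. kl_gamma A t e act w v * act v (pt A act e id x))"
      by (rule sum.mono_neutral_right) (use v in \<open>auto simp: pt_def act_zero\<close>)
    then show "(\<Sum>x\<in>{x \<in> W. v \<circ> x = u}. kl_gamma A t e act w v * act v (pt A act e id x))
        = (if v = u then kl_gamma A t e act w v * act v (x_Pi A e) else 0)"
      using acts_onD(1)[OF acts_on_x_Pi] by (simp add: pt_def)
  qed
  then show ?thesis using assms by (simp add: sum.delta)
qed

text \<open>The point class is concentrated at \<open>lo\<close>, so the right action picks out the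
  single coefficient at the x with \<open>u \<circ> x = lo\<close>.\<close>

lemma KL_Ct_at:
  assumes u: "u \<in> W"
  shows "KL_Ct A t e act v u = act lo (x_Pi A e)
    * act u (kl_gamma_tilde A t e act (inv v \<circ> lo) (inv u \<circ> lo))"
proof -
  let ?h = "kl_gamma_tilde A t e act (inv v \<circ> lo)"
  have ul: "inv u \<circ> lo \<in> W" using u longest(1) by simp
  have "KL_Ct A t e act v u
      = (\<Sum>x\<in>W. if x = inv u \<circ> lo then act lo (x_Pi A e) * act u (?h x) else 0)"
    unfolding KL_Ct_def bullet_def
  proof (rule sum.cong[OF refl])
    fix x assume x: "x \<in> W"
    have ux: "u \<circ> x \<in> W" using u x by simp
    have "{y \<in> W. u \<circ> x = y} = {u \<circ> x}" using ux by blast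
    then have "(\<Sum>y\<in>{y \<in> W. u \<circ> x = y}. pt A act e lo y * act u (?h x)) = pt A act e lo (u \<circ> x) * act u (?h x)"
      by simp
    moreover have "u \<circ> x = lo \<longleftrightarrow> x = inv u \<circ> lo"
      using weyl_inv_comp(3)[OF u, of x] weyl_inv_comp(4)[OF u, of lo] by metis
    ultimately show "(\<Sum>y\<in>{y \<in> W. u \<circ> x = y}. pt A act e lo y * act u (?h x))
      = (if x = inv u \<circ> lo then act lo (x_Pi A e) * act u (?h x) else 0)"
      unfolding pt_def by simp
  qed
  then show ?thesis using ul by (simp only: sum.delta finite_weyl if_True)
qed

lemma longest_bij: "bij_betw lo (neg_roots A) \<Phi>pos"
proof (rule bij_betw_byWitness[where f' = "inv lo"])
  note lo = longest(1)
  show "\<forall>\<gamma>\<in>neg_roots A. inv lo (lo \<gamma>) = \<gamma>" using lo by simp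
  show "\<forall>\<beta>\<in>\<Phi>pos. lo (inv lo \<beta>) = \<beta>" using weyl_apply_inv[OF lo] by simp
  show "lo ` neg_roots A \<subseteq> \<Phi>pos" using longest_neg_roots by blast
  show "inv lo ` \<Phi>pos \<subseteq> neg_roots A"
  proof
    fix \<gamma> assume "\<gamma> \<in> inv lo ` \<Phi>pos"
    then obtain \<beta> where \<beta>: "\<beta> \<in> \<Phi>pos" "\<gamma> = inv lo \<beta>" by blast
    have "\<gamma> \<in> \<Phi>" using \<beta> pos_roots_root[of \<beta>] lo by simp
    then show "\<gamma> \<in> neg_roots A"
      using inv_longest_neg[OF \<beta>(1)] minus_pos_iff[of \<gamma>] \<beta>(2) unfolding neg_roots_iff by blast
  qed
qed

theorem pairing_KL:
  assumes w: "w \<in> W" and v: "v \<in> W"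
  shows "pairing A act e (KL_C A t e act w) (KL_Ct A t e act v)
    = (if w = v then 1 else 0) * (\<Prod>\<alpha>\<in>pos_roots A. t - inverse t * e (- \<alpha>))"
proof -
  let ?y = "inv v \<circ> lo"
  let ?f = "hecke_map (\<lambda>x. ev (klb w x))"
  let ?g = "hecke_map (\<lambda>x. ev (lsgn ?y * twist (klb ?y) x))"
  let ?\<delta> = "if w = v then 1 else 0 :: 'k"
  note lo = longest(1)
  have y: "?y \<in> W" using v lo by simp
  have acts: "acts_on (hecke_map (\<lambda>x. ev (h x)) u)" if "u \<in> W" for h u
    unfolding hecke_map_def by (intro acts_on_sum acts_on_mult acts_on_ev acts_on_G that)
  have "pairing A act e (KL_C A t e act w) (KL_Ct A t e act v)
      = (\<Sum>u\<in>W. act lo (x_Pi A e) * act lo (act (inv lo \<circ> u) (?f u) * ?g (inv u \<circ> lo)))"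
    unfolding pairing_def
  proof (rule sum.cong[OF refl])
    fix u assume u: "u \<in> W"
    have iu: "inv u \<circ> lo \<in> W" and il: "inv lo \<circ> u \<in> W" using u lo by simp_all
    have "KL_C A t e act w u * KL_Ct A t e act v u / act u (x_Pi A e)
      = act lo (x_Pi A e) * (act u (?f u) * act u (act (inv u \<circ> lo) (?g (inv u \<circ> lo))))"
      unfolding KL_C_at[OF u] KL_Ct_at[OF u] kl_gamma_hecke_map[OF w u] kl_gamma_tilde_hecke_map[OF y iu]
      using act_nz[OF u x_Pi_nz] by simp
    \<comment> \<open>The factor x_\<Pi> of C_w has cancelled the denominator. Both remaining
      factors are pulled back through \<open>act lo\<close>, which makes the sum over u the
      \<open>gmult\<close> coefficient at \<open>lo\<close>.\<close>
    also have "act u (act (inv u \<circ> lo) (?g (inv u \<circ> lo))) = act lo (?g (inv u \<circ> lo))"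
      unfolding acts_onD(2)[OF acts[OF iu] u iu] weyl_inv_comp(4)[OF u] ..
    also have "act u (?f u) = act lo (act (inv lo \<circ> u) (?f u))"
      unfolding acts_onD(2)[OF acts[OF u] lo il] weyl_inv_comp(4)[OF lo] ..
    finally show "KL_C A t e act w u * KL_Ct A t e act v u / act u (x_Pi A e)
      = act lo (x_Pi A e) * act lo (act (inv lo \<circ> u) (?f u) * ?g (inv u \<circ> lo))"
      by (simp only: act_mult[OF lo])
  qed
  also have "\<dots> = act lo (x_Pi A e) * act lo (gmult ?f ?g lo)"
    unfolding gmult_def if_P[OF lo] by (simp only: act_sum[OF lo] sum_distrib_left)
  also have "gmult ?f ?g lo = ?\<delta> * (\<Prod>\<gamma>\<in>neg_roots A. cc - pw \<gamma>)"
  proof -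
    have "hprod (klb w) (\<lambda>x. lsgn ?y * twist (klb ?y) x) lo = (if w = v then 1 else 0)"
      unfolding hprod_def by (rule kl_inversion[OF w v refl])
    then have E: "ev (hprod (klb w) (\<lambda>x. lsgn ?y * twist (klb ?y) x) lo) = ?\<delta>" by simp
    show ?thesis unfolding gmult_hecke_map hecke_map_longest E ..
  qed
  \<comment> \<open>The leading coefficient has denominators 1 - e^(-\<gamma>) over the negative
    roots, and x_\<Pi> is precisely their product.\<close>
  also have "act lo (x_Pi A e) * act lo (?\<delta> * (\<Prod>\<gamma>\<in>neg_roots A. cc - pw \<gamma>))
      = ?\<delta> * act lo (\<Prod>\<gamma>\<in>neg_roots A. (1 - e (- \<gamma>)) * (cc - pw \<gamma>))"
    unfolding x_Pi_def prod.distrib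
    by (cases "w = v") (simp_all add: act_mult[OF lo] act_zero[OF lo] act_one[OF lo])
  also have "(\<Prod>\<gamma>\<in>neg_roots A. (1 - e (- \<gamma>)) * (cc - pw \<gamma>)) = (\<Prod>\<gamma>\<in>neg_roots A. t - inverse t * e (- \<gamma>))"
  proof (rule prod.cong[OF refl])
    fix \<gamma> assume "\<gamma> \<in> neg_roots A"
    then have g: "\<gamma> \<in> \<Phi>" by (rule neg_roots_root)
    show "(1 - e (- \<gamma>)) * (cc - pw \<gamma>) = t - inverse t * e (- \<gamma>)"
      unfolding cc_minus_pw[OF g] using e_neq_1[OF g] by simp
  qed
  \<comment> \<open>The product over negative roots becomes one over positive roots because lo
    exchanges the two sets.\<close>
  also have "act lo \<dots> = (\<Prod>\<gamma>\<in>neg_roots A. t - inverse t * e (- lo \<gamma>))"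
    by (simp only: act_prod[OF lo] act_diff[OF lo] act_mult[OF lo] act_inverse[OF lo] act_t[OF lo] act_e[OF lo]
        weyl_minus[OF lo])
  also have "\<dots> = (\<Prod>\<alpha>\<in>\<Phi>pos. t - inverse t * e (- \<alpha>))"
    by (rule prod.reindex_bij_betw[OF longest_bij])
  finally show ?thesis .
qed

end

theorem theorem4p2:
  fixes A :: "'i::finite \<Rightarrow> 'i \<Rightarrow> int"
    and t :: "'k::field"
    and e :: "('i \<Rightarrow> int) \<Rightarrow> 'k"
    and act :: "(('i \<Rightarrow> int) \<Rightarrow> ('i \<Rightarrow> int)) \<Rightarrow> 'k \<Rightarrow> 'k"
    and w v :: "('i \<Rightarrow> int) \<Rightarrow> ('i \<Rightarrow> int)"
  assumes cartan: "finite_type_cartan A"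
    and t_nz: "t \<noteq> 0" and t_inv: "t + inverse t \<noteq> 0"
    and e_zero: "e 0 = 1"
    and e_add: "\<forall>lam mu. e (lam + mu) = e lam * e mu"
    and e_roots: "\<forall>\<beta>\<in>roots A. e \<beta> \<noteq> 1"
    and act_add: "\<forall>u\<in>weyl A. \<forall>a b. act u (a + b) = act u a + act u b"
    and act_mult: "\<forall>u\<in>weyl A. \<forall>a b. act u (a * b) = act u a * act u b"
    and act_one: "\<forall>u\<in>weyl A. act u 1 = 1"
    and act_t: "\<forall>u\<in>weyl A. act u t = t"
    and act_e: "\<forall>u\<in>weyl A. \<forall>lam. act u (e lam) = e (u lam)"
    and w: "w \<in> weyl A" and v: "v \<in> weyl A"
  shows "pairing A act e (KL_C A t e act w) (KL_Ct A t e act v)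
           = (if w = v then 1 else 0) * (\<Prod>\<alpha>\<in>pos_roots A. t - inverse t * e (- \<alpha>))"
proof -
  interpret twisted_datum A t e act
    using assms by unfold_locales blast+
  show ?thesis by (rule pairing_KL[OF w v])
qed

end
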